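(* Let $\nu$ satisfy (H0) and (H1a), and let $A$ be the generator of a Feller semigroup on $C_\infty(\mathbb R^d)$ with $C^\infty_\infty(\mathbb R^d)\subset Dom(A)$. Consider the problem $$(-{}_tD^{(\nu)}_{a+*}+A)u(t,x)=-g(t,x),\ (t,x)\in(a,b]\times\mathbb R^d,\qquad u(a,x)=\phi_a(x),\ x\in\mathbb R^d. \quad (\mathrm{Cap})$$ (i) If $g\in C_\infty([a,b]\times\mathbb R^d)$ and $\phi_a\in Dom(A)$ satisfies $A\phi_a(\cdot)=-g(a,\cdot)$, then there exists a unique solution in the domain of the generator $u\in C_\infty([a,b]\times\mathbb R^d)$ to problem (Cap), and $$u(t,x)=\mathbf E\left[\phi_a\big(X^{x,A}(\tau_a^{(\nu)}(t))\big)\right]+\mathbf E\left[\int_0^{\tau_a^{(\nu)}(t)}g\big(X^{t,(\nu)}_{+}(s),X^{x,A}(s)\big)\,ds\right].\quad ( * )$$ (ii) If $g\in B([a,b]\times\mathbb R^d)$, $\phi_a\in Dom(A)$ and (H2) holds, then there exists a unique generalised solution $u\in B([a,b]\times\mathbb R^d)$ to problem (Cap), and $u$ is given by $( * )$.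
   Context: Fix real numbers $a<b$ and $d\in\mathbb N$. $B(E)$ is the space of bounded Borel functions on $E$, $C(E)$ the bounded continuous functions, $C_\infty(E)$ the continuous functions vanishing at infinity, all with the sup norm $\|\cdot\|$. $C_a([a,b])=\{f\in C([a,b]):f(a)=0\}$ and $C_{a,\infty}([a,b]\times\mathbb R^d)=\{f\in C_\infty([a,b]\times\mathbb R^d):f(a,\cdot)=0\}$. $C_\infty^\infty(\mathbb R^d)$: smooth functions all of whose derivatives lie in $C_\infty(\mathbb R^d)$. "a.e." refers to Lebesgue measure. Assumptions on $\nu:\mathbb R\times(0,\infty)\to[0,\infty)$: (H0) $\nu(t,r)$ is continuous in both variables and continuously differentiable in $t$; $\sup_t\int_0^\infty\min\{1,r\}\nu(t,r)dr<\infty$, $\sup_t\int_0^\infty\min\{1,r\}|\partial_t\nu(t,r)|dr<\infty$, and $\lim_{\delta\to0}\sup_t\int_{0<r\le\delta}r\nu(t,r)dr=0$. (H1a) There exist $\epsilon,\delta>0$ with $\nu(t,r)\ge\delta$ for all $t$ and all $0<r<\epsilon$. Operators: for $t\in(a,b]$, $-D^{(\nu)}_{a+*}f(t)=\int_0^{t-a}(f(t-r)-f(t))\nu(t,r)dr+(f(a)-f(t))\int_{t-a}^\infty\nu(t,r)dr$ (Caputo type), $-D^{(\nu)}_{a+}f(t)=\int_0^{t-a}(f(t-r)-f(t))\nu(t,r)dr-f(t)\int_{t-a}^\infty\nu(t,r)dr$ (Riemann-Liouville, RL, type), $-D^{(\nu)}_+f(t)=\int_0^\infty(f(t-r)-f(t))\nu(t,r)dr$.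 A left subscript $t$ indicates the variable acted on. Under (H0) it is known that: $-D_+^{(\nu)}$ generates a Feller semigroup on $C_\infty((-\infty,b])$ with core $\{f\in C^1_\infty((-\infty,b]):-D_+^{(\nu)}f\in C_\infty((-\infty,b])\}$, and $X_+^{t,(\nu)}$ is the corresponding (non-increasing) Feller process started at $t$, with transition probabilities $p_s^{(\nu)+}(t,\cdot)$; $-D^{(\nu)}_{a+}$ generates a strongly continuous semigroup $T_s$ of positive contractions on $C_a([a,b])$ with core $C^1([a,b])\cap C_a([a,b])$. Put $\tau_a^{(\nu)}(t)=\inf\{s\ge0:X_+^{t,(\nu)}(s)\le a\}$. $X^{x,A}$ is the Feller process on $\mathbb R^d$ generated by $A$ started at $x$, taken independent of $X_+^{t,(\nu)}$; $p_s^A(x,\cdot)$ is the law of $X^{x,A}(s)$; $e^{As}$ is its semigroup. (H2) For every $t\in[a,b]$, $x\in\mathbb R^d$, $s>0$, the measures $p_s^{(\nu)+}(t,\cdot)$ and $p_s^A(x,\cdot)$ are absolutely continuous with respect to Lebesgue measure. $L$ denotes the generator of the strongly continuous semigroup $T_se^{As}$ on $C_{a,\infty}([a,b]\times\mathbb R^d)$ ($T_s$ acting in $t$, $e^{As}$ acting in $x$); it is the closure of $-D^{(\nu)}_{a+}+A$ on the linear span of products $f(t)h(x)$, $f\in Dom(-D^{(\nu)}_{a+})$, $h\in Dom(A)$. RL problem: $(-{}_tD^{(\nu)}_{a+}+A)\tilde u=-\tilde g$ on $(a,b]\times\mathbb R^d$, $\tilde u(a,\cdot)=0$. For $\tilde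 g\in C_{a,\infty}([a,b]\times\mathbb R^d)$, a solution in the domain of the generator of the RL problem is $\tilde u\in Dom(L)\subset C_{a,\infty}([a,b]\times\mathbb R^d)$ with $L\tilde u=-\tilde g$. For $\tilde g\in B([a,b]\times\mathbb R^d)$, a generalised solution of the RL problem is $\tilde u\in B([a,b]\times\mathbb R^d)$ that is the pointwise limit of $u_n$, where $u_n$ is the solution in the domain of the generator of the RL problem with right-hand side $g_n\in C_{a,\infty}([a,b]\times\mathbb R^d)$, $g_n\to\tilde g$ a.e. and $\sup_n\|g_n\|<\infty$. Caputo problem (Cap): for $g\in C([a,b]\times\mathbb R^d)$, $\phi_a\in Dom(A)$ with $A\phi_a=-g(a,\cdot)$, a solution in the domain of the generator is $u=\tilde u+\phi_a$ with $\tilde u$ a solution in the domain of the generator of the RL problem with $\tilde g=g+A\phi_a\in C_{a,\infty}([a,b]\times\mathbb R^d)$. For $g\in B([a,b]\times\mathbb R^d)$, $\phi_a\in Dom(A)$, a generalised solution is $u=\tilde u+\phi_a$ with $\tilde u$ a generalised solution of the RL problem with $\tilde g=g+A\phi_a$. *)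

theory Defs
  imports "HOL-Probability.Probability"
begin

section \<open>Function spaces\<close>

text \<open>
  A real function on a subset \<open>E\<close> of a type is represented by the total function that is \<open>0\<close> off \<open>E\<close>.
  This representative is unique, so equality of functions on \<open>E\<close> is HOL equality, and the
  sup norm over \<open>E\<close> is the sup norm over the whole type.
\<close>

definition sup_norm :: "('a \<Rightarrow> real) \<Rightarrow> real" where
  "sup_norm f = (SUP x. \<bar>f x\<bar>)"

definition C0 :: "'a::topological_space set \<Rightarrow> ('a \<Rightarrow> real) set" where
  "C0 E = {f. continuous_on E f \<and> (\<forall>x. x \<notin> E \<longrightarrow> f x = 0) \<and>
    (\<forall>\<epsilon>>0. \<exists>K. compact K \<and> K \<subseteq> E \<and> (\<forall>x\<in>E - K. \<bar>f x\<bar> < \<epsilon>))}"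

definition bounded_borel :: "'a::topological_space set \<Rightarrow> ('a \<Rightarrow> real) set" where
  "bounded_borel E = {f. f \<in> borel_measurable borel \<and> bounded (range f) \<and> (\<forall>x. x \<notin> E \<longrightarrow> f x = 0)}"

text \<open>Since \<open>{a..b}\<close> is compact, \<open>C0 {a..b}\<close> is the space of all continuous functions on \<open>[a,b]\<close>.\<close>

definition Ca :: "real \<Rightarrow> real \<Rightarrow> (real \<Rightarrow> real) set" where
  "Ca a b = {f \<in> C0 {a..b}. f a = 0}"

definition Ca0 :: "real \<Rightarrow> real \<Rightarrow> (real \<times> 'a::topological_space \<Rightarrow> real) set" where
  "Ca0 a b = {f \<in> C0 ({a..b} \<times> UNIV). \<forall>x. f (a, x) = 0}"

text \<open>Functions in \<open>C0 E\<close> with derivative (one-sided at boundary points) in \<open>C0 E\<close>; for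
  \<open>E = {a..b}\<close> this is \<open>C\<^sup>1([a,b])\<close>.\<close>

definition C1_0 :: "real set \<Rightarrow> (real \<Rightarrow> real) set" where
  "C1_0 E = {f \<in> C0 E. \<exists>f'\<in>C0 E. \<forall>t\<in>E. (f has_real_derivative f' t) (at t within E)}"

fun Ck_0 :: "nat \<Rightarrow> (real ^ 'd \<Rightarrow> real) \<Rightarrow> bool" where
  "Ck_0 0 f \<longleftrightarrow> f \<in> C0 UNIV"
| "Ck_0 (Suc k) f \<longleftrightarrow> f \<in> C0 UNIV \<and> (\<forall>x. f differentiable (at x)) \<and>
     (\<forall>i. Ck_0 k (\<lambda>x. frechet_derivative f (at x) (axis i 1)))"

definition Cinf_0 :: "(real ^ 'd \<Rightarrow> real) set" where
  "Cinf_0 = {f. \<forall>k. Ck_0 k f}"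


section \<open>Semigroups and generators\<close>

definition pos_contraction_semigroup ::
    "('a \<Rightarrow> real) set \<Rightarrow> (real \<Rightarrow> ('a \<Rightarrow> real) \<Rightarrow> ('a \<Rightarrow> real)) \<Rightarrow> bool" where
  "pos_contraction_semigroup V T \<longleftrightarrow>
    (\<forall>s\<ge>0. \<forall>f\<in>V. T s f \<in> V) \<and>
    (\<forall>s\<ge>0. \<forall>f\<in>V. \<forall>g\<in>V. \<forall>\<alpha> \<beta>. T s (\<lambda>x. \<alpha> * f x + \<beta> * g x) = (\<lambda>x. \<alpha> * T s f x + \<beta> * T s g x)) \<and>
    (\<forall>f\<in>V. T 0 f = f) \<and>
    (\<forall>s\<ge>0. \<forall>r\<ge>0. \<forall>f\<in>V. T (s + r) f = T s (T r f)) \<and>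
    (\<forall>s\<ge>0. \<forall>f\<in>V. (\<forall>x. 0 \<le> f x) \<longrightarrow> (\<forall>x. 0 \<le> T s f x)) \<and>
    (\<forall>s\<ge>0. \<forall>f\<in>V. sup_norm (T s f) \<le> sup_norm f) \<and>
    (\<forall>f\<in>V. uniform_limit UNIV (\<lambda>s. T s f) f (at_right 0))"

text \<open>The value of the generator is taken as a pointwise limit, but membership in the domain
  requires the limit to be uniform, i.e. in the sup norm.\<close>

definition gen_op ::
    "(real \<Rightarrow> ('a \<Rightarrow> real) \<Rightarrow> ('a \<Rightarrow> real)) \<Rightarrow> ('a \<Rightarrow> real) \<Rightarrow> ('a \<Rightarrow> real)" where
  "gen_op T f = (\<lambda>x. Lim (at_right 0) (\<lambda>s. (T s f x - f x) / s))"

definition gen_dom ::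
    "('a \<Rightarrow> real) set \<Rightarrow> (real \<Rightarrow> ('a \<Rightarrow> real) \<Rightarrow> ('a \<Rightarrow> real)) \<Rightarrow> ('a \<Rightarrow> real) set" where
  "gen_dom V T = {f \<in> V. gen_op T f \<in> V \<and>
     uniform_limit UNIV (\<lambda>s x. (T s f x - f x) / s) (gen_op T f) (at_right 0)}"

definition generates ::
    "('a \<Rightarrow> real) set \<Rightarrow> ('a \<Rightarrow> real) set \<Rightarrow> (('a \<Rightarrow> real) \<Rightarrow> ('a \<Rightarrow> real)) \<Rightarrow>
     (real \<Rightarrow> ('a \<Rightarrow> real) \<Rightarrow> ('a \<Rightarrow> real)) \<Rightarrow> bool" where
  "generates V D A T \<longleftrightarrow>
     pos_contraction_semigroup V T \<and> D = gen_dom V T \<and> (\<forall>f\<in>D. A f = gen_op T f)"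

text \<open>The generator of \<open>T\<close> is the closure of \<open>A\<close> restricted to the core \<open>C\<close>.\<close>

definition generates_with_core ::
    "('a \<Rightarrow> real) set \<Rightarrow> ('a \<Rightarrow> real) set \<Rightarrow> (('a \<Rightarrow> real) \<Rightarrow> ('a \<Rightarrow> real)) \<Rightarrow>
     (real \<Rightarrow> ('a \<Rightarrow> real) \<Rightarrow> ('a \<Rightarrow> real)) \<Rightarrow> bool" where
  "generates_with_core V C A T \<longleftrightarrow>
     pos_contraction_semigroup V T \<and> C \<subseteq> gen_dom V T \<and> (\<forall>f\<in>C. gen_op T f = A f) \<and>
     (\<forall>f\<in>gen_dom V T. \<exists>h. (\<forall>n::nat. h n \<in> C) \<and>
        uniform_limit UNIV h f sequentially \<and>
        uniform_limit UNIV (\<lambda>n. A (h n)) (gen_op T f) sequentially)"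

text \<open>\<open>T\<close> acts on the first variable and \<open>S\<close> on the second one.\<close>

definition product_semigroup ::
    "(real \<Rightarrow> (real \<Rightarrow> real) \<Rightarrow> (real \<Rightarrow> real)) \<Rightarrow> (real \<Rightarrow> ('a \<Rightarrow> real) \<Rightarrow> ('a \<Rightarrow> real)) \<Rightarrow>
     real \<Rightarrow> (real \<times> 'a \<Rightarrow> real) \<Rightarrow> (real \<times> 'a \<Rightarrow> real)" where
  "product_semigroup T S s u = (\<lambda>(t, x). T s (\<lambda>t'. S s (\<lambda>x'. u (t', x')) x) t)"


section \<open>The kernel and the generalised fractional operators\<close>

text \<open>Only the values \<open>\<nu> t r\<close> with \<open>r > 0\<close> matter.\<close>

definition H0 :: "(real \<Rightarrow> real \<Rightarrow> real) \<Rightarrow> bool" where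
  "H0 \<nu> \<longleftrightarrow>
    (\<forall>t. \<forall>r>0. 0 \<le> \<nu> t r) \<and>
    continuous_on (UNIV \<times> {0<..}) (\<lambda>(t, r). \<nu> t r) \<and>
    (\<forall>r>0. (\<forall>t. (\<lambda>t. \<nu> t r) differentiable (at t)) \<and> continuous_on UNIV (deriv (\<lambda>t. \<nu> t r))) \<and>
    (SUP t. \<integral>\<^sup>+ r\<in>{0<..}. ennreal (min 1 r * \<nu> t r) \<partial>lborel) < \<infinity> \<and>
    (SUP t. \<integral>\<^sup>+ r\<in>{0<..}. ennreal (min 1 r * \<bar>deriv (\<lambda>t. \<nu> t r) t\<bar>) \<partial>lborel) < \<infinity> \<and>
    ((\<lambda>\<delta>. SUP t. \<integral>\<^sup>+ r\<in>{0<..\<delta>}. ennreal (r * \<nu> t r) \<partial>lborel) \<longlongrightarrow> 0) (at_right 0)"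

definition H1a :: "(real \<Rightarrow> real \<Rightarrow> real) \<Rightarrow> bool" where
  "H1a \<nu> \<longleftrightarrow> (\<exists>\<epsilon>>0. \<exists>\<delta>>0. \<forall>t r. 0 < r \<and> r < \<epsilon> \<longrightarrow> \<delta> \<le> \<nu> t r)"

text \<open>The operators below are \<open>-D\<^sub>+\<close> on \<open>(-\<infinity>,b]\<close> and the Riemann--Liouville type operator
  \<open>-D\<^sub>a\<^sub>+\<close>. The latter is continued by \<open>0\<close> to \<open>t = a\<close>, the value forced by membership in \<open>Ca a b\<close>.\<close>

definition neg_D_plus :: "real \<Rightarrow> (real \<Rightarrow> real \<Rightarrow> real) \<Rightarrow> (real \<Rightarrow> real) \<Rightarrow> (real \<Rightarrow> real)" where
  "neg_D_plus b \<nu> f = (\<lambda>t. if t \<le> b then LINT r:{0<..}|lborel. (f (t - r) - f t) * \<nu> t r else 0)"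

definition neg_D_RL ::
    "real \<Rightarrow> real \<Rightarrow> (real \<Rightarrow> real \<Rightarrow> real) \<Rightarrow> (real \<Rightarrow> real) \<Rightarrow> (real \<Rightarrow> real)" where
  "neg_D_RL a b \<nu> f = (\<lambda>t. if a < t \<and> t \<le> b then
      (LINT r:{0<..t - a}|lborel. (f (t - r) - f t) * \<nu> t r)
      - f t * (LINT r:{t - a..}|lborel. \<nu> t r) else 0)"

definition generates_D_plus ::
    "real \<Rightarrow> (real \<Rightarrow> real \<Rightarrow> real) \<Rightarrow> (real \<Rightarrow> (real \<Rightarrow> real) \<Rightarrow> (real \<Rightarrow> real)) \<Rightarrow> bool" where
  "generates_D_plus b \<nu> P \<longleftrightarrow>
     generates_with_core (C0 {..b}) {f \<in> C1_0 {..b}. neg_D_plus b \<nu> f \<in> C0 {..b}} (neg_D_plus b \<nu>) P"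

definition generates_D_RL ::
    "real \<Rightarrow> real \<Rightarrow> (real \<Rightarrow> real \<Rightarrow> real) \<Rightarrow> (real \<Rightarrow> (real \<Rightarrow> real) \<Rightarrow> (real \<Rightarrow> real)) \<Rightarrow> bool" where
  "generates_D_RL a b \<nu> T \<longleftrightarrow>
     generates_with_core (Ca a b) (C1_0 {a..b} \<inter> Ca a b) (neg_D_RL a b \<nu>) T"


section \<open>Feller processes\<close>

text \<open>
  A Feller semigroup is only required to be sub-Markovian, so its process lives in the one-point
  compactification: \<open>None\<close> is the cemetery (the point at infinity), and functions
  are extended to it by \<open>0\<close>.
\<close>

definition ext0 :: "('a \<Rightarrow> real) \<Rightarrow> 'a option \<Rightarrow> real" where
  "ext0 f = case_option 0 f"

definition compactified_borel :: "'a::topological_space option measure" where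
  "compactified_borel = sigma UNIV {U. openin (Alexandroff_compactification euclidean) U}"

definition path_sigma ::
    "'w measure \<Rightarrow> real set \<Rightarrow> (real \<Rightarrow> 'w \<Rightarrow> 'a::topological_space option) \<Rightarrow> 'w measure" where
  "path_sigma M I X =
     sigma (space M) (\<Union>s\<in>I. {X s -` B \<inter> space M | B. B \<in> sets compactified_borel})"

text \<open>\<open>X\<close> is a process with right-continuous paths with left limits that starts at \<open>x\<close> and is Markov,
  with respect to its natural filtration, with transition semigroup \<open>T\<close> on \<open>C0 E\<close>.\<close>

definition feller_process ::
    "'w measure \<Rightarrow> 'a::topological_space set \<Rightarrow> (real \<Rightarrow> ('a \<Rightarrow> real) \<Rightarrow> ('a \<Rightarrow> real)) \<Rightarrow> 'a \<Rightarrow>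
     (real \<Rightarrow> 'w \<Rightarrow> 'a option) \<Rightarrow> bool" where
  "feller_process M E T x X \<longleftrightarrow>
    prob_space M \<and>
    (\<forall>s\<ge>0. X s \<in> measurable M compactified_borel) \<and>
    (\<forall>s\<ge>0. \<forall>\<omega>\<in>space M. X s \<omega> \<in> insert None (Some ` E)) \<and>
    (\<forall>\<omega>\<in>space M. X 0 \<omega> = Some x) \<and>
    (\<forall>s\<ge>0. \<forall>r\<ge>0. \<forall>f\<in>C0 E. AE \<omega> in M.
       real_cond_exp M (path_sigma M {0..s} X) (\<lambda>\<omega>. ext0 f (X (s + r) \<omega>)) \<omega> = ext0 (T r f) (X s \<omega>)) \<and>
    (\<forall>\<omega>\<in>space M. \<forall>s\<ge>0.
       limitin (Alexandroff_compactification (top_of_set E)) (\<lambda>r. X r \<omega>) (X s \<omega>) (at_right s)) \<and>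
    (\<forall>\<omega>\<in>space M. \<forall>s>0.
       \<exists>l. limitin (Alexandroff_compactification (top_of_set E)) (\<lambda>r. X r \<omega>) l (at_left s))"

text \<open>The process generated by \<open>-D\<^sub>+\<close> is conservative and non-increasing, hence real-valued.\<close>

definition decreasing_feller_process ::
    "'w measure \<Rightarrow> real \<Rightarrow> (real \<Rightarrow> (real \<Rightarrow> real) \<Rightarrow> (real \<Rightarrow> real)) \<Rightarrow> real \<Rightarrow>
     (real \<Rightarrow> 'w \<Rightarrow> real) \<Rightarrow> bool" where
  "decreasing_feller_process M b P t X \<longleftrightarrow>
     feller_process M {..b} P t (\<lambda>s \<omega>. Some (X s \<omega>)) \<and>
     (\<forall>\<omega>\<in>space M. antimono_on {0..} (\<lambda>s. X s \<omega>))"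

definition indep_processes ::
    "'w measure \<Rightarrow> (real \<Rightarrow> 'w \<Rightarrow> 'a::topological_space option) \<Rightarrow>
     (real \<Rightarrow> 'w \<Rightarrow> 'b::topological_space option) \<Rightarrow> bool" where
  "indep_processes M X Y \<longleftrightarrow>
     prob_space.indep_set M (sets (path_sigma M {0..} X)) (sets (path_sigma M {0..} Y))"

definition law_on_space :: "'w measure \<Rightarrow> ('w \<Rightarrow> 'a::topological_space option) \<Rightarrow> 'a measure" where
  "law_on_space M Y = distr (restrict_space M {\<omega>\<in>space M. Y \<omega> \<noteq> None}) borel (\<lambda>\<omega>. the (Y \<omega>))"

definition H2 ::
    "'w measure \<Rightarrow> real \<Rightarrow> real \<Rightarrow> (real \<Rightarrow> real \<Rightarrow> 'w \<Rightarrow> real) \<Rightarrow>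
     (real ^ 'd \<Rightarrow> real \<Rightarrow> 'w \<Rightarrow> (real ^ 'd) option) \<Rightarrow> bool" where
  "H2 M a b X Y \<longleftrightarrow> (\<forall>t\<in>{a..b}. \<forall>x. \<forall>s>0.
     absolutely_continuous lborel (distr M borel (X t s)) \<and>
     absolutely_continuous lborel (law_on_space M (Y x s)))"

text \<open>The hitting time is \<open>\<infinity>\<close> if the level \<open>a\<close> is never reached.\<close>

definition hitting_time :: "real \<Rightarrow> (real \<Rightarrow> 'w \<Rightarrow> real) \<Rightarrow> 'w \<Rightarrow> ereal" where
  "hitting_time a X \<omega> = (INF s\<in>{s. 0 \<le> s \<and> X s \<omega> \<le> a}. ereal s)"

text \<open>The term for an infinite hitting time only affects a null set when \<open>H1a\<close> holds.\<close>

definition stochastic_rep ::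
    "'w measure \<Rightarrow> real \<Rightarrow> (real \<Rightarrow> 'w \<Rightarrow> real) \<Rightarrow> (real \<Rightarrow> 'w \<Rightarrow> 'a option) \<Rightarrow>
     ('a \<Rightarrow> real) \<Rightarrow> (real \<times> 'a \<Rightarrow> real) \<Rightarrow> real" where
  "stochastic_rep M a X Y \<phi> g =
     (\<integral>\<omega>. (if hitting_time a X \<omega> = \<infinity> then 0
           else ext0 \<phi> (Y (real_of_ereal (hitting_time a X \<omega>)) \<omega>)) \<partial>M)
     + (\<integral>\<omega>. (LINT s:{s. 0 \<le> s \<and> ereal s < hitting_time a X \<omega>}|lborel.
           ext0 (\<lambda>y. g (X s \<omega>, y)) (Y s \<omega>)) \<partial>M)"


section \<open>Notions of solution\<close>

text \<open>Riemann--Liouville problem; \<open>T\<close> and \<open>S\<close> are the semigroups generated by \<open>-D\<^sub>a\<^sub>+\<close> and \<open>A\<close>,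
  and the operator \<open>L\<close> is the generator of the product semigroup.\<close>

definition RL_solution_dom ::
    "real \<Rightarrow> real \<Rightarrow> (real \<Rightarrow> (real \<Rightarrow> real) \<Rightarrow> (real \<Rightarrow> real)) \<Rightarrow>
     (real \<Rightarrow> ('a::topological_space \<Rightarrow> real) \<Rightarrow> ('a \<Rightarrow> real)) \<Rightarrow>
     (real \<times> 'a \<Rightarrow> real) \<Rightarrow> (real \<times> 'a \<Rightarrow> real) \<Rightarrow> bool" where
  "RL_solution_dom a b T S g u \<longleftrightarrow>
     g \<in> Ca0 a b \<and> u \<in> gen_dom (Ca0 a b) (product_semigroup T S) \<and>
     gen_op (product_semigroup T S) u = (\<lambda>p. - g p)"

definition RL_solution_gen ::
    "real \<Rightarrow> real \<Rightarrow> (real \<Rightarrow> (real \<Rightarrow> real) \<Rightarrow> (real \<Rightarrow> real)) \<Rightarrow>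
     (real \<Rightarrow> ('a::euclidean_space \<Rightarrow> real) \<Rightarrow> ('a \<Rightarrow> real)) \<Rightarrow>
     (real \<times> 'a \<Rightarrow> real) \<Rightarrow> (real \<times> 'a \<Rightarrow> real) \<Rightarrow> bool" where
  "RL_solution_gen a b T S g u \<longleftrightarrow>
     g \<in> bounded_borel ({a..b} \<times> UNIV) \<and> u \<in> bounded_borel ({a..b} \<times> UNIV) \<and>
     (\<exists>gs us. (\<forall>n::nat. RL_solution_dom a b T S (gs n) (us n)) \<and>
        (AE p in lborel. (\<lambda>n. gs n p) \<longlonglongrightarrow> g p) \<and>
        bdd_above (range (\<lambda>n. sup_norm (gs n))) \<and>
        (\<forall>p. (\<lambda>n. us n p) \<longlonglongrightarrow> u p))"

text \<open>The function \<open>(t, x) \<mapsto> h x\<close> on \<open>[a,b] \<times> \<real>\<^sup>d\<close>.\<close>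

definition const_in_time :: "real \<Rightarrow> real \<Rightarrow> ('a \<Rightarrow> real) \<Rightarrow> (real \<times> 'a \<Rightarrow> real)" where
  "const_in_time a b h = (\<lambda>(t, x). if t \<in> {a..b} then h x else 0)"

text \<open>Caputo problem: solutions are by definition those of the Riemann--Liouville problem
  with source \<open>g + A \<phi>\<close>, shifted by the initial value \<open>\<phi>\<close>. The Caputo type operator
  \<open>-D\<^sub>a\<^sub>+\<^sub>*\<close> vanishes on functions constant in time and agrees with \<open>-D\<^sub>a\<^sub>+\<close> on functions that are
  \<open>0\<close> at \<open>t = a\<close>, so it does not occur explicitly.\<close>

definition Caputo_solution_dom ::
    "real \<Rightarrow> real \<Rightarrow> (real \<Rightarrow> (real \<Rightarrow> real) \<Rightarrow> (real \<Rightarrow> real)) \<Rightarrow>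
     (real \<Rightarrow> ('a::topological_space \<Rightarrow> real) \<Rightarrow> ('a \<Rightarrow> real)) \<Rightarrow>
     ('a \<Rightarrow> real) set \<Rightarrow> (('a \<Rightarrow> real) \<Rightarrow> ('a \<Rightarrow> real)) \<Rightarrow>
     (real \<times> 'a \<Rightarrow> real) \<Rightarrow> ('a \<Rightarrow> real) \<Rightarrow> (real \<times> 'a \<Rightarrow> real) \<Rightarrow> bool" where
  "Caputo_solution_dom a b T S domA A g \<phi> u \<longleftrightarrow>
     \<phi> \<in> domA \<and> (\<forall>x. A \<phi> x = - g (a, x)) \<and>
     (\<exists>v. RL_solution_dom a b T S (\<lambda>p. g p + const_in_time a b (A \<phi>) p) v \<and>
          u = (\<lambda>p. v p + const_in_time a b \<phi> p))"

definition Caputo_solution_gen ::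
    "real \<Rightarrow> real \<Rightarrow> (real \<Rightarrow> (real \<Rightarrow> real) \<Rightarrow> (real \<Rightarrow> real)) \<Rightarrow>
     (real \<Rightarrow> ('a::euclidean_space \<Rightarrow> real) \<Rightarrow> ('a \<Rightarrow> real)) \<Rightarrow>
     ('a \<Rightarrow> real) set \<Rightarrow> (('a \<Rightarrow> real) \<Rightarrow> ('a \<Rightarrow> real)) \<Rightarrow>
     (real \<times> 'a \<Rightarrow> real) \<Rightarrow> ('a \<Rightarrow> real) \<Rightarrow> (real \<times> 'a \<Rightarrow> real) \<Rightarrow> bool" where
  "Caputo_solution_gen a b T S domA A g \<phi> u \<longleftrightarrow>
     \<phi> \<in> domA \<and>
     (\<exists>v. RL_solution_gen a b T S (\<lambda>p. g p + const_in_time a b (A \<phi>) p) v \<and>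
          u = (\<lambda>p. v p + const_in_time a b \<phi> p))"

end

theory Submission
  imports Defs
begin

text \<open>
  Functions in \<open>Ca a b\<close>, extended by \<open>0\<close>, lie in \<open>C0 {..b}\<close>, and there the Riemann--Liouville operator
  and \<open>-D\<^sub>+\<close> agree on functions whose derivative vanishes at \<open>a\<close>. Approximating a general core
  function by such functions shows that the generator of \<open>T\<close> is a restriction of the generator of \<open>P\<close>,
  so \<open>T s f = P s f\<close> on \<open>Ca a b\<close> and \<open>T\<close> is the semigroup of the process killed at level \<open>a\<close>. With
  independence, the product semigroup is \<open>U s g (t, x) = E[g(X(s), Y(s))]\<close> with \<open>g\<close> vanishing below \<open>a\<close>.

  By \<open>H1a\<close>, increasing functions of the form \<open>exp t * (1 - exp (- n (t - a)))\<close> are contracted by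
  \<open>T\<close> at an exponential rate that does not depend on \<open>n\<close>; letting \<open>n\<close> tend to infinity bounds
  \<open>P(X(s) > a)\<close> by a multiple of \<open>exp (- c s)\<close>. Hence \<open>\<integral>\<^sub>0\<^sup>\<infinity> U s g ds\<close> converges and is the unique
  solution of the Riemann--Liouville problem in the domain of the generator. Under \<open>H2\<close> the joint law
  of \<open>(X(s), Y(s))\<close> is absolutely continuous, so this integral passes to the limit along bounded almost
  everywhere convergent sources, which gives generalised solutions. Finally \<open>s < \<tau> \<longleftrightarrow> X(s) > a\<close>
  and Dynkin's formula for \<open>Y\<close> at the independent time \<open>\<tau>\<close> turn the integral into the stochastic
  representation.
\<close>

section \<open>Contraction semigroups on function spaces\<close>

text \<open>The obstacle in identifying the two generators is a kink: the zero extension of a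
  function that is C^1 on [a,b] with value 0 at \<open>a\<close> is in general not differentiable at
  \<open>a\<close>, so it need not lie in the core of -D_+, and closedness of the generator has to
  bring it in. Paths are non-increasing, so a path that has left (a,b] stays out; evaluating at X(s)
  a function that vanishes below \<open>a\<close> already kills it, without a stopping argument.

  The rate in the survival estimate comes from jumps in a fixed window near 0: they occur at a rate
  bounded below, and each costs a fixed fraction of the factor exp t. This uniform decay makes the
  generator of the product semigroup invertible, its inverse being minus the time integral of the
  orbit; existence and uniqueness are the two halves of that statement. For generalised solutions
  the delicate point is uniqueness, as the approximating sequence is free. It holds because the
  inverse is an integral against a measure that does not charge Lebesgue null sets, so all bounded
  admissible sequences lead to the same limit.\<close>

lemma abs_le_sup_norm:
  assumes "bounded (range f)"
  shows "\<bar>f x\<bar> \<le> sup_norm f"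
proof -
  have "bdd_above (range (\<lambda>x. \<bar>f x\<bar>))"
    using assms by (fastforce simp: bounded_iff bdd_above_def)
  then show ?thesis
    unfolding sup_norm_def by (intro cSUP_upper) auto
qed

lemma sup_norm_le:
  assumes "\<And>x. \<bar>f x\<bar> \<le> c"
  shows "sup_norm f \<le> c"
  unfolding sup_norm_def using assms by (intro cSUP_least) auto

text \<open>Contractions preserve non-strict pointwise bounds, while a strict pointwise bound may
  become an equality in the supremum. The estimates below are therefore phrased with
  \<open>\<le> e\<close>, and this is the bridge to the filter formulation.\<close>

lemma uniform_limit_at_right_0_iff:
  "uniform_limit UNIV f l (at_right (0::real)) \<longleftrightarrow>
    (\<forall>e>0. \<exists>d>0. \<forall>h. 0 < h \<and> h < d \<longrightarrow> (\<forall>x. \<bar>f h x - l x\<bar> \<le> (e::real)))"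
  (is "_ = ?R")
proof
  assume "uniform_limit UNIV f l (at_right 0)"
  then show ?R
    unfolding uniform_limit_iff eventually_at_right_field dist_real_def
    by (metis UNIV_I less_imp_le)
next
  assume R: ?R
  show "uniform_limit UNIV f l (at_right 0)"
  proof (rule uniform_limitI)
    fix e :: real assume "0 < e"
    then obtain d where "d > 0" "\<forall>h. 0 < h \<and> h < d \<longrightarrow> (\<forall>x. \<bar>f h x - l x\<bar> \<le> e/2)"
      using R by (meson half_gt_zero)
    moreover have "y \<le> e/2 \<Longrightarrow> y < e" for y using \<open>0 < e\<close> by simp
    ultimately show "\<forall>\<^sub>F h in at_right 0. \<forall>x\<in>UNIV. dist (f h x) (l x) < e"
      unfolding eventually_at_right_field dist_real_def by blast
  qed
qed

lemma uniform_limit_sequentially_real_iff: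
  "uniform_limit UNIV f l sequentially \<longleftrightarrow>
    (\<forall>e>0. \<exists>N. \<forall>n\<ge>N. \<forall>x. \<bar>f n x - l x\<bar> \<le> (e::real))" (is "_ = ?R")
proof
  assume "uniform_limit UNIV f l sequentially"
  then show ?R
    unfolding uniform_limit_sequentially_iff dist_real_def by (metis UNIV_I less_imp_le)
next
  assume R: ?R
  show "uniform_limit UNIV f l sequentially"
    unfolding uniform_limit_sequentially_iff dist_real_def
  proof (intro allI impI)
    fix e :: real assume "0 < e"
    then obtain N where "\<forall>n\<ge>N. \<forall>x. \<bar>f n x - l x\<bar> \<le> e/2"
      using R by (meson half_gt_zero)
    moreover have "y \<le> e/2 \<Longrightarrow> y < e" for y using \<open>0 < e\<close> by simp
    ultimately show "\<exists>N. \<forall>n\<ge>N. \<forall>x\<in>UNIV. \<bar>f n x - l x\<bar> < e" by blast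
  qed
qed

text \<open>The left difference quotient at \<open>s\<close> is the right one at \<open>s - h\<close>; this is why the
  convergence has to be uniform in \<open>s\<close>.\<close>

lemma has_derivative_if_uniform_right_quotients:
  fixes F G :: "real \<Rightarrow> real"
  assumes lim: "\<And>e. e > 0 \<Longrightarrow> \<exists>d>0. \<forall>h s. 0 < h \<and> h < d \<and> 0 \<le> s \<longrightarrow> \<bar>(F (s + h) - F s) / h - G s\<bar> \<le> e"
    and G: "continuous_on {0..} G" and s: "0 \<le> s"
  shows "(F has_real_derivative G s) (at s within {0..})"
  unfolding has_field_derivative_iff Lim_within
proof (intro allI impI)
  fix e :: real assume "0 < e"
  then have e2: "e/3 > 0" by simp
  obtain d where d: "d > 0" and dq: "\<And>h s. 0 < h \<Longrightarrow> h < d \<Longrightarrow> 0 \<le> s \<Longrightarrow> \<bar>(F (s + h) - F s) / h - G s\<bar> \<le> e/3"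
    using lim[OF e2] by blast
  obtain d' where d': "d' > 0" and dG: "\<And>r. r \<ge> 0 \<Longrightarrow> \<bar>r - s\<bar> < d' \<Longrightarrow> \<bar>G r - G s\<bar> < e/3"
    using G s e2 unfolding continuous_on_iff dist_real_def by (metis atLeast_iff)
  have "norm ((F r - F s) / (r - s) - G s) < e" if r: "r \<ge> 0" "r \<noteq> s" "\<bar>r - s\<bar> < min d d'" for r
  proof (cases "r > s")
    case True
    then have "\<bar>(F (s + (r - s)) - F s) / (r - s) - G s\<bar> \<le> e/3"
      using r s by (intro dq) auto
    then show ?thesis using \<open>0 < e\<close> by simp
  next
    case False
    then have "\<bar>(F (r + (s - r)) - F r) / (s - r) - G r\<bar> \<le> e/3"
      using r by (intro dq) auto
    moreover have "(F (r + (s - r)) - F r) / (s - r) = (F r - F s) / (r - s)"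
      by (metis add_diff_cancel_left' add.commute diff_add_cancel minus_diff_eq minus_divide_divide)
    moreover have "\<bar>G r - G s\<bar> < e/3" using r by (intro dG) auto
    moreover have "\<bar>q - c\<bar> < e" if "\<bar>q - b\<bar> \<le> e/3" "\<bar>b - c\<bar> < e/3" for q b c
      using that by linarith
    ultimately show ?thesis unfolding real_norm_def by metis
  qed
  then show "\<exists>d>0. \<forall>x\<in>{0..}. 0 < dist x s \<and> dist x s < d \<longrightarrow> dist ((F x - F s) / (x - s)) (G s) < e"
    unfolding dist_norm using d d' by (intro exI[of _ "min d d'"]) auto
qed

text \<open>Continuous induction: the points up to which
  \<open>\<bar>F r - F 0\<bar> \<le> e * r\<close> holds form a closed initial segment, and a zero
  right derivative pushes its end point further unless it is \<open>s\<close>. The mean value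
  theorem would ask for a two-sided derivative, while the interpolation between two semigroups is
  differentiated from the right.\<close>

lemma constant_if_right_derivative_zero:
  fixes F :: "real \<Rightarrow> real"
  assumes "0 \<le> s" and cont: "continuous_on {0..s} F"
    and der: "\<And>r e. 0 \<le> r \<Longrightarrow> r < s \<Longrightarrow> e > 0 \<Longrightarrow> \<exists>d>0. \<forall>h. 0 < h \<and> h < d \<longrightarrow> \<bar>F (r + h) - F r\<bar> \<le> e * h"
  shows "F s = F 0"
proof -
  have "\<bar>F s - F 0\<bar> \<le> e * s" if e: "e > 0" for e
  proof -
    define Z where "Z = {r\<in>{0..s}. \<bar>F r - F 0\<bar> \<le> e * r}"
    have "closed Z"
      unfolding Z_def
      by (intro continuous_on_closed_Collect_le continuous_intros cont closed_atLeastAtMost)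
    define W where "W = {r\<in>{0..s}. {0..r} \<subseteq> Z}"
    have "0 \<in> W" using \<open>0 \<le> s\<close> by (auto simp: W_def Z_def)
    have bdd: "bdd_above W" by (auto simp: W_def)
    define m where "m = Sup W"
    have m0: "0 \<le> m" unfolding m_def by (rule cSup_upper[OF \<open>0 \<in> W\<close> bdd])
    have ms: "m \<le> s" unfolding m_def using \<open>0 \<in> W\<close> by (intro cSup_least) (auto simp: W_def)
    have below: "r \<in> Z" if "0 \<le> r" "r < m" for r
    proof -
      obtain w where "w \<in> W" "r < w"
        using \<open>r < m\<close> \<open>0 \<in> W\<close> bdd unfolding m_def by (metis less_cSup_iff empty_iff)
      then show ?thesis using that by (auto simp: W_def)
    qed
    have mZ: "m \<in> Z"
    proof (cases "m = 0")
      case True then show ?thesis using \<open>0 \<in> W\<close> by (auto simp: W_def)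
    next
      case False
      then have "m \<in> closure {0..<m}" using m0 by (simp add: closure_atLeastLessThan)
      also have "\<dots> \<subseteq> Z" using below \<open>closed Z\<close> by (intro closure_minimal) auto
      finally show ?thesis .
    qed
    have "m = s"
    proof (rule ccontr)
      assume "m \<noteq> s"
      then have "m < s" using ms by simp
      then obtain d where d: "d > 0" "\<And>h. 0 < h \<Longrightarrow> h < d \<Longrightarrow> \<bar>F (m + h) - F m\<bar> \<le> e * h"
        using der[OF m0 _ e] by blast
      define h where "h = min (d/2) (s - m)"
      have h: "0 < h" "h < d" "m + h \<le> s" using d \<open>m < s\<close> by (auto simp: h_def)
      have "r \<in> Z" if r: "0 \<le> r" "r \<le> m + h" for r
      proof (cases "r \<le> m")
        case True then show ?thesis using below[of r] mZ r by (cases "r = m") auto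
      next
        case False
        then have "\<bar>F (m + (r - m)) - F m\<bar> \<le> e * (r - m)" using r h by (intro d) auto
        moreover have "\<bar>F m - F 0\<bar> \<le> e * m" using mZ by (simp add: Z_def)
        ultimately have "\<bar>F r - F 0\<bar> \<le> e * r" by (simp add: algebra_simps)
        then show ?thesis using r h by (auto simp: Z_def)
      qed
      then have "m + h \<in> W" using h m0 by (auto simp: W_def)
      then have "m + h \<le> m" unfolding m_def by (rule cSup_upper[OF _ bdd])
      then show False using h by simp
    qed
    then show ?thesis using mZ by (simp add: Z_def)
  qed
  note bound = this
  have "\<bar>F s - F 0\<bar> \<le> 0 + e" if e: "e > 0" for e
  proof -
    \<comment> \<open>Dividing by \<open>s + 1\<close> instead of \<open>s\<close> keeps the
      constant positive and meaningful at s = 0.\<close>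
    have "\<bar>F s - F 0\<bar> \<le> (e / (s + 1)) * s" using e \<open>0 \<le> s\<close> by (intro bound) auto
    also have "\<dots> \<le> e" using e \<open>0 \<le> s\<close> by (simp add: divide_simps mult_left_mono)
    finally show ?thesis by simp
  qed
  then have "\<bar>F s - F 0\<bar> \<le> 0" by (rule field_le_epsilon)
  then show ?thesis by simp
qed

text \<open>Strong continuity speaks of one function at a time; on a totally bounded family it
  becomes uniform, as is required for the slices of a function of two variables. The net is taken in
  \<open>V\<close> and not in \<open>K\<close>, so that the zero function may be added to
  it.\<close>

definition totally_bounded_family :: "('a \<Rightarrow> real) set \<Rightarrow> ('a \<Rightarrow> real) set \<Rightarrow> bool" where
  "totally_bounded_family V K \<longleftrightarrow> K \<subseteq> V \<and>
    (\<forall>e>0. \<exists>G. finite G \<and> G \<subseteq> V \<and> (\<forall>f\<in>K. \<exists>g\<in>G. \<forall>x. \<bar>f x - g x\<bar> \<le> e))"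

text \<open>\<open>pos_contraction_semigroup\<close> leaves the structure of \<open>V\<close> open.
  Linearity of \<open>V\<close> allows differences and quotients to be fed back into
  \<open>T\<close>, and boundedness makes \<open>sup_norm\<close> a true supremum, so that
  contractivity yields pointwise bounds.\<close>

locale contraction_semigroup =
  fixes V :: "('a \<Rightarrow> real) set" and T :: "real \<Rightarrow> ('a \<Rightarrow> real) \<Rightarrow> ('a \<Rightarrow> real)"
  assumes semigroup: "pos_contraction_semigroup V T"
    and bounded: "f \<in> V \<Longrightarrow> bounded (range f)"
    and lincomb: "f \<in> V \<Longrightarrow> g \<in> V \<Longrightarrow> (\<lambda>x. \<alpha> * f x + \<beta> * g x) \<in> V"
begin

section \<open>Generator calculus: difference quotients, integrated orbits, closedness\<close>

lemma T_in: "s \<ge> 0 \<Longrightarrow> f \<in> V \<Longrightarrow> T s f \<in> V"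
  and T_lin: "s \<ge> 0 \<Longrightarrow> f \<in> V \<Longrightarrow> g \<in> V \<Longrightarrow> T s (\<lambda>x. \<alpha> * f x + \<beta> * g x) = (\<lambda>x. \<alpha> * T s f x + \<beta> * T s g x)"
  and T_0: "f \<in> V \<Longrightarrow> T 0 f = f"
  and T_add: "s \<ge> 0 \<Longrightarrow> r \<ge> 0 \<Longrightarrow> f \<in> V \<Longrightarrow> T (s + r) f = T s (T r f)"
  and T_nonneg: "s \<ge> 0 \<Longrightarrow> f \<in> V \<Longrightarrow> (\<And>x. 0 \<le> f x) \<Longrightarrow> 0 \<le> T s f x"
  and T_contract: "s \<ge> 0 \<Longrightarrow> f \<in> V \<Longrightarrow> sup_norm (T s f) \<le> sup_norm f"
  and T_strong: "f \<in> V \<Longrightarrow> uniform_limit UNIV (\<lambda>s. T s f) f (at_right 0)"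
  using semigroup unfolding pos_contraction_semigroup_def by simp_all

lemma scale_in: "f \<in> V \<Longrightarrow> (\<lambda>x. c * f x) \<in> V"
  using lincomb[of f f c 0] by simp

lemma diff_in: "f \<in> V \<Longrightarrow> g \<in> V \<Longrightarrow> (\<lambda>x. f x - g x) \<in> V"
  using lincomb[of f g 1 "-1"] by simp

lemma T_scale: "s \<ge> 0 \<Longrightarrow> f \<in> V \<Longrightarrow> T s (\<lambda>x. c * f x) = (\<lambda>x. c * T s f x)"
  using T_lin[of s f f c 0] by simp

lemma T_diff: "s \<ge> 0 \<Longrightarrow> f \<in> V \<Longrightarrow> g \<in> V \<Longrightarrow> T s (\<lambda>x. f x - g x) = (\<lambda>x. T s f x - T s g x)"
  using T_lin[of s f g 1 "-1"] by simp

lemma T_le: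
  assumes "s \<ge> 0" "f \<in> V" "\<And>x. \<bar>f x\<bar> \<le> c"
  shows "\<bar>T s f x\<bar> \<le> c"
  using abs_le_sup_norm[OF bounded[OF T_in[OF assms(1,2)]], of x] T_contract[OF assms(1,2)]
    sup_norm_le[of f c] assms(3) by (auto intro: order_trans)

lemma T_diff_le:
  assumes "s \<ge> 0" "f \<in> V" "g \<in> V" "\<And>x. \<bar>f x - g x\<bar> \<le> c"
  shows "\<bar>T s f x - T s g x\<bar> \<le> c"
  using T_le[OF assms(1) diff_in[OF assms(2,3)] assms(4), of x] T_diff[OF assms(1-3)] by simp

text \<open>By the semigroup law the increment at \<open>s\<close> is \<open>T s\<close> applied to
  the increment at 0, so contractivity makes the modulus of continuity independent of
  \<open>s\<close>.\<close>

lemma strong_continuity: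
  assumes "f \<in> V" "e > 0"
  obtains d where "d > 0" "\<And>h s x. 0 \<le> h \<Longrightarrow> h < d \<Longrightarrow> 0 \<le> s \<Longrightarrow> \<bar>T (s + h) f x - T s f x\<bar> \<le> e"
proof -
  obtain d where d: "d > 0" "\<And>h x. 0 < h \<Longrightarrow> h < d \<Longrightarrow> \<bar>T h f x - f x\<bar> \<le> e"
    using iffD1[OF uniform_limit_at_right_0_iff T_strong[OF assms(1)], rule_format, OF assms(2)] by auto
  have "\<bar>T (s + h) f x - T s f x\<bar> \<le> e" if h: "0 \<le> h" "h < d" "0 \<le> s" for h s x
  proof (cases "h = 0")
    case True then show ?thesis using assms by simp
  next
    case False
    then show ?thesis
      using T_add[OF \<open>0 \<le> s\<close> \<open>0 \<le> h\<close> assms(1)] T_diff_le[OF \<open>0 \<le> s\<close> T_in[OF \<open>0 \<le> h\<close> assms(1)] assms(1), of e x]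
        d(2)[of h] h by auto
  qed
  then show ?thesis using d(1) that by blast
qed

lemma orbit_uniformly_continuous:
  assumes "f \<in> V" "e > 0"
  obtains d where "d > 0" "\<And>r s x. 0 \<le> r \<Longrightarrow> 0 \<le> s \<Longrightarrow> \<bar>r - s\<bar> < d \<Longrightarrow> \<bar>T r f x - T s f x\<bar> \<le> e"
proof -
  obtain d where d: "d > 0" "\<And>h s x. 0 \<le> h \<Longrightarrow> h < d \<Longrightarrow> 0 \<le> s \<Longrightarrow> \<bar>T (s + h) f x - T s f x\<bar> \<le> e"
    using strong_continuity[OF assms] by blast
  have "\<bar>T r f x - T s f x\<bar> \<le> e" if "0 \<le> r" "0 \<le> s" "\<bar>r - s\<bar> < d" for r s x
    using d(2)[of "r - s" s x] d(2)[of "s - r" r x] that by (cases "r \<le> s") auto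
  then show ?thesis using that d(1) by blast
qed

lemma orbit_continuous: "f \<in> V \<Longrightarrow> continuous_on {0..} (\<lambda>s. T s f x)"
  unfolding continuous_on_iff dist_real_def
proof (intro ballI allI impI)
  fix s e :: real assume *: "f \<in> V" "s \<in> {0..}" "0 < e"
  then have "e/2 > 0" by simp
  then obtain d where d: "d > 0" "\<And>r s x. 0 \<le> r \<Longrightarrow> 0 \<le> s \<Longrightarrow> \<bar>r - s\<bar> < d \<Longrightarrow> \<bar>T r f x - T s f x\<bar> \<le> e/2"
    using orbit_uniformly_continuous[OF *(1)] by metis
  have "\<bar>T r f x - T s f x\<bar> < e" if "r \<in> {0..}" "\<bar>r - s\<bar> < d" for r
    using d(2)[of r s x] that * by (auto intro: le_less_trans)
  then show "\<exists>d>0. \<forall>x'\<in>{0..}. \<bar>x' - s\<bar> < d \<longrightarrow> \<bar>T x' f x - T s f x\<bar> < e"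
    using d(1) by blast
qed

lemma gen_domD:
  assumes "f \<in> gen_dom V T"
  shows "f \<in> V" "gen_op T f \<in> V"
  using assms by (auto simp: gen_dom_def)

text \<open>The quotient at \<open>s\<close> is \<open>T s\<close> applied to the quotient at 0, and
  a contraction does not increase its distance to the limit. Uniformity in \<open>s\<close> is what
  later upgrades right derivatives of orbits to two-sided ones.\<close>

lemma gen_quotient:
  assumes "f \<in> gen_dom V T" "e > 0"
  obtains d where "d > 0"
    "\<And>h s x. 0 < h \<Longrightarrow> h < d \<Longrightarrow> 0 \<le> s \<Longrightarrow> \<bar>(T (s + h) f x - T s f x) / h - T s (gen_op T f) x\<bar> \<le> e"
proof -
  note f = gen_domD[OF assms(1)]
  obtain d where d: "d > 0" "\<And>h x. 0 < h \<Longrightarrow> h < d \<Longrightarrow> \<bar>(T h f x - f x) / h - gen_op T f x\<bar> \<le> e"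
  proof -
    have "uniform_limit UNIV (\<lambda>s x. (T s f x - f x) / s) (gen_op T f) (at_right 0)"
      using assms(1) by (simp add: gen_dom_def)
    from iffD1[OF uniform_limit_at_right_0_iff this, rule_format, OF assms(2)] show ?thesis
      using that by auto
  qed
  have "\<bar>(T (s + h) f x - T s f x) / h - T s (gen_op T f) x\<bar> \<le> e" if h: "0 < h" "h < d" "0 \<le> s" for h s x
  proof -
    have h0: "0 \<le> h" using h by simp
    note Th = T_in[OF h0 f(1)]
    have q: "(\<lambda>x. 1/h * (T h f x - f x)) \<in> V" by (intro scale_in diff_in Th f)
    have "T s (\<lambda>x. 1/h * (T h f x - f x)) x = 1/h * (T (s + h) f x - T s f x)"
      by (simp only: T_scale[OF h(3) diff_in[OF Th f(1)]] T_diff[OF h(3) Th f(1)] T_add[OF h(3) h0 f(1)])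
    moreover have "\<bar>T s (\<lambda>x. 1/h * (T h f x - f x)) x - T s (gen_op T f) x\<bar> \<le> e"
      using d(2)[OF h(1,2)] by (intro T_diff_le q f h) simp
    ultimately show ?thesis by simp
  qed
  then show ?thesis using d(1) that by blast
qed

lemma gen_derivative:
  assumes "f \<in> gen_dom V T" "0 \<le> s"
  shows "((\<lambda>s. T s f x) has_real_derivative T s (gen_op T f) x) (at s within {0..})"
proof (rule has_derivative_if_uniform_right_quotients)
  fix e :: real assume "e > 0"
  then show "\<exists>d>0. \<forall>h s. 0 < h \<and> h < d \<and> 0 \<le> s \<longrightarrow> \<bar>(T (s + h) f x - T s f x) / h - T s (gen_op T f) x\<bar> \<le> e"
    using gen_quotient[OF assms(1)] by metis
qed (use assms gen_domD orbit_continuous in auto)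

lemma gen_integral:
  assumes "f \<in> gen_dom V T" "0 \<le> s"
  shows "((\<lambda>r. T r (gen_op T f) x) has_integral (T s f x - f x)) {0..s}"
proof -
  have "((\<lambda>r. T r (gen_op T f) x) has_integral (T s f x - T 0 f x)) {0..s}"
    using assms gen_derivative
    by (intro fundamental_theorem_of_calculus)
      (auto simp flip: has_real_derivative_iff_has_vector_derivative intro!: DERIV_subset[OF gen_derivative[OF assms(1)]])
  then show ?thesis using T_0 gen_domD(1)[OF assms(1)] by simp
qed

lemma gen_domI_uniform:
  assumes f: "f \<in> V" and k: "k \<in> V"
    and unif: "uniform_limit UNIV (\<lambda>s x. (T s f x - f x) / s) k (at_right 0)"
  shows "f \<in> gen_dom V T" "gen_op T f = k"
proof -
  show *: "gen_op T f = k"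
  proof
    fix x
    show "gen_op T f x = k x"
      unfolding gen_op_def
      by (rule tendsto_Lim[OF _ tendsto_uniform_limitI[OF unif]]) auto
  qed
  show "f \<in> gen_dom V T" using f k unif by (simp add: gen_dom_def *)
qed

text \<open>Converse of \<open>gen_integral\<close>: dividing the integrated equation by
  \<open>s\<close> leaves the average of \<open>T r k\<close> over [0,s], which tends to
  \<open>k\<close> in sup norm by strong continuity. Domain membership of a candidate is thereby
  reduced to computing one integral.\<close>

lemma gen_domI:
  assumes f: "f \<in> V" and k: "k \<in> V"
    and int: "\<And>s x. 0 < s \<Longrightarrow> ((\<lambda>r. T r k x) has_integral (T s f x - f x)) {0..s}"
  shows "f \<in> gen_dom V T" "gen_op T f = k"
proof -
  have "uniform_limit UNIV (\<lambda>s x. (T s f x - f x) / s) k (at_right 0)"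
    unfolding uniform_limit_at_right_0_iff
  proof (intro allI impI)
    fix e :: real assume "e > 0"
    then obtain d where d: "d > 0" "\<And>h s x. 0 \<le> h \<Longrightarrow> h < d \<Longrightarrow> 0 \<le> s \<Longrightarrow> \<bar>T (s + h) k x - T s k x\<bar> \<le> e"
      using strong_continuity[OF k] by blast
    have "\<bar>(T h f x - f x) / h - k x\<bar> \<le> e" if h: "0 < h" "h < d" for h x
    proof -
      have "((\<lambda>r. T r k x - k x) has_integral (T h f x - f x) - (h *\<^sub>R k x)) {0..h}"
        using has_integral_diff[OF int[OF h(1)] has_integral_const_real[of "k x" 0 h]] h by simp
      moreover have "\<bar>T r k x - k x\<bar> \<le> e" if "r \<in> {0..h}" for r
        using d(2)[of r 0 x] T_0[OF k] that h by simp
      ultimately have "norm ((T h f x - f x) - (h *\<^sub>R k x)) \<le> e * measure lborel {0..h}"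
        using \<open>e > 0\<close> by (intro has_integral_bound_real[where f="\<lambda>r. T r k x - k x" and S="{}"]) auto
      then have "\<bar>(T h f x - f x) - h * k x\<bar> \<le> e * h" using h by simp
      then show ?thesis using h by (simp add: field_simps abs_le_iff)
    qed
    then show "\<exists>d>0. \<forall>h. 0 < h \<and> h < d \<longrightarrow> (\<forall>x. \<bar>(T h f x - f x) / h - k x\<bar> \<le> e)"
      using d(1) by blast
  qed
  from gen_domI_uniform[OF f k this] show "f \<in> gen_dom V T" "gen_op T f = k" .
qed

text \<open>The integrated form of the generator equation survives uniform limits, because each
  \<open>T r\<close> is a contraction and the integrands therefore converge uniformly on [0,s].
  \<open>gen_domI\<close> then turns the limit identity back into a statement on the
  generator.\<close>

lemma gen_closed:
  assumes "\<And>n. h n \<in> gen_dom V T" "f \<in> V" "k \<in> V"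
    and "uniform_limit UNIV h f sequentially"
    and "uniform_limit UNIV (\<lambda>n. gen_op T (h n)) k sequentially"
  shows "f \<in> gen_dom V T" "gen_op T f = k"
proof -
  have hV: "h n \<in> V" "gen_op T (h n) \<in> V" for n using gen_domD[OF assms(1)] by auto
  have "((\<lambda>r. T r k x) has_integral (T s f x - f x)) {0..s}" if s: "0 < s" for s x
  proof -
    have s0: "0 \<le> s" using s by simp
    have "uniform_limit {0..s} (\<lambda>n r. T r (gen_op T (h n)) x) (\<lambda>r. T r k x) sequentially"
    proof (rule uniform_limitI)
      fix e :: real assume "e > 0"
      then obtain N where N: "\<forall>n\<ge>N. \<forall>x. \<bar>gen_op T (h n) x - k x\<bar> \<le> e/2"
        using assms(5) unfolding uniform_limit_sequentially_real_iff by (meson half_gt_zero)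
      show "\<forall>\<^sub>F n in sequentially. \<forall>r\<in>{0..s}. dist (T r (gen_op T (h n)) x) (T r k x) < e"
      proof (rule eventually_sequentiallyI[of N], intro ballI)
        fix n r assume "N \<le> n" "r \<in> {0..s}"
        then have "\<bar>T r (gen_op T (h n)) x - T r k x\<bar> \<le> e/2"
          using N by (intro T_diff_le hV assms) auto
        then show "dist (T r (gen_op T (h n)) x) (T r k x) < e"
          using \<open>e > 0\<close> by (simp add: dist_real_def)
      qed
    qed
    then have "uniform_limit (cbox 0 s) (\<lambda>n r. T r (gen_op T (h n)) x) (\<lambda>r. T r k x) sequentially"
      by simp
    moreover have "continuous_on (cbox 0 s) (\<lambda>r. T r (gen_op T (h n)) x)" for n
      using continuous_on_subset[OF orbit_continuous[OF hV(2)]] by auto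
    ultimately obtain I J where I: "\<And>n. ((\<lambda>r. T r (gen_op T (h n)) x) has_integral I n) (cbox 0 s)"
      and J: "((\<lambda>r. T r k x) has_integral J) (cbox 0 s)" and lim: "I \<longlonglongrightarrow> J"
      using uniform_limit_integral_cbox[OF _ _ trivial_limit_sequentially] by metis
    have "I = (\<lambda>n. T s (h n) x - h n x)"
      using has_integral_unique[OF I] gen_integral[OF assms(1) s0] by fastforce
    moreover have "(\<lambda>n. T s (h n) x - h n x) \<longlonglongrightarrow> T s f x - f x"
    proof (intro tendsto_diff)
      show hf: "(\<lambda>n. h n x) \<longlonglongrightarrow> f x"
        using tendsto_uniform_limitI[OF assms(4)] by simp
      show "(\<lambda>n. T s (h n) x) \<longlonglongrightarrow> T s f x"
      proof (rule LIMSEQ_I)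
        fix e :: real assume "e > 0"
        then obtain N where "\<forall>n\<ge>N. \<forall>x. \<bar>h n x - f x\<bar> \<le> e/2"
          using assms(4) unfolding uniform_limit_sequentially_real_iff by (meson half_gt_zero)
        then have "\<bar>T s (h n) x - T s f x\<bar> \<le> e/2" if "n \<ge> N" for n
          using that by (intro T_diff_le hV assms s0) auto
        then show "\<exists>N. \<forall>n\<ge>N. norm (T s (h n) x - T s f x) < e"
          using \<open>e > 0\<close> by (intro exI[of _ N]) (auto intro: le_less_trans[of _ "e/2"])
      qed
    qed
    ultimately show ?thesis using J lim by (auto dest: LIMSEQ_unique)
  qed
  with gen_domI[OF assms(2,3)] show "f \<in> gen_dom V T" "gen_op T f = k" by auto
qed

lemma gen_dom_invariant:
  assumes "f \<in> gen_dom V T" "0 \<le> r"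
  shows "T r f \<in> gen_dom V T" "gen_op T (T r f) = T r (gen_op T f)"
proof -
  note f = gen_domD[OF assms(1)]
  have "uniform_limit UNIV (\<lambda>s x. (T s (T r f) x - T r f x) / s) (T r (gen_op T f)) (at_right 0)"
    unfolding uniform_limit_at_right_0_iff
  proof (intro allI impI)
    fix e :: real assume "e > 0"
    then obtain d where d: "d > 0"
      "\<And>h s x. 0 < h \<Longrightarrow> h < d \<Longrightarrow> 0 \<le> s \<Longrightarrow> \<bar>(T (s + h) f x - T s f x) / h - T s (gen_op T f) x\<bar> \<le> e"
      using gen_quotient[OF assms(1)] by blast
    have "\<bar>(T h (T r f) x - T r f x) / h - T r (gen_op T f) x\<bar> \<le> e" if "0 < h" "h < d" for h x
      using d(2)[OF that assms(2), of x] T_add[of h r f] that assms f by (simp add: add.commute)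
    then show "\<exists>d>0. \<forall>h. 0 < h \<and> h < d \<longrightarrow> (\<forall>x. \<bar>(T h (T r f) x - T r f x) / h - T r (gen_op T f) x\<bar> \<le> e)"
      using d(1) by blast
  qed
  from gen_domI_uniform[OF T_in[OF assms(2) f(1)] T_in[OF assms(2) f(2)] this]
  show "T r f \<in> gen_dom V T" "gen_op T (T r f) = T r (gen_op T f)" .
qed

lemma strong_continuity_totally_bounded:
  assumes K: "totally_bounded_family V K" and "e > 0"
  obtains d where "d > 0" "\<And>f h x. f \<in> K \<Longrightarrow> 0 \<le> h \<Longrightarrow> h < d \<Longrightarrow> \<bar>T h f x - f x\<bar> \<le> e"
proof -
  obtain G where G: "finite G" "G \<subseteq> V" "\<And>f. f \<in> K \<Longrightarrow> \<exists>g\<in>G. \<forall>x. \<bar>f x - g x\<bar> \<le> e/3"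
    using K \<open>e > 0\<close> unfolding totally_bounded_family_def
    by (metis zero_less_divide_iff zero_less_numeral)
  have "\<exists>d>0. \<forall>h x. 0 \<le> h \<and> h < d \<longrightarrow> \<bar>T h g x - g x\<bar> \<le> e/3" if "g \<in> G" for g
  proof -
    have g: "g \<in> V" and e3: "e/3 > 0" using that G \<open>e > 0\<close> by auto
    obtain d where d: "d > 0" "\<And>h s x. 0 \<le> h \<Longrightarrow> h < d \<Longrightarrow> 0 \<le> s \<Longrightarrow> \<bar>T (s + h) g x - T s g x\<bar> \<le> e/3"
      using strong_continuity[OF g e3] by blast
    show ?thesis using d(1) d(2)[of _ 0] T_0[OF g] by (intro exI[of _ d]) auto
  qed
  then obtain D where D: "\<And>g. g \<in> G \<Longrightarrow> D g > 0"
    "\<And>g h x. g \<in> G \<Longrightarrow> 0 \<le> h \<Longrightarrow> h < D g \<Longrightarrow> \<bar>T h g x - g x\<bar> \<le> e/3"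
    by metis
  \<comment> \<open>The element 1 keeps \<open>Min\<close> meaningful when \<open>G\<close> is
    empty.\<close>
  define d where "d = Min (insert 1 (D ` G))"
  have "d > 0" unfolding d_def using G(1) D(1) by (subst Min_gr_iff) auto
  moreover have "\<bar>T h f x - f x\<bar> \<le> e" if f: "f \<in> K" and h: "0 \<le> h" "h < d" for f h x
  proof -
    obtain g where g: "g \<in> G" "\<And>x. \<bar>f x - g x\<bar> \<le> e/3" using G(3)[OF f] by blast
    have "d \<le> D g" unfolding d_def using G(1) g(1) by (intro Min_le) auto
    then have "\<bar>T h g x - g x\<bar> \<le> e/3" using h g by (intro D) auto
    moreover have "\<bar>T h f x - T h g x\<bar> \<le> e/3"
      using K f g G(2) h by (intro T_diff_le) (auto simp: totally_bounded_family_def)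
    moreover note g(2)[of x]
    ultimately show ?thesis by linarith
  qed
  ultimately show ?thesis using that by blast
qed

end

text \<open>Duhamel interpolation: \<open>P (s - r) (T r f)\<close> runs from \<open>P s f\<close>
  at r = 0 to \<open>T s f\<close> at r = s. Its right derivative is 0, because from the common
  starting point \<open>T r f\<close> both semigroups move by the same first-order term.\<close>

lemma semigroups_agree_on_domain:
  assumes T: "contraction_semigroup V T" and P: "contraction_semigroup W P" and sub: "V \<subseteq> W"
    and gen: "\<And>f. f \<in> gen_dom V T \<Longrightarrow> f \<in> gen_dom W P \<and> gen_op P f = gen_op T f"
    and f: "f \<in> gen_dom V T" and s: "0 \<le> s"
  shows "T s f = P s f"
proof
  fix x
  interpret T: contraction_semigroup V T by fact
  interpret P: contraction_semigroup W P by fact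
  have fV: "f \<in> V" using T.gen_domD[OF f] by simp
  have TW: "T r f \<in> W" if "0 \<le> r" for r using T.T_in[OF that fV] sub by auto
  define F where "F r = P (s - r) (T r f) x" for r
  have "F s = F 0"
  proof (rule constant_if_right_derivative_zero[OF s])
    show "continuous_on {0..s} F"
      unfolding continuous_on_iff dist_real_def
    proof (intro ballI allI impI)
      fix r e :: real assume r: "r \<in> {0..s}" and "0 < e"
      then have e3: "e/3 > 0" and r0: "0 \<le> r" by auto
      obtain d1 where d1: "d1 > 0"
        "\<And>r q x. 0 \<le> r \<Longrightarrow> 0 \<le> q \<Longrightarrow> \<bar>r - q\<bar> < d1 \<Longrightarrow> \<bar>T r f x - T q f x\<bar> \<le> e/3"
        using T.orbit_uniformly_continuous[OF fV e3] by blast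
      obtain d2 where d2: "d2 > 0"
        "\<And>p q x. 0 \<le> p \<Longrightarrow> 0 \<le> q \<Longrightarrow> \<bar>p - q\<bar> < d2 \<Longrightarrow> \<bar>P p (T r f) x - P q (T r f) x\<bar> \<le> e/3"
        using P.orbit_uniformly_continuous[OF TW[OF r0] e3] by blast
      have "\<bar>F q - F r\<bar> < e" if q: "q \<in> {0..s}" "\<bar>q - r\<bar> < min d1 d2" for q
      proof -
        have "\<bar>P (s - q) (T q f) x - P (s - q) (T r f) x\<bar> \<le> e/3"
          using q r by (intro P.T_diff_le TW d1) auto
        moreover have "\<bar>P (s - q) (T r f) x - P (s - r) (T r f) x\<bar> \<le> e/3"
          using q r by (intro d2) auto
        ultimately show ?thesis using \<open>0 < e\<close> unfolding F_def by linarith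
      qed
      then show "\<exists>d>0. \<forall>q\<in>{0..s}. \<bar>q - r\<bar> < d \<longrightarrow> \<bar>F q - F r\<bar> < e"
        using d1(1) d2(1) by (intro exI[of _ "min d1 d2"]) auto
    qed
  next
    fix r e :: real assume r: "0 \<le> r" "r < s" and "e > 0"
    then have e2: "e/2 > 0" by simp
    define u where "u = T r f"
    have u: "u \<in> gen_dom V T" unfolding u_def using T.gen_dom_invariant[OF f r(1)] by simp
    then have uV: "u \<in> V" "u \<in> W" using T.gen_domD[OF u] sub by auto
    obtain d1 where d1: "d1 > 0"
      "\<And>h q x. 0 < h \<Longrightarrow> h < d1 \<Longrightarrow> 0 \<le> q \<Longrightarrow> \<bar>(T (q + h) u x - T q u x) / h - T q (gen_op T u) x\<bar> \<le> e/2"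
      using T.gen_quotient[OF u e2] by blast
    obtain d2 where d2: "d2 > 0"
      "\<And>h q x. 0 < h \<Longrightarrow> h < d2 \<Longrightarrow> 0 \<le> q \<Longrightarrow> \<bar>(P (q + h) u x - P q u x) / h - P q (gen_op P u) x\<bar> \<le> e/2"
      using P.gen_quotient[OF conjunct1[OF gen[OF u]] e2] by blast
    have "\<bar>F (r + h) - F r\<bar> \<le> e * h" if h: "0 < h" "h < min (min d1 d2) (s - r)" for h
    proof -
      have h0: "0 \<le> h" using h by simp
      have *: "\<bar>T h u y - P h u y\<bar> \<le> e * h" for y
      proof -
        have "\<bar>(T h u y - u y) / h - gen_op T u y\<bar> \<le> e/2"
          using d1(2)[of h 0 y] h T.T_0[OF uV(1)] T.T_0[OF T.gen_domD(2)[OF u]] by simp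
        moreover have "\<bar>(P h u y - u y) / h - gen_op T u y\<bar> \<le> e/2"
          using d2(2)[of h 0 y] h P.T_0[OF uV(2)] P.T_0[OF P.gen_domD(2)[OF conjunct1[OF gen[OF u]]]] gen[OF u] by simp
        ultimately have "\<bar>(T h u y - u y) / h - (P h u y - u y) / h\<bar> \<le> e" by linarith
        then show ?thesis using h by (simp add: field_simps abs_le_iff)
      qed
      \<comment> \<open>Both values are \<open>P (s - r - h)\<close> applied to one short step from
        \<open>u\<close>, made with \<open>T\<close> for \<open>F (r + h)\<close> and with
        \<open>P\<close> for \<open>F r\<close>; contractivity carries the estimate over.\<close>
      have "F (r + h) = P (s - r - h) (T h u) x"
        unfolding F_def u_def using T.T_add[of h r f] h r fV by (simp add: add.commute diff_diff_eq)
      moreover have "F r = P (s - r - h) (P h u) x"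
        unfolding F_def using P.T_add[of "s - r - h" h u] h r uV by (simp add: u_def)
      moreover have "\<bar>P (s - r - h) (T h u) x - P (s - r - h) (P h u) x\<bar> \<le> e * h"
        using h T.T_in[OF h0 uV(1)] P.T_in[OF h0 uV(2)] sub * by (intro P.T_diff_le) auto
      ultimately show ?thesis by simp
    qed
    then show "\<exists>d>0. \<forall>h. 0 < h \<and> h < d \<longrightarrow> \<bar>F (r + h) - F r\<bar> \<le> e * h"
      using d1(1) d2(1) r by (intro exI[of _ "min (min d1 d2) (s - r)"]) auto
  qed
  then show "T s f x = P s f x"
    using P.T_0[OF TW[OF s]] T.T_0[OF fV] by (simp add: F_def)
qed

lemma semigroups_agree:
  assumes T: "contraction_semigroup V T" and P: "contraction_semigroup W P" and sub: "V \<subseteq> W"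
    and gen: "\<And>f. f \<in> gen_dom V T \<Longrightarrow> f \<in> gen_dom W P \<and> gen_op P f = gen_op T f"
    and dense: "\<And>e. e > 0 \<Longrightarrow> \<exists>g\<in>gen_dom V T. \<forall>x. \<bar>f x - g x\<bar> \<le> e"
    and f: "f \<in> V" and s: "0 \<le> s"
  shows "T s f = P s f"
proof
  fix x
  interpret T: contraction_semigroup V T by fact
  interpret P: contraction_semigroup W P by fact
  have "\<bar>T s f x - P s f x\<bar> \<le> 0 + e" if "e > 0" for e
  proof -
    obtain g where g: "g \<in> gen_dom V T" "\<And>x. \<bar>f x - g x\<bar> \<le> e/2"
      using dense[of "e/2"] \<open>e > 0\<close> by auto
    have gV: "g \<in> V" using T.gen_domD[OF g(1)] by simp
    have "T s g x = P s g x"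
      using semigroups_agree_on_domain[OF T P sub gen g(1) s] by simp
    moreover have "\<bar>T s f x - T s g x\<bar> \<le> e/2" using g gV f s by (intro T.T_diff_le) auto
    moreover have "\<bar>P s f x - P s g x\<bar> \<le> e/2" using g gV f s sub by (intro P.T_diff_le) auto
    ultimately show ?thesis by linarith
  qed
  then have "\<bar>T s f x - P s f x\<bar> \<le> 0" by (rule field_le_epsilon)
  then show "T s f x = P s f x" by simp
qed

section \<open>Functions vanishing at infinity and product semigroups\<close>

lemma C0_small_off_compact:
  assumes "f \<in> C0 E" "e > 0"
  obtains K where "compact K" "K \<subseteq> E" "\<And>x. x \<in> E - K \<Longrightarrow> \<bar>f x\<bar> < e"
proof -
  have "\<forall>e>0. \<exists>K. compact K \<and> K \<subseteq> E \<and> (\<forall>x\<in>E - K. \<bar>f x\<bar> < e)"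
    using assms(1) by (simp add: C0_def)
  then show ?thesis using assms(2) that by meson
qed

lemma C0_bounded:
  assumes "f \<in> C0 E"
  shows "bounded (range f)"
proof -
  obtain K where K: "compact K" "K \<subseteq> E" "\<And>x. x \<in> E - K \<Longrightarrow> \<bar>f x\<bar> < 1"
    using C0_small_off_compact[OF assms zero_less_one] by blast
  have "continuous_on K f" using assms K by (auto simp: C0_def intro: continuous_on_subset)
  then have "bounded (f ` K)" using K compact_continuous_image compact_imp_bounded by blast
  then obtain c where c: "\<And>x. x \<in> K \<Longrightarrow> \<bar>f x\<bar> \<le> c" unfolding bounded_iff by auto
  have "\<bar>f x\<bar> \<le> max 1 c" for x
    using K(3)[of x] c[of x] assms by (cases "x \<in> K"; cases "x \<in> E") (auto simp: C0_def)
  then show ?thesis unfolding bounded_iff by (auto intro!: exI[of _ "max 1 c"])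
qed

lemma C0_lincomb:
  assumes "f \<in> C0 E" "g \<in> C0 E"
  shows "(\<lambda>x. \<alpha> * f x + \<beta> * g x) \<in> C0 (E :: 'a::t2_space set)"
proof -
  have *: "\<exists>K. compact K \<and> K \<subseteq> E \<and> (\<forall>x\<in>E - K. \<bar>c * h x\<bar> < e)" if h: "h \<in> C0 E" and "e > 0" for h e c
  proof -
    have "e / (\<bar>c\<bar> + 1) > 0" using \<open>e > 0\<close> by simp
    then obtain K where K: "compact K" "K \<subseteq> E" "\<And>x. x \<in> E - K \<Longrightarrow> \<bar>h x\<bar> < e / (\<bar>c\<bar> + 1)"
      using C0_small_off_compact[OF h] by blast
    have "\<bar>c * h x\<bar> < e" if "x \<in> E - K" for x
    proof -
      have "(\<bar>c\<bar> + 1) * \<bar>h x\<bar> < e" using K(3)[OF that] by (simp add: field_simps)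
      moreover have "\<bar>c * h x\<bar> \<le> (\<bar>c\<bar> + 1) * \<bar>h x\<bar>" by (simp add: abs_mult mult_right_mono)
      ultimately show ?thesis by linarith
    qed
    then show ?thesis using K by blast
  qed
  have "\<exists>K. compact K \<and> K \<subseteq> E \<and> (\<forall>x\<in>E - K. \<bar>\<alpha> * f x + \<beta> * g x\<bar> < e)" if "e > 0" for e
  proof -
    have "e/2 > 0" using that by simp
    then obtain K K' where K: "compact K" "K \<subseteq> E" "\<And>x. x \<in> E - K \<Longrightarrow> \<bar>\<alpha> * f x\<bar> < e/2"
      and K': "compact K'" "K' \<subseteq> E" "\<And>x. x \<in> E - K' \<Longrightarrow> \<bar>\<beta> * g x\<bar> < e/2"
      using *[OF assms(1)] *[OF assms(2)] by metis
    have "\<bar>\<alpha> * f x + \<beta> * g x\<bar> < e" if "x \<in> E - (K \<union> K')" for x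
    proof -
      have "\<bar>\<alpha> * f x\<bar> < e/2" "\<bar>\<beta> * g x\<bar> < e/2" using K(3) K'(3) that by auto
      then show ?thesis by linarith
    qed
    then show ?thesis using K K' by (intro exI[of _ "K \<union> K'"]) auto
  qed
  then show ?thesis using assms by (auto simp: C0_def intro!: continuous_intros)
qed

lemma C0_borel:
  fixes E :: "'a::topological_space set"
  assumes "f \<in> C0 E" "closed E"
  shows "f \<in> borel_measurable borel"
proof -
  have "(\<lambda>x. if x \<in> E then f x else 0) \<in> borel_measurable borel"
    using assms by (intro borel_measurable_continuous_on_if) (auto simp: C0_def)
  moreover have "(\<lambda>x. if x \<in> E then f x else 0) = f" using assms by (auto simp: C0_def)
  ultimately show ?thesis by simp
qed

lemma Ca_bounded: "f \<in> Ca a b \<Longrightarrow> bounded (range f)"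
  by (auto simp: Ca_def C0_bounded)

lemma Ca_lincomb: "f \<in> Ca a b \<Longrightarrow> g \<in> Ca a b \<Longrightarrow> (\<lambda>x. \<alpha> * f x + \<beta> * g x) \<in> Ca a b"
  by (auto simp: Ca_def C0_lincomb)

lemma Ca0_bounded: "f \<in> Ca0 a b \<Longrightarrow> bounded (range f)"
  by (auto simp: Ca0_def C0_bounded)

lemma Ca0_lincomb:
  "f \<in> Ca0 a b \<Longrightarrow> g \<in> Ca0 a b \<Longrightarrow> (\<lambda>x. \<alpha> * f x + \<beta> * g x) \<in> Ca0 a (b :: real)"
  for f :: "real \<times> 'a::t2_space \<Rightarrow> real"
  by (auto simp: Ca0_def C0_lincomb)

lemma contraction_semigroup_C0:
  "pos_contraction_semigroup (C0 E) T \<Longrightarrow> contraction_semigroup (C0 (E::'a::t2_space set)) T"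
  by unfold_locales (auto simp: C0_bounded C0_lincomb)

lemma contraction_semigroup_Ca:
  "pos_contraction_semigroup (Ca a b) T \<Longrightarrow> contraction_semigroup (Ca a b) T"
  by unfold_locales (auto simp: Ca_bounded Ca_lincomb)

lemma contraction_semigroup_Ca0:
  "pos_contraction_semigroup (Ca0 a b) T \<Longrightarrow> contraction_semigroup (Ca0 a b :: (real \<times> 'a::t2_space \<Rightarrow> real) set) T"
  by unfold_locales (auto simp: Ca0_bounded Ca0_lincomb)

section \<open>Concrete descriptions of the spaces on the interval and on the strip\<close>

lemma Ca_iff: "f \<in> Ca a b \<longleftrightarrow> continuous_on {a..b} f \<and> (\<forall>t. t \<notin> {a..b} \<longrightarrow> f t = 0) \<and> f a = 0"
  unfolding Ca_def C0_def by (auto intro!: exI[of _ "{a..b}"])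

lemma Ca_le: "f \<in> Ca a b \<Longrightarrow> t \<le> a \<Longrightarrow> f t = 0"
  by (cases "t = a") (auto simp: Ca_iff)

text \<open>The value 0 at \<open>a\<close> matches the convention 0 to the left of
  \<open>a\<close>, so gluing there creates no jump. At \<open>b\<close> the representing function
  may jump, hence continuity on \<open>{..b}\<close> only.\<close>

lemma Ca_continuous_atMost:
  assumes f: "f \<in> Ca a b" and "a \<le> b"
  shows "continuous_on {..b} f"
proof -
  have "continuous_on {..a} f"
    using Ca_le[OF f] continuous_on_cong[of "{..a}" "{..a}" f "\<lambda>_. 0"] by auto
  then have "continuous_on ({..a} \<union> {a..b}) f"
    using f by (intro continuous_on_closed_Un) (auto simp: Ca_iff)
  moreover have "{..a} \<union> {a..b} = {..b}" using \<open>a \<le> b\<close> by auto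
  ultimately show ?thesis by simp
qed

lemma Ca_subset_C0:
  assumes "a \<le> b"
  shows "Ca a b \<subseteq> C0 {..b}"
proof
  fix f assume f: "f \<in> Ca a b"
  have "\<bar>f x\<bar> < e" if "e > 0" "x \<in> {..b} - {a..b}" for x e
    using f that by (auto simp: Ca_iff)
  then have "\<exists>K. compact K \<and> K \<subseteq> {..b} \<and> (\<forall>x\<in>{..b} - K. \<bar>f x\<bar> < e)" if "e > 0" for e
    using that by (intro exI[of _ "{a..b}"]) auto
  then show "f \<in> C0 {..b}"
    using Ca_continuous_atMost[OF f assms] f by (auto simp: C0_def Ca_iff)
qed

lemma C0_UNIV_iff:
  fixes f :: "'a::euclidean_space \<Rightarrow> real"
  shows "f \<in> C0 UNIV \<longleftrightarrow> continuous_on UNIV f \<and> (\<forall>e>0. \<exists>R. \<forall>x. R < norm x \<longrightarrow> \<bar>f x\<bar> < e)"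
proof -
  have "(\<exists>K. compact K \<and> (\<forall>x. x \<notin> K \<longrightarrow> \<bar>f x\<bar> < e)) \<longleftrightarrow> (\<exists>R. \<forall>x. R < norm x \<longrightarrow> \<bar>f x\<bar> < e)" for e
  proof safe
    fix K assume K: "compact K" "\<forall>x. x \<notin> K \<longrightarrow> \<bar>f x\<bar> < e"
    then obtain R where "\<forall>x\<in>K. norm x \<le> R" using compact_imp_bounded bounded_iff by blast
    with K show "\<exists>R. \<forall>x. R < norm x \<longrightarrow> \<bar>f x\<bar> < e" by (intro exI[of _ R]) force
  next
    fix R assume "\<forall>x. R < norm x \<longrightarrow> \<bar>f x\<bar> < e"
    then show "\<exists>K. compact K \<and> (\<forall>x. x \<notin> K \<longrightarrow> \<bar>f x\<bar> < e)"
      by (intro exI[of _ "cball 0 R"]) auto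
  qed
  then show ?thesis by (simp add: C0_def Ball_def)
qed

text \<open>The time interval is compact, so leaving every compact subset of the strip means that
  \<open>x\<close> goes to infinity; one radius then serves all \<open>t\<close>.\<close>

lemma Ca0_iff:
  fixes f :: "real \<times> 'a::euclidean_space \<Rightarrow> real"
  shows "f \<in> Ca0 a b \<longleftrightarrow> continuous_on ({a..b} \<times> UNIV) f \<and> (\<forall>t x. t \<notin> {a..b} \<longrightarrow> f (t, x) = 0) \<and>
    (\<forall>x. f (a, x) = 0) \<and> (\<forall>e>0. \<exists>R. \<forall>t x. R < norm x \<longrightarrow> \<bar>f (t, x)\<bar> < e)"
    (is "_ \<longleftrightarrow> ?c \<and> ?z \<and> ?a \<and> ?t")
proof
  assume f: "f \<in> Ca0 a b"
  then have c: ?c ?a and z: ?z by (auto simp: Ca0_def C0_def)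
  have "\<exists>R. \<forall>t x. R < norm x \<longrightarrow> \<bar>f (t, x)\<bar> < e" if e: "e > 0" for e
  proof -
    obtain K where K: "compact K" "\<And>p. p \<in> {a..b} \<times> UNIV - K \<Longrightarrow> \<bar>f p\<bar> < e"
    proof -
      have "f \<in> C0 ({a..b} \<times> UNIV)" using f by (simp add: Ca0_def)
      from C0_small_off_compact[OF this e] show ?thesis using that by metis
    qed
    then obtain R where R: "\<And>p. p \<in> K \<Longrightarrow> norm p \<le> R" using compact_imp_bounded bounded_iff by metis
    have "\<bar>f (t, x)\<bar> < e" if "R < norm x" for t x
    proof (cases "t \<in> {a..b}")
      case True
      have "norm x \<le> norm (t, x)" using norm_snd_le[of x t] by simp
      then have "(t, x) \<notin> K" using R[of "(t, x)"] that by auto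
      then show ?thesis using K(2)[of "(t, x)"] True by auto
    qed (use z e in auto)
    then show ?thesis by blast
  qed
  then show "?c \<and> ?z \<and> ?a \<and> ?t" using c z by auto
next
  assume R: "?c \<and> ?z \<and> ?a \<and> ?t"
  have "\<exists>K. compact K \<and> K \<subseteq> {a..b} \<times> UNIV \<and> (\<forall>p\<in>{a..b} \<times> UNIV - K. \<bar>f p\<bar> < e)" if e: "e > 0" for e
  proof -
    obtain r where r: "\<And>t x. r < norm x \<Longrightarrow> \<bar>f (t, x)\<bar> < e" using R e by metis
    show ?thesis
      by (intro exI[of _ "{a..b} \<times> cball 0 r"]) (auto intro!: compact_Times r)
  qed
  then show "f \<in> Ca0 a b" using R by (auto simp: Ca0_def C0_def)
qed

lemma Ca0_uniformly_continuous:
  fixes f :: "real \<times> 'a::euclidean_space \<Rightarrow> real"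
  assumes f: "f \<in> Ca0 a b" and "e > 0"
  obtains d where "d > 0" "\<And>t t' x x'. t \<in> {a..b} \<Longrightarrow> t' \<in> {a..b} \<Longrightarrow> dist t t' < d \<Longrightarrow> dist x x' < d \<Longrightarrow>
    \<bar>f (t, x) - f (t', x')\<bar> \<le> e"
proof -
  have "e/2 > 0" using \<open>e > 0\<close> by simp
  then obtain R where R: "\<And>t x. R < norm x \<Longrightarrow> \<bar>f (t, x)\<bar> < e/2" using f unfolding Ca0_iff by blast
  \<comment> \<open>The margin 1 in the radius matches the cap 1 on \<open>d'\<close>: two points
    closer than \<open>d'\<close> either both lie in this compact set or both have space norm above
    \<open>R\<close>, where the function is below e/2.\<close>
  let ?K = "{a..b} \<times> cball 0 (R + 1)"
  have "continuous_on ({a..b} \<times> UNIV) f" using f by (simp add: Ca0_iff)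
  then have "continuous_on ?K f" by (rule continuous_on_subset) auto
  then have "uniformly_continuous_on ?K f"
    by (intro compact_uniformly_continuous compact_Times) auto
  then obtain d where d: "d > 0" "\<And>p q. p \<in> ?K \<Longrightarrow> q \<in> ?K \<Longrightarrow> dist q p < d \<Longrightarrow> \<bar>f q - f p\<bar> < e"
    using \<open>e > 0\<close> unfolding uniformly_continuous_on_def dist_real_def by metis
  \<comment> \<open>The product distance is at most the sum of the two coordinate distances, hence
    half of \<open>d\<close> for each of them.\<close>
  define d' where "d' = min (d/2) 1"
  have "\<bar>f (t, x) - f (t', x')\<bar> \<le> e"
    if t: "t \<in> {a..b}" "t' \<in> {a..b}" "dist t t' < d'" "dist x x' < d'" for t t' x x'
  proof (cases "norm x \<le> R + 1 \<and> norm x' \<le> R + 1")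
    case True
    have "dist (t, x) (t', x') \<le> dist t t' + dist x x'"
      unfolding dist_prod_def using sqrt_sum_squares_le_sum[of "dist t t'" "dist x x'"] by simp
    then have "dist (t, x) (t', x') < d" using t by (simp add: d'_def)
    then show ?thesis using d(2)[of "(t', x')" "(t, x)"] True t by auto
  next
    case False
    have "dist x x' < 1" using t by (simp add: d'_def)
    then have "\<bar>norm x - norm x'\<bar> < 1" using norm_triangle_ineq3[of x x'] by (simp add: dist_norm)
    then have "R < norm x" "R < norm x'" using False by auto
    then have "\<bar>f (t, x)\<bar> < e/2" "\<bar>f (t', x')\<bar> < e/2" using R by auto
    then show ?thesis by linarith
  qed
  moreover have "d' > 0" using d by (simp add: d'_def)
  ultimately show ?thesis using that by blast
qed

lemma Ca0_borel:
  fixes f :: "real \<times> 'a::euclidean_space \<Rightarrow> real"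
  shows "f \<in> Ca0 a b \<Longrightarrow> f \<in> borel_measurable borel"
  unfolding Ca0_def by (auto intro!: C0_borel closed_Times)

section \<open>Slices and lifts of functions on the strip\<close>

lemma Ca0_space_slice:
  fixes u :: "real \<times> 'a::euclidean_space \<Rightarrow> real"
  assumes u: "u \<in> Ca0 a b"
  shows "(\<lambda>x. u (t, x)) \<in> C0 UNIV"
proof (cases "t \<in> {a..b}")
  case True
  have "continuous_on UNIV (\<lambda>x. u (t, x))"
    using u True unfolding Ca0_iff
    by (auto intro!: continuous_on_compose2[of "{a..b} \<times> UNIV" u] continuous_intros)
  moreover have "\<exists>R. \<forall>x. R < norm x \<longrightarrow> \<bar>u (t, x)\<bar> < e" if "e > 0" for e
    using u that unfolding Ca0_iff by blast
  ultimately show ?thesis unfolding C0_UNIV_iff by blast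
qed (use u in \<open>auto simp: Ca0_iff C0_UNIV_iff\<close>)

lemma Ca0_time_slice:
  fixes u :: "real \<times> 'a::euclidean_space \<Rightarrow> real"
  assumes u: "u \<in> Ca0 a b"
  shows "(\<lambda>t. u (t, x)) \<in> Ca a b"
proof -
  have "continuous_on {a..b} (\<lambda>t. u (t, x))"
    using u unfolding Ca0_iff
    by (auto intro!: continuous_on_compose2[of "{a..b} \<times> UNIV" u] continuous_intros)
  then show ?thesis using u by (auto simp: Ca_iff Ca0_iff)
qed

lemma Ca_0: "(\<lambda>_. 0) \<in> Ca a b" and C0_0: "(\<lambda>_. 0) \<in> C0 E"
  by (auto simp: Ca_iff C0_def)

lemma totally_bounded_space_slices:
  fixes u :: "real \<times> 'a::euclidean_space \<Rightarrow> real"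
  assumes u: "u \<in> Ca0 a b"
  shows "totally_bounded_family (C0 UNIV) (range (\<lambda>t x. u (t, x)))"
  unfolding totally_bounded_family_def
proof (intro conjI allI impI)
  show "range (\<lambda>t x. u (t, x)) \<subseteq> C0 UNIV" using Ca0_space_slice[OF u] by auto
  fix e :: real assume "e > 0"
  then obtain d where d: "d > 0" "\<And>t t' x x'. t \<in> {a..b} \<Longrightarrow> t' \<in> {a..b} \<Longrightarrow> dist t t' < d \<Longrightarrow> dist x x' < d \<Longrightarrow>
    \<bar>u (t, x) - u (t', x')\<bar> \<le> e"
    using Ca0_uniformly_continuous[OF u] by metis
  obtain F where F: "finite F" "F \<subseteq> {a..b}" "{a..b} \<subseteq> (\<Union>t\<in>F. ball t d)"
    using seq_compact_imp_totally_bounded[OF compact_imp_seq_compact[OF compact_Icc]] d(1) by meson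
  let ?G = "insert (\<lambda>_. 0) ((\<lambda>t x. u (t, x)) ` F)"
  have "\<exists>g\<in>?G. \<forall>x. \<bar>u (t, x) - g x\<bar> \<le> e" for t
  proof (cases "t \<in> {a..b}")
    case True
    then obtain t' where t': "t' \<in> F" "dist t t' < d" using F by (auto simp: dist_commute)
    then have "\<forall>x. \<bar>u (t, x) - u (t', x)\<bar> \<le> e" using d True F by auto
    then show ?thesis using t'(1) by (intro bexI[of _ "\<lambda>x. u (t', x)"]) auto
  next
    case False
    then show ?thesis using u \<open>e > 0\<close> by (auto simp: Ca0_iff)
  qed
  then show "\<exists>G. finite G \<and> G \<subseteq> C0 UNIV \<and> (\<forall>f\<in>range (\<lambda>t x. u (t, x)). \<exists>g\<in>G. \<forall>x. \<bar>f x - g x\<bar> \<le> e)"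
    using F(1) Ca0_space_slice[OF u] C0_0 by (intro exI[of _ ?G]) (auto simp del: insert_iff bex_simps)
qed

text \<open>Slices at \<open>x\<close> in a ball are handled by a finite net of that ball; slices at
  larger \<open>x\<close> are uniformly small, and the zero function represents all of them.\<close>

lemma totally_bounded_time_slices:
  fixes u :: "real \<times> 'a::euclidean_space \<Rightarrow> real"
  assumes u: "u \<in> Ca0 a b"
  shows "totally_bounded_family (Ca a b) (range (\<lambda>x t. u (t, x)))"
  unfolding totally_bounded_family_def
proof (intro conjI allI impI)
  show "range (\<lambda>x t. u (t, x)) \<subseteq> Ca a b" using Ca0_time_slice[OF u] by auto
  fix e :: real assume "e > 0"
  then obtain d where d: "d > 0" "\<And>t t' x x'. t \<in> {a..b} \<Longrightarrow> t' \<in> {a..b} \<Longrightarrow> dist t t' < d \<Longrightarrow> dist x x' < d \<Longrightarrow>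
    \<bar>u (t, x) - u (t', x')\<bar> \<le> e"
    using Ca0_uniformly_continuous[OF u] by metis
  obtain R where R: "\<And>t x. R < norm x \<Longrightarrow> \<bar>u (t, x)\<bar> < e" using u \<open>e > 0\<close> unfolding Ca0_iff by blast
  obtain F where F: "finite F" "F \<subseteq> cball 0 R" "cball 0 R \<subseteq> (\<Union>x\<in>F. ball (x::'a) d)"
    using seq_compact_imp_totally_bounded[OF compact_imp_seq_compact[OF compact_cball[of 0 R]], rule_format, OF d(1)]
    by metis
  let ?G = "insert (\<lambda>_. 0) ((\<lambda>x t. u (t, x)) ` F)"
  have "\<exists>g\<in>?G. \<forall>t. \<bar>u (t, x) - g t\<bar> \<le> e" for x
  proof (cases "norm x \<le> R")
    case True
    then have "x \<in> cball 0 R" by simp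
    then obtain x' where x': "x' \<in> F" "dist x x' < d" using F(3) by (auto simp: dist_commute)
    have "\<bar>u (t, x) - u (t, x')\<bar> \<le> e" for t
      using d(2)[of t t x x'] d(1) x' u \<open>e > 0\<close> by (cases "t \<in> {a..b}") (auto simp: Ca0_iff)
    then show ?thesis using x'(1) by (intro bexI[of _ "\<lambda>t. u (t, x')"]) auto
  next
    case False
    then show ?thesis using R by (auto intro: less_imp_le)
  qed
  then show "\<exists>G. finite G \<and> G \<subseteq> Ca a b \<and> (\<forall>f\<in>range (\<lambda>x t. u (t, x)). \<exists>g\<in>G. \<forall>x. \<bar>f x - g x\<bar> \<le> e)"
    using F(1) Ca0_time_slice[OF u] Ca_0 by (intro exI[of _ ?G]) (auto simp del: insert_iff bex_simps)
qed

text \<open>The radius beyond which \<open>S s f\<close> is small depends on \<open>f\<close>, so a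
  tail bound uniform in \<open>t\<close> does not follow slice by slice. Finitely many functions
  approximating all slices give a common radius.\<close>

lemma space_lift_in_Ca0:
  fixes u :: "real \<times> 'a::euclidean_space \<Rightarrow> real"
  assumes S: "pos_contraction_semigroup (C0 UNIV) S" and u: "u \<in> Ca0 a b" and s: "0 \<le> s"
  shows "(\<lambda>(t, x). S s (\<lambda>x'. u (t, x')) x) \<in> Ca0 a b"
proof -
  interpret S: contraction_semigroup "C0 UNIV" S by (rule contraction_semigroup_C0[OF S])
  note sl = Ca0_space_slice[OF u]
  have z: "S s (\<lambda>_. 0) x = 0" for x
    using S.T_le[OF s C0_0, of 0 x] by simp
  define w where "w = (\<lambda>(t, x). S s (\<lambda>x'. u (t, x')) x)"
  have tails: "\<exists>R. \<forall>t x. R < norm x \<longrightarrow> \<bar>w (t, x)\<bar> < e" if "e > 0" for e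
  proof -
    have e3: "e/3 > 0" using \<open>e > 0\<close> by simp
    obtain G where G: "finite G" "G \<subseteq> C0 UNIV" "\<And>t. \<exists>g\<in>G. \<forall>x. \<bar>u (t, x) - g x\<bar> \<le> e/3"
      using totally_bounded_space_slices[OF u] e3 unfolding totally_bounded_family_def by (metis rangeI)
    have "\<exists>R. \<forall>x. R < norm x \<longrightarrow> \<bar>S s g x\<bar> < e/3" if "g \<in> G" for g
    proof -
      have "S s g \<in> C0 UNIV" using S.T_in[OF s, of g] that G(2) by blast
      then show ?thesis using e3 unfolding C0_UNIV_iff by blast
    qed
    then obtain R where R: "\<And>g x. g \<in> G \<Longrightarrow> R g < norm x \<Longrightarrow> \<bar>S s g x\<bar> < e/3" by metis
    have "\<bar>w (t, x)\<bar> < e" if x: "Max (insert 0 (R ` G)) < norm x" for t x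
    proof -
      obtain g where g: "g \<in> G" "\<And>x. \<bar>u (t, x) - g x\<bar> \<le> e/3" using G(3) by blast
      have "R g < norm x" using x g G(1) by auto
      then have "\<bar>S s g x\<bar> < e/3" using R g by blast
      moreover have "\<bar>S s (\<lambda>x'. u (t, x')) x - S s g x\<bar> \<le> e/3"
        using g G sl s by (intro S.T_diff_le) auto
      ultimately show ?thesis using e3 unfolding w_def prod.case by linarith
    qed
    then show ?thesis by blast
  qed
  have "continuous_on ({a..b} \<times> UNIV) w"
    unfolding continuous_on_iff
  proof (intro ballI allI impI)
    fix p and e :: real assume p: "p \<in> {a..b} \<times> (UNIV :: 'a set)" and "e > 0"
    obtain t x where tx: "p = (t, x)" by force
    have e3: "e/3 > 0" using \<open>e > 0\<close> by simp
    obtain d where d: "d > 0" "\<And>t t' x x'. t \<in> {a..b} \<Longrightarrow> t' \<in> {a..b} \<Longrightarrow> dist t t' < d \<Longrightarrow> dist x x' < d \<Longrightarrow>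
      \<bar>u (t, x) - u (t', x')\<bar> \<le> e/3"
      using Ca0_uniformly_continuous[OF u e3] by metis
    have "continuous_on UNIV (S s (\<lambda>x'. u (t, x')))" using S.T_in[OF s sl] by (simp add: C0_def)
    then obtain d' where d': "d' > 0" "\<And>x'. dist x' x < d' \<Longrightarrow> dist (S s (\<lambda>x'. u (t, x')) x') (S s (\<lambda>x'. u (t, x')) x) < e/3"
      using e3 unfolding continuous_on_iff by (metis UNIV_I)
    have "dist (w q) (w p) < e" if q: "q \<in> {a..b} \<times> UNIV" "dist q p < min d d'" for q
    proof -
      obtain t' x' where tx': "q = (t', x')" by force
      have "dist t' t < d" using q dist_fst_le[of q p] tx tx' by auto
      then have "\<And>y. \<bar>u (t', y) - u (t, y)\<bar> \<le> e/3" using d p q tx tx' by auto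
      then have "\<bar>S s (\<lambda>x'. u (t', x')) x' - S s (\<lambda>x'. u (t, x')) x'\<bar> \<le> e/3"
        using s sl by (intro S.T_diff_le) auto
      moreover have "dist x' x < d'" using q dist_snd_le[of q p] tx tx' by auto
      then have "\<bar>S s (\<lambda>x'. u (t, x')) x' - S s (\<lambda>x'. u (t, x')) x\<bar> < e/3"
        using d'(2) by (simp add: dist_real_def)
      ultimately show ?thesis using \<open>e > 0\<close> unfolding tx tx' w_def dist_real_def prod.case by linarith
    qed
    then show "\<exists>d>0. \<forall>q\<in>{a..b} \<times> UNIV. dist q p < d \<longrightarrow> dist (w q) (w p) < e"
      using d(1) d'(1) by (intro exI[of _ "min d d'"]) auto
  qed
  moreover have "w (t, x) = 0" if "t \<notin> {a..b} \<or> t = a" for t x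
  proof -
    have "(\<lambda>x'. u (t, x')) = (\<lambda>_. 0)" using u that by (auto simp: Ca0_iff)
    then show ?thesis by (simp add: w_def z)
  qed
  ultimately show ?thesis using tails unfolding Ca0_iff w_def[symmetric] by auto
qed

text \<open>Tails are immediate here, since for large \<open>x\<close> the whole time slice is small
  and \<open>T s\<close> keeps that bound. For joint continuity the slice is changed before the
  time: slices at nearby \<open>x\<close> are uniformly close, and the image of a single slice is
  continuous.\<close>

lemma time_lift_in_Ca0:
  fixes u :: "real \<times> 'a::euclidean_space \<Rightarrow> real"
  assumes T: "pos_contraction_semigroup (Ca a b) T" and u: "u \<in> Ca0 a b" and s: "0 \<le> s"
  shows "(\<lambda>(t, x). T s (\<lambda>t'. u (t', x)) t) \<in> Ca0 a b"
proof -
  interpret T: contraction_semigroup "Ca a b" T by (rule contraction_semigroup_Ca[OF T])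
  note sl = Ca0_time_slice[OF u]
  define w where "w = (\<lambda>(t, x). T s (\<lambda>t'. u (t', x)) t)"
  have tails: "\<exists>R. \<forall>t x. R < norm x \<longrightarrow> \<bar>w (t, x)\<bar> < e" if "e > 0" for e
  proof -
    have "e/2 > 0" using \<open>e > 0\<close> by simp
    then obtain R where R: "\<And>t x. R < norm x \<Longrightarrow> \<bar>u (t, x)\<bar> < e/2" using u unfolding Ca0_iff by blast
    have "\<bar>w (t, x)\<bar> \<le> e/2" if "R < norm x" for t x
      unfolding w_def prod.case by (intro T.T_le s sl less_imp_le[OF R] that)
    then show ?thesis using \<open>e > 0\<close> by (intro exI[of _ R]) (auto intro: le_less_trans[of _ "e/2"])
  qed
  have "continuous_on ({a..b} \<times> UNIV) w"
    unfolding continuous_on_iff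
  proof (intro ballI allI impI)
    fix p and e :: real assume p: "p \<in> {a..b} \<times> (UNIV :: 'a set)" and "e > 0"
    obtain t x where tx: "p = (t, x)" by force
    have e3: "e/3 > 0" using \<open>e > 0\<close> by simp
    obtain d where d: "d > 0" "\<And>t t' x x'. t \<in> {a..b} \<Longrightarrow> t' \<in> {a..b} \<Longrightarrow> dist t t' < d \<Longrightarrow> dist x x' < d \<Longrightarrow>
      \<bar>u (t, x) - u (t', x')\<bar> \<le> e/3"
      using Ca0_uniformly_continuous[OF u e3] by metis
    have "continuous_on {a..b} (T s (\<lambda>t'. u (t', x)))" using T.T_in[OF s sl] by (simp add: Ca_iff)
    then obtain d' where d': "d' > 0" "\<And>t'. t' \<in> {a..b} \<Longrightarrow> dist t' t < d' \<Longrightarrow>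
        dist (T s (\<lambda>t'. u (t', x)) t') (T s (\<lambda>t'. u (t', x)) t) < e/3"
      using e3 p tx unfolding continuous_on_iff by (metis mem_Sigma_iff)
    have "dist (w q) (w p) < e" if q: "q \<in> {a..b} \<times> UNIV" "dist q p < min d d'" for q
    proof -
      obtain t' x' where tx': "q = (t', x')" by force
      have "dist x' x < d" using q dist_snd_le[of q p] tx tx' by auto
      then have "\<bar>u (r, x') - u (r, x)\<bar> \<le> e/3" for r
        using d(2)[of r r x' x] d(1) u e3 by (cases "r \<in> {a..b}") (auto simp: Ca0_iff)
      then have "\<bar>T s (\<lambda>r. u (r, x')) t' - T s (\<lambda>r. u (r, x)) t'\<bar> \<le> e/3"
        using s sl by (intro T.T_diff_le) auto
      moreover have "dist t' t < d'" using q dist_fst_le[of q p] tx tx' by auto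
      then have "\<bar>T s (\<lambda>r. u (r, x)) t' - T s (\<lambda>r. u (r, x)) t\<bar> < e/3"
        using d'(2) q tx' by (simp add: dist_real_def)
      ultimately show ?thesis using \<open>e > 0\<close> unfolding tx tx' w_def dist_real_def prod.case by linarith
    qed
    then show "\<exists>d>0. \<forall>q\<in>{a..b} \<times> UNIV. dist q p < d \<longrightarrow> dist (w q) (w p) < e"
      using d(1) d'(1) by (intro exI[of _ "min d d'"]) auto
  qed
  moreover have "w (t, x) = 0" if "t \<notin> {a..b} \<or> t = a" for t x
    using T.T_in[OF s sl[of x]] that by (auto simp: Ca_iff w_def)
  ultimately show ?thesis using tails unfolding Ca0_iff w_def[symmetric] by auto
qed

text \<open>The product is the composition of the lifts of the two factors. The semigroup law needs
  the lifts to commute, which \<open>comm\<close> supplies; strong continuity needs each factor to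
  act uniformly on all slices, which total boundedness supplies.\<close>

lemma pos_contraction_semigroup_product:
  fixes S :: "real \<Rightarrow> ('a::euclidean_space \<Rightarrow> real) \<Rightarrow> 'a \<Rightarrow> real"
  assumes T: "pos_contraction_semigroup (Ca a b) T" and S: "pos_contraction_semigroup (C0 UNIV) S"
    and comm: "\<And>u r s t x. u \<in> Ca0 a b \<Longrightarrow> 0 \<le> r \<Longrightarrow> 0 \<le> s \<Longrightarrow>
      T r (\<lambda>t'. S s (\<lambda>x'. u (t', x')) x) t = S s (\<lambda>x'. T r (\<lambda>t'. u (t', x')) t) x"
  shows "pos_contraction_semigroup (Ca0 a b) (product_semigroup T S)"
proof -
  interpret S: contraction_semigroup "C0 UNIV" S by (rule contraction_semigroup_C0[OF S])
  interpret T: contraction_semigroup "Ca a b" T by (rule contraction_semigroup_Ca[OF T])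
  let ?U = "product_semigroup T S"
  define SL where "SL s u = (\<lambda>(t, x). S s (\<lambda>x'. u (t, x')) x)" for s and u :: "real \<times> 'a \<Rightarrow> real"
  define TL where "TL s u = (\<lambda>(t, x). T s (\<lambda>t'. u (t', x)) t)" for s and u :: "real \<times> 'a \<Rightarrow> real"
  have U: "?U s u = TL s (SL s u)" for s u
    by (auto simp: product_semigroup_def TL_def SL_def)
  have SL_in: "SL s u \<in> Ca0 a b" if "0 \<le> s" "u \<in> Ca0 a b" for s u
    unfolding SL_def using space_lift_in_Ca0[OF S that(2,1)] .
  have TL_in: "TL s u \<in> Ca0 a b" if "0 \<le> s" "u \<in> Ca0 a b" for s u
    unfolding TL_def using time_lift_in_Ca0[OF T that(2,1)] .
  have U_in: "?U s u \<in> Ca0 a b" if "0 \<le> s" "u \<in> Ca0 a b" for s u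
    unfolding U using that by (intro TL_in SL_in)
  have SL_le: "\<bar>SL s u p\<bar> \<le> c" if "0 \<le> s" "u \<in> Ca0 a b" "\<And>p. \<bar>u p\<bar> \<le> c" for s u p c
    unfolding SL_def by (cases p) (auto intro!: S.T_le Ca0_space_slice that)
  have TL_le: "\<bar>TL s u p\<bar> \<le> c" if "0 \<le> s" "u \<in> Ca0 a b" "\<And>p. \<bar>u p\<bar> \<le> c" for s u p c
    unfolding TL_def by (cases p) (auto intro!: T.T_le Ca0_time_slice that)
  have SL_lin: "SL s (\<lambda>p. \<alpha> * u p + \<beta> * v p) = (\<lambda>p. \<alpha> * SL s u p + \<beta> * SL s v p)"
    if "0 \<le> s" "u \<in> Ca0 a b" "v \<in> Ca0 a b" for s u v \<alpha> \<beta>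
    using S.T_lin[OF that(1) Ca0_space_slice[OF that(2)] Ca0_space_slice[OF that(3)]]
    by (auto simp: SL_def)
  have TL_lin: "TL s (\<lambda>p. \<alpha> * u p + \<beta> * v p) = (\<lambda>p. \<alpha> * TL s u p + \<beta> * TL s v p)"
    if "0 \<le> s" "u \<in> Ca0 a b" "v \<in> Ca0 a b" for s u v \<alpha> \<beta>
    using T.T_lin[OF that(1) Ca0_time_slice[OF that(2)] Ca0_time_slice[OF that(3)]]
    by (auto simp: TL_def)
  have SL_add: "SL (s + r) u = SL s (SL r u)" if "0 \<le> s" "0 \<le> r" "u \<in> Ca0 a b" for s r u
    using S.T_add[OF that(1,2) Ca0_space_slice[OF that(3)]] by (auto simp: SL_def)
  have TL_add: "TL (s + r) u = TL s (TL r u)" if "0 \<le> s" "0 \<le> r" "u \<in> Ca0 a b" for s r u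
    using T.T_add[OF that(1,2) Ca0_time_slice[OF that(3)]] by (auto simp: TL_def)
  have comm': "TL r (SL s u) = SL s (TL r u)" if "0 \<le> s" "0 \<le> r" "u \<in> Ca0 a b" for s r u
    using comm[OF that(3,2,1)] by (auto simp: SL_def TL_def)
  have strong: "uniform_limit UNIV (\<lambda>s. ?U s u) u (at_right 0)" if u: "u \<in> Ca0 a b" for u
    unfolding uniform_limit_at_right_0_iff
  proof (intro allI impI)
    fix e :: real assume "e > 0"
    then have e2: "e/2 > 0" by simp
    obtain d where d: "d > 0" "\<And>f h x. f \<in> range (\<lambda>t x. u (t, x)) \<Longrightarrow> 0 \<le> h \<Longrightarrow> h < d \<Longrightarrow> \<bar>S h f x - f x\<bar> \<le> e/2"
      using S.strong_continuity_totally_bounded[OF totally_bounded_space_slices[OF u] e2] by blast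
    obtain d' where d': "d' > 0" "\<And>f h x. f \<in> range (\<lambda>x t. u (t, x)) \<Longrightarrow> 0 \<le> h \<Longrightarrow> h < d' \<Longrightarrow> \<bar>T h f x - f x\<bar> \<le> e/2"
      using T.strong_continuity_totally_bounded[OF totally_bounded_time_slices[OF u] e2] by blast
    have "\<bar>?U h u p - u p\<bar> \<le> e" if h: "0 < h" "h < min d d'" for h p
    proof -
      obtain t x where p: "p = (t, x)" by force
      have "\<bar>T h (\<lambda>t'. u (t', x)) t - u (t, x)\<bar> \<le> e/2"
        using d'(2)[of "\<lambda>t. u (t, x)" h t] h by auto
      moreover have "\<bar>T h (\<lambda>t'. S h (\<lambda>x'. u (t', x')) x) t - T h (\<lambda>t'. u (t', x)) t\<bar> \<le> e/2"
      proof (rule T.T_diff_le)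
        show "(\<lambda>t'. S h (\<lambda>x'. u (t', x')) x) \<in> Ca a b"
          using Ca0_time_slice[OF SL_in[of h, OF _ u], of x] h by (simp add: SL_def)
        show "\<bar>S h (\<lambda>x'. u (t', x')) x - u (t', x)\<bar> \<le> e/2" for t'
          using d(2)[of "\<lambda>x. u (t', x)" h x] h by auto
      qed (use h Ca0_time_slice[OF u] in auto)
      ultimately show ?thesis unfolding product_semigroup_def p prod.case by linarith
    qed
    then show "\<exists>d>0. \<forall>h. 0 < h \<and> h < d \<longrightarrow> (\<forall>p. \<bar>?U h u p - u p\<bar> \<le> e)"
      using d(1) d'(1) by (intro exI[of _ "min d d'"]) auto
  qed
  have lin: "?U s (\<lambda>p. \<alpha> * u p + \<beta> * v p) = (\<lambda>p. \<alpha> * ?U s u p + \<beta> * ?U s v p)"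
    if "0 \<le> s" "u \<in> Ca0 a b" "v \<in> Ca0 a b" for s u v \<alpha> \<beta>
    unfolding U using that by (simp only: SL_lin TL_lin SL_in)
  have zero: "?U 0 u = u" if "u \<in> Ca0 a b" for u
    using S.T_0[OF Ca0_space_slice[OF that]] T.T_0[OF Ca0_time_slice[OF that]]
    by (auto simp: product_semigroup_def)
  have add: "?U (s + r) u = ?U s (?U r u)" if "0 \<le> s" "0 \<le> r" "u \<in> Ca0 a b" for s r u
    unfolding U using that by (simp add: SL_add TL_add SL_in TL_in comm')
  have pos: "0 \<le> ?U s u p" if "0 \<le> s" "u \<in> Ca0 a b" "\<forall>p. 0 \<le> u p" for s u p
  proof -
    have *: "0 \<le> SL s u p" for p
      unfolding SL_def using that by (cases p) (auto intro!: S.T_nonneg Ca0_space_slice)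
    show ?thesis
      unfolding U TL_def[of s "SL s u"] using * that by (cases p) (auto intro!: T.T_nonneg Ca0_time_slice SL_in)
  qed
  have contr: "sup_norm (?U s u) \<le> sup_norm u" if "0 \<le> s" "u \<in> Ca0 a b" for s u
    unfolding U by (intro sup_norm_le TL_le SL_le SL_in that abs_le_sup_norm Ca0_bounded[OF that(2)])
  show ?thesis
    unfolding pos_contraction_semigroup_def
    using U_in lin zero add pos contr strong by (intro conjI allI ballI impI) auto
qed

section \<open>The Riemann--Liouville operator\<close>

lemma H0_nonneg: "H0 \<nu> \<Longrightarrow> 0 < r \<Longrightarrow> 0 \<le> \<nu> t r"
  by (simp add: H0_def)

lemma H0_measurable:
  assumes "H0 \<nu>"
  shows "set_borel_measurable lborel {0<..} (\<nu> t)"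
proof -
  have "continuous_on (UNIV \<times> {0<..}) (\<lambda>(t, r). \<nu> t r)" using assms by (simp only: H0_def)
  moreover have "continuous_on {0<..} (\<lambda>r. (t, r))" by (intro continuous_intros)
  ultimately have "continuous_on {0<..} (\<lambda>r. (\<lambda>(t, r). \<nu> t r) (t, r))"
    by (rule continuous_on_compose2) auto
  then have "continuous_on {0<..} (\<nu> t)" by simp
  then show ?thesis
    unfolding set_borel_measurable_def
    using borel_measurable_continuous_on_indicator[of "{0<..}" "\<nu> t"] by simp
qed

lemma H0_set_measurable:
  assumes "H0 \<nu>" "f \<in> borel_measurable borel" "A \<in> sets borel" "A \<subseteq> {0<..}"
  shows "set_borel_measurable lborel A (\<lambda>r. f r * \<nu> t r)"
proof -
  have "(\<lambda>r. (indicator A r * f r) * (indicator {0<..} r *\<^sub>R \<nu> t r)) \<in> borel_measurable lborel"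
    using H0_measurable[OF assms(1), of t] assms(2,3) unfolding set_borel_measurable_def
    by (intro borel_measurable_times) auto
  moreover have "(\<lambda>r. (indicator A r * f r) * (indicator {0<..} r *\<^sub>R \<nu> t r)) = (\<lambda>r. indicator A r *\<^sub>R (f r * \<nu> t r))"
    using assms(4) by (auto simp: indicator_def fun_eq_iff)
  ultimately show ?thesis unfolding set_borel_measurable_def by simp
qed

lemma H0_integral_le:
  assumes H: "H0 \<nu>"
  obtains C where "0 \<le> C" "\<And>t. set_integrable lborel {0<..} (\<lambda>r. min 1 r * \<nu> t r)"
    "\<And>t. (LINT r:{0<..}|lborel. min 1 r * \<nu> t r) \<le> C"
proof -
  let ?I = "\<lambda>t. \<integral>\<^sup>+ r\<in>{0<..}. ennreal (min 1 r * \<nu> t r) \<partial>lborel"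
  have "(SUP t. ?I t) < \<infinity>" using H by (simp add: H0_def)
  then obtain C where C: "0 \<le> C" "(SUP t. ?I t) = ennreal C"
    by (cases "SUP t. ?I t") auto
  have I: "?I t \<le> ennreal C" for t unfolding C(2)[symmetric] by (rule SUP_upper) simp
  have eq: "?I t = (\<integral>\<^sup>+ r. ennreal (indicator {0<..} r *\<^sub>R (min 1 r * \<nu> t r)) \<partial>lborel)" for t
    by (intro nn_integral_cong) (auto simp: indicator_def)
  have int: "set_integrable lborel {0<..} (\<lambda>r. min 1 r * \<nu> t r)" for t
    unfolding set_integrable_def
  proof (rule integrableI_nonneg)
    show "(\<lambda>r. indicator {0<..} r *\<^sub>R (min 1 r * \<nu> t r)) \<in> borel_measurable lborel"
      using H0_set_measurable[OF H, of "min 1"] unfolding set_borel_measurable_def by simp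
    show "AE r in lborel. 0 \<le> indicator {0<..} r *\<^sub>R (min 1 r * \<nu> t r)"
      using H0_nonneg[OF H] by (auto simp: indicator_def)
    show "(\<integral>\<^sup>+ r. ennreal (indicator {0<..} r *\<^sub>R (min 1 r * \<nu> t r)) \<partial>lborel) < \<infinity>"
      using I[of t] eq[of t] by (simp add: order_le_less_trans)
  qed
  moreover have "(LINT r:{0<..}|lborel. min 1 r * \<nu> t r) \<le> C" for t
  proof -
    have "ennreal (LINT r:{0<..}|lborel. min 1 r * \<nu> t r) = ?I t"
      unfolding eq set_lebesgue_integral_def using int[of t] H0_nonneg[OF H]
      by (intro nn_integral_eq_integral[symmetric]) (auto simp: set_integrable_def indicator_def)
    then show ?thesis using I[of t] C(1) by (metis ennreal_le_iff)
  qed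
  ultimately show ?thesis using that C(1) by blast
qed

lemma H0_small_jumps:
  assumes H: "H0 \<nu>" and "e > 0"
  obtains d where "0 < d" "d \<le> 1" "\<And>t. (LINT r:{0<..d}|lborel. r * \<nu> t r) \<le> e"
proof -
  let ?I = "\<lambda>d t. \<integral>\<^sup>+ r\<in>{0<..d}. ennreal (r * \<nu> t r) \<partial>lborel"
  have "((\<lambda>d. SUP t. ?I d t) \<longlongrightarrow> 0) (at_right 0)" using H by (simp add: H0_def)
  then have "eventually (\<lambda>d. (SUP t. ?I d t) < ennreal e) (at_right 0)"
    using \<open>e > 0\<close> by (intro order_tendstoD) auto
  then obtain d0 where d0: "d0 > 0" "\<And>d. 0 < d \<Longrightarrow> d < d0 \<Longrightarrow> (SUP t. ?I d t) < ennreal e"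
    unfolding eventually_at_right_field by auto
  define d where "d = min (d0/2) 1"
  have d: "0 < d" "d \<le> 1" "d < d0" using d0(1) by (auto simp: d_def)
  have "(LINT r:{0<..d}|lborel. r * \<nu> t r) \<le> e" for t
  proof -
    have "?I d t \<le> (SUP t. ?I d t)" by (rule SUP_upper) simp
    then have I: "?I d t < ennreal e" using d0(2)[OF d(1,3)] by (rule le_less_trans)
    have eq: "?I d t = (\<integral>\<^sup>+ r. ennreal (indicator {0<..d} r *\<^sub>R (r * \<nu> t r)) \<partial>lborel)"
      by (intro nn_integral_cong) (auto simp: indicator_def)
    have "integrable lborel (\<lambda>r. indicator {0<..d} r *\<^sub>R (r * \<nu> t r))"
    proof (rule integrableI_nonneg)
      show "(\<lambda>r. indicator {0<..d} r *\<^sub>R (r * \<nu> t r)) \<in> borel_measurable lborel"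
        using H0_set_measurable[OF H, of "\<lambda>r. r" "{0<..d}" t] unfolding set_borel_measurable_def by force
      show "AE r in lborel. 0 \<le> indicator {0<..d} r *\<^sub>R (r * \<nu> t r)"
        using H0_nonneg[OF H] by (auto simp: indicator_def)
      show "(\<integral>\<^sup>+ r. ennreal (indicator {0<..d} r *\<^sub>R (r * \<nu> t r)) \<partial>lborel) < \<infinity>"
        using I eq by (auto simp: order.strict_trans)
    qed
    then have "ennreal (LINT r:{0<..d}|lborel. r * \<nu> t r) = ?I d t"
      unfolding eq set_lebesgue_integral_def using H0_nonneg[OF H]
      by (intro nn_integral_eq_integral[symmetric]) (auto simp: indicator_def)
    then have "ennreal (LINT r:{0<..d}|lborel. r * \<nu> t r) < ennreal e" using I by simp
    then show ?thesis by (meson ennreal_leI leD le_cases)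
  qed
  then show ?thesis using that d by blast
qed

text \<open>The weight \<open>min 1 r\<close> is the one that \<open>H0\<close> integrates against
  the kernel: a Lipschitz bound for small jumps, mere boundedness for large ones.\<close>

definition jump_bounded :: "real \<Rightarrow> (real \<Rightarrow> real) \<Rightarrow> bool" where
  "jump_bounded b f \<longleftrightarrow> f \<in> borel_measurable borel \<and>
    (\<exists>C. \<forall>t\<le>b. \<forall>r>0. \<bar>f (t - r) - f t\<bar> \<le> C * min 1 r)"

lemma jump_integrable:
  assumes H: "H0 \<nu>" and f: "jump_bounded b f" and t: "t \<le> b" and A: "A \<in> sets borel" "A \<subseteq> {0<..}"
  shows "set_integrable lborel A (\<lambda>r. (f (t - r) - f t) * \<nu> t r)"
proof -
  obtain C where C: "\<And>r. r > 0 \<Longrightarrow> \<bar>f (t - r) - f t\<bar> \<le> C * min 1 r" using f t by (auto simp: jump_bounded_def)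
  have fm[measurable]: "f \<in> borel_measurable borel" using f by (simp add: jump_bounded_def)
  obtain I where "set_integrable lborel {0<..} (\<lambda>r. min 1 r * \<nu> t r)"
    using H0_integral_le[OF H] by metis
  then have i: "set_integrable lborel {0<..} (\<lambda>r. C * (min 1 r * \<nu> t r))" by simp
  have m: "set_borel_measurable lborel {0<..} (\<lambda>r. (f (t - r) - f t) * \<nu> t r)"
    by (intro H0_set_measurable[OF H]) auto
  have le: "norm ((f (t - r) - f t) * \<nu> t r) \<le> norm (C * (min 1 r * \<nu> t r))" if "r > 0" for r
  proof -
    have "\<bar>f (t - r) - f t\<bar> * \<nu> t r \<le> C * min 1 r * \<nu> t r"
      using C[OF that] H0_nonneg[OF H that] by (intro mult_right_mono)
    also have "\<dots> \<le> \<bar>C * min 1 r * \<nu> t r\<bar>" by (rule abs_ge_self)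
    finally show ?thesis using H0_nonneg[OF H that, of t] by (simp add: abs_mult mult.assoc)
  qed
  have "AE r in lborel. r \<in> {0<..} \<longrightarrow> norm ((f (t - r) - f t) * \<nu> t r) \<le> norm (C * (min 1 r * \<nu> t r))"
    by (rule AE_I2, rule impI, rule le) (simp only: greaterThan_iff)
  from set_integrable_bound[OF i m this] show ?thesis
    by (rule set_integrable_subset) (use A in simp_all)
qed

text \<open>Jumps of size r > t - a land where \<open>f\<close> vanishes and contribute minus
  \<open>f t\<close> times the tail mass of the kernel, which is the killing term. For t \<le> a
  every value involved is 0.\<close>

lemma neg_D_RL_eq_plus:
  assumes H: "H0 \<nu>" and f: "jump_bounded b f" and f0: "\<And>t. t \<le> a \<Longrightarrow> f t = 0"
  shows "neg_D_RL a b \<nu> f = neg_D_plus b \<nu> f"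
proof
  fix t
  consider "t > b" | "t \<le> a" "t \<le> b" | "a < t" "t \<le> b" by linarith
  then show "neg_D_RL a b \<nu> f t = neg_D_plus b \<nu> f t"
  proof cases
    case 2
    have "(LINT r:{0<..}|lborel. (f (t - r) - f t) * \<nu> t r) = (LINT r:{0::real<..}|lborel. 0)"
      using 2 unfolding set_lebesgue_integral_def
      by (intro Bochner_Integration.integral_cong) (auto simp: indicator_def f0)
    then show ?thesis using 2 by (simp add: neg_D_plus_def neg_D_RL_def)
  next
    case 3
    let ?g = "\<lambda>r. (f (t - r) - f t) * \<nu> t r"
    have "{0<..} = {0<..t - a} \<union> {t - a<..}" using 3 by auto
    then have "(LINT r:{0<..}|lborel. ?g r) = (LINT r:{0<..t - a} \<union> {t - a<..}|lborel. ?g r)" by simp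
    also have "\<dots> = (LINT r:{0<..t - a}|lborel. ?g r) + (LINT r:{t - a<..}|lborel. ?g r)"
      using 3 by (intro set_integral_Un jump_integrable[OF H f]) auto
    also have "(LINT r:{t - a<..}|lborel. ?g r) = (LINT r:{t - a<..}|lborel. - f t * \<nu> t r)"
      using f0 by (intro set_lebesgue_integral_cong) auto
    also have "\<dots> = - f t * (LINT r:{t - a<..}|lborel. \<nu> t r)"
      by (rule set_integral_mult_right)
    also have "(LINT r:{t - a<..}|lborel. \<nu> t r) = (LINT r:{t - a..}|lborel. \<nu> t r)"
    proof (rule set_integral_cong_set)
      have m: "set_borel_measurable lborel A (\<nu> t)" if "A \<in> sets borel" "A \<subseteq> {0<..}" for A
        using H0_set_measurable[OF H, of "\<lambda>_. 1" A t] that by simp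
      show "set_borel_measurable lborel {t - a..} (\<nu> t)" "set_borel_measurable lborel {t - a<..} (\<nu> t)"
        using 3 by (auto intro!: m)
      show "AE r in lborel. (r \<in> {t - a..}) = (r \<in> {t - a<..})"
        using AE_lborel_singleton[of "t - a"] by eventually_elim auto
    qed
    finally show ?thesis using 3 by (simp add: neg_D_plus_def neg_D_RL_def)
  qed (auto simp: neg_D_plus_def neg_D_RL_def)
qed

section \<open>The Riemann-Liouville core and its extension to the half line\<close>

abbreviation RL_core :: "real \<Rightarrow> real \<Rightarrow> (real \<Rightarrow> real) set" where
  "RL_core a b \<equiv> C1_0 {a..b} \<inter> Ca a b"

lemma RL_coreI:
  assumes "\<And>t. t \<in> {a..b} \<Longrightarrow> (h has_real_derivative h' t) (at t within {a..b})"
    and "continuous_on {a..b} h'" "h a = 0"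
  shows "(\<lambda>t. if t \<in> {a..b} then h t else 0) \<in> RL_core a b"
proof -
  have z: "(\<lambda>t. if t \<in> {a..b} then g t else 0) \<in> C0 {a..b}" if "continuous_on {a..b} g" for g :: "real \<Rightarrow> real"
  proof -
    have "continuous_on {a..b} (\<lambda>t. if t \<in> {a..b} then g t else 0)"
      using that by (rule continuous_on_eq) auto
    then show ?thesis by (auto simp: C0_def intro!: exI[of _ "{a..b}"])
  qed
  have c: "continuous_on {a..b} h" using assms(1) by (rule DERIV_continuous_on)
  have "((\<lambda>t. if t \<in> {a..b} then h t else 0) has_real_derivative (if t \<in> {a..b} then h' t else 0)) (at t within {a..b})"
    if "t \<in> {a..b}" for t
    using has_field_derivative_transform_within[OF assms(1)[OF that] zero_less_one that, of "\<lambda>t. if t \<in> {a..b} then h t else 0"] that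
    by auto
  then show ?thesis
    using z[OF c] z[OF assms(2)] assms(3) unfolding C1_0_def Ca_def
    by (auto intro!: bexI[of _ "\<lambda>t. if t \<in> {a..b} then h' t else 0"])
qed

text \<open>A C^1 function with value 0 at \<open>a\<close> stays Lipschitz when continued by 0,
  since a jump across \<open>a\<close> is compared with the value at \<open>a\<close>. Large jumps
  are bounded by twice the sup norm, and the sum of the two constants serves for every
  \<open>r\<close>.\<close>

lemma RL_core_jump_bounded:
  assumes f: "f \<in> RL_core a b" and ab: "a \<le> b"
  shows "jump_bounded b f"
proof -
  obtain f' where f': "f' \<in> C0 {a..b}" "\<And>t. t \<in> {a..b} \<Longrightarrow> (f has_real_derivative f' t) (at t within {a..b})"
    using f by (auto simp: C1_0_def)
  obtain L where L: "L > 0" "\<And>t. \<bar>f' t\<bar> \<le> L" using C0_bounded[OF f'(1)] unfolding bounded_pos by auto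
  have fC: "f \<in> Ca a b" using f by simp
  obtain B where B: "B > 0" "\<And>t. \<bar>f t\<bar> \<le> B" using Ca_bounded[OF fC] unfolding bounded_pos by auto
  have lip: "\<bar>f t - f s\<bar> \<le> L * \<bar>t - s\<bar>" if "t \<in> {a..b}" "s \<in> {a..b}" for s t
    using field_differentiable_bound[of "{a..b}" f f' L t s] f'(2) L that by auto
  have "\<bar>f (t - r) - f t\<bar> \<le> (L + 2 * B) * min 1 r" if t: "t \<le> b" "r > 0" for t r
  proof -
    have "\<bar>f (t - r) - f t\<bar> \<le> L * r"
    proof -
      consider "t \<le> a" | "a \<le> t - r" | "a < t" "t - r < a" by linarith
      then show ?thesis
      proof cases
        case 1 then show ?thesis using Ca_le[OF fC] t L by simp
      next
        case 2 then show ?thesis using lip[of "t - r" t] t by simp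
      next
        case 3
        then have "\<bar>f t - f a\<bar> \<le> L * \<bar>t - a\<bar>" using t by (intro lip) auto
        also have "\<dots> \<le> L * r" using 3 L by (intro mult_left_mono) auto
        finally show ?thesis using Ca_le[OF fC, of "t - r"] Ca_le[OF fC, of a] 3 by simp
      qed
    qed
    moreover have "\<bar>f (t - r) - f t\<bar> \<le> 2 * B" using B(2)[of t] B(2)[of "t - r"] by linarith
    moreover have "L * r \<le> (L + 2 * B) * r" using B(1) t by (intro mult_right_mono) auto
    moreover have "(L + 2 * B) * min 1 r = (if r \<le> 1 then (L + 2 * B) * r else L + 2 * B)" by (simp add: min_def)
    ultimately show ?thesis using L(1) by (auto split: if_splits)
  qed
  moreover have "f \<in> borel_measurable borel" using fC by (auto simp: Ca_def intro: C0_borel)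
  ultimately show ?thesis unfolding jump_bounded_def by blast
qed

lemma RL_core_neg_D:
  assumes "H0 \<nu>" "a \<le> b" "f \<in> RL_core a b"
  shows "neg_D_RL a b \<nu> f = neg_D_plus b \<nu> f"
  using assms RL_core_jump_bounded[OF assms(3,2)] Ca_le by (intro neg_D_RL_eq_plus) auto

lemma neg_D_plus_diff:
  assumes H: "H0 \<nu>" and "jump_bounded b f" "jump_bounded b g"
  shows "neg_D_plus b \<nu> (\<lambda>t. f t - c * g t) t = neg_D_plus b \<nu> f t - c * neg_D_plus b \<nu> g t"
proof (cases "t \<le> b")
  case True
  have "(LINT r:{0<..}|lborel. ((f (t - r) - c * g (t - r)) - (f t - c * g t)) * \<nu> t r) =
    (LINT r:{0<..}|lborel. (f (t - r) - f t) * \<nu> t r - c * ((g (t - r) - g t) * \<nu> t r))"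
    by (simp add: algebra_simps)
  also have "\<dots> = (LINT r:{0<..}|lborel. (f (t - r) - f t) * \<nu> t r) - (LINT r:{0<..}|lborel. c * ((g (t - r) - g t) * \<nu> t r))"
    by (intro set_integral_diff set_integrable_mult_right jump_integrable[OF H _ True] assms) auto
  finally show ?thesis using True by (simp add: neg_D_plus_def)
qed (simp add: neg_D_plus_def)

text \<open>These functions have derivative \<open>1\<close> at \<open>a\<close> but tend to \<open>0\<close> together with their images under
  the operator, so subtracting them makes the derivative at \<open>a\<close> of a core function vanish.\<close>

definition flat_corr :: "real \<Rightarrow> real \<Rightarrow> nat \<Rightarrow> real \<Rightarrow> real" where
  "flat_corr a b n t = (if t \<in> {a..b} then (1 - exp (- real (Suc n) * (t - a))) / real (Suc n) else 0)"

lemma flat_corr_derivative: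
  assumes "m > 0"
  shows "((\<lambda>t. (1 - exp (- m * (t - a))) / m) has_real_derivative exp (- m * (t - a))) (at t within A)"
  by (rule derivative_eq_intros refl | use assms in simp)+

lemma flat_corr_core: "flat_corr a b n \<in> RL_core a b"
proof -
  have "(\<lambda>t. if t \<in> {a..b} then (1 - exp (- real (Suc n) * (t - a))) / real (Suc n) else 0) \<in> RL_core a b"
    by (rule RL_coreI[OF flat_corr_derivative]) (auto intro!: continuous_intros)
  then show ?thesis by (simp add: flat_corr_def[abs_def])
qed

lemma flat_corr_bounds: "0 \<le> flat_corr a b n t" "flat_corr a b n t \<le> 1 / real (Suc n)"
proof -
  have "0 \<le> 1 - exp (- real (Suc n) * (t - a))" if "a \<le> t"
    using that by (simp add: mult_nonpos_nonneg)
  then show "0 \<le> flat_corr a b n t" "flat_corr a b n t \<le> 1 / real (Suc n)"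
    by (auto simp: flat_corr_def divide_le_cancel simp del: of_nat_Suc)
qed

text \<open>The slope bound 1 is meant for small jumps and the oscillation bound 1/(n+1) for large
  ones. On \<open>{..b}\<close> the function is a smooth 1-Lipschitz function composed with
  \<open>max a\<close>, which covers jumps across \<open>a\<close>.\<close>

lemma flat_corr_jump:
  assumes "t \<le> b" "r > 0" "a \<le> b"
  shows "\<bar>flat_corr a b n (t - r) - flat_corr a b n t\<bar> \<le> min r (1 / real (Suc n))"
proof -
  have "\<bar>flat_corr a b n (t - r) - flat_corr a b n t\<bar> \<le> 1 / real (Suc n)"
    using flat_corr_bounds[of a b n t] flat_corr_bounds[of a b n "t - r"] by linarith
  moreover have "\<bar>flat_corr a b n (t - r) - flat_corr a b n t\<bar> \<le> r"
  proof -
    define h where "h t = (1 - exp (- real (Suc n) * (t - a))) / real (Suc n)" for t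
    have "\<bar>h x - h y\<bar> \<le> 1 * \<bar>x - y\<bar>" if "x \<in> {a..}" "y \<in> {a..}" for x y
    proof -
      have "norm (h x - h y) \<le> 1 * norm (x - y)"
      proof (rule field_differentiable_bound)
        show "(h has_field_derivative exp (- real (Suc n) * (z - a))) (at z within {a..})" for z
          unfolding h_def by (rule flat_corr_derivative) simp
      qed (use that in \<open>auto intro: mult_nonpos_nonneg\<close>)
      then show ?thesis by simp
    qed
    note lip = this
    have h: "flat_corr a b n z = h (max a z)" if "z \<le> b" for z
      using that assms by (auto simp: flat_corr_def h_def max_def)
    have "\<bar>h (max a (t - r)) - h (max a t)\<bar> \<le> 1 * \<bar>max a (t - r) - max a t\<bar>" by (rule lip) auto
    also have "\<dots> \<le> r" using assms by (simp add: max_def abs_if)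
    finally show ?thesis using h[of t] h[of "t - r"] assms by auto
  qed
  ultimately show ?thesis by simp
qed

text \<open>Jumps up to a small \<open>d\<close> contribute at most the integral of r * \<nu> over
  (0,d], which \<open>H0\<close> makes small uniformly in \<open>t\<close>. The remaining jumps are
  controlled by the oscillation 1/(n+1), and \<open>N\<close> is chosen to push their share below
  e/2.\<close>

lemma flat_corr_neg_D_tendsto_0:
  assumes H: "H0 \<nu>" and ab: "a \<le> b" and "e > 0"
  shows "\<exists>N. \<forall>n\<ge>N. \<forall>t. \<bar>neg_D_plus b \<nu> (flat_corr a b n) t\<bar> \<le> e"
proof -
  obtain C where C: "0 \<le> C" "\<And>t. set_integrable lborel {0<..} (\<lambda>r. min 1 r * \<nu> t r)"
    "\<And>t. (LINT r:{0<..}|lborel. min 1 r * \<nu> t r) \<le> C"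
    using H0_integral_le[OF H] by metis
  have "e/2 > 0" using \<open>e > 0\<close> by simp
  then obtain d where d: "0 < d" "d \<le> 1" "\<And>t. (LINT r:{0<..d}|lborel. r * \<nu> t r) \<le> e/2"
    using H0_small_jumps[OF H] by metis
  obtain N where N: "C / (d * e/2) \<le> real N" using real_arch_simple by blast
  have "\<bar>neg_D_plus b \<nu> (flat_corr a b n) t\<bar> \<le> e" if n: "n \<ge> N" for n t
  proof (cases "t \<le> b")
    case True
    let ?k = "flat_corr a b n"
    \<comment> \<open>As d \<le> 1, this choice gives 1/(n+1) \<le> c * min 1 r for every r >
      d.\<close>
    define c where "c = 1 / (Suc n * d)"
    have c: "c \<ge> 0" using d by (simp add: c_def)
    have jb: "jump_bounded b ?k" by (rule RL_core_jump_bounded[OF flat_corr_core ab])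
    have i1: "set_integrable lborel {0<..} (\<lambda>r. indicator {0<..d} r *\<^sub>R (r * \<nu> t r))"
    proof -
      have "set_integrable lborel {0<..d} (\<lambda>r. min 1 r * \<nu> t r)"
        using C(2) by (rule set_integrable_subset) auto
      moreover have "(\<lambda>r. indicator {0<..} r *\<^sub>R indicator {0<..d} r *\<^sub>R (r * \<nu> t r)) = (\<lambda>r. indicator {0<..d} r *\<^sub>R (min 1 r * \<nu> t r))"
        using d by (auto simp: indicator_def)
      ultimately show ?thesis unfolding set_integrable_def by metis
    qed
    have e1: "(LINT r:{0<..}|lborel. indicator {0<..d} r *\<^sub>R (r * \<nu> t r)) = (LINT r:{0<..d}|lborel. r * \<nu> t r)"
      unfolding set_lebesgue_integral_def by (intro Bochner_Integration.integral_cong) (auto simp: indicator_def)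
    have "\<bar>LINT r:{0<..}|lborel. (?k (t - r) - ?k t) * \<nu> t r\<bar> \<le> (LINT r:{0<..}|lborel. \<bar>(?k (t - r) - ?k t) * \<nu> t r\<bar>)"
      using set_integral_norm_bound[OF jump_integrable[OF H jb True, of "{0<..}"]] by simp
    also have "\<dots> \<le> (LINT r:{0<..}|lborel. indicator {0<..d} r *\<^sub>R (r * \<nu> t r) + c * (min 1 r * \<nu> t r))"
    proof (rule set_integral_mono)
      show "set_integrable lborel {0<..} (\<lambda>r. \<bar>(?k (t - r) - ?k t) * \<nu> t r\<bar>)"
        using set_integrable_norm[OF jump_integrable[OF H jb True, of "{0<..}"]] by simp
      show "set_integrable lborel {0<..} (\<lambda>r. indicator {0<..d} r *\<^sub>R (r * \<nu> t r) + c * (min 1 r * \<nu> t r))"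
        by (intro set_integral_add i1 set_integrable_mult_right C)
      fix r :: real assume "r \<in> {0<..}"
      then have r: "r > 0" by simp
      have "\<bar>?k (t - r) - ?k t\<bar> \<le> indicator {0<..d} r * r + c * min 1 r"
      proof (cases "r \<le> d")
        case True
        then show ?thesis using flat_corr_jump[OF \<open>t \<le> b\<close> r ab, of n] r c by (auto intro: add_increasing2)
      next
        case False
        have "1 / real (Suc n) \<le> c * min 1 r"
          using False d by (simp add: c_def divide_simps min_def)
        then show ?thesis using flat_corr_jump[OF \<open>t \<le> b\<close> r ab, of n] False by auto
      qed
      then have "\<bar>?k (t - r) - ?k t\<bar> * \<nu> t r \<le> (indicator {0<..d} r * r + c * min 1 r) * \<nu> t r"
        using H0_nonneg[OF H r] by (intro mult_right_mono)
      moreover have "\<bar>(?k (t - r) - ?k t) * \<nu> t r\<bar> = \<bar>?k (t - r) - ?k t\<bar> * \<nu> t r"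
        using H0_nonneg[OF H r] by (simp only: abs_mult abs_of_nonneg)
      ultimately show "\<bar>(?k (t - r) - ?k t) * \<nu> t r\<bar> \<le> indicator {0<..d} r *\<^sub>R (r * \<nu> t r) + c * (min 1 r * \<nu> t r)"
        by (simp add: distrib_right mult.assoc)
    qed
    also have "\<dots> = (LINT r:{0<..d}|lborel. r * \<nu> t r) + c * (LINT r:{0<..}|lborel. min 1 r * \<nu> t r)"
      using i1 C(2) e1 by (simp add: set_integral_add)
    also have "\<dots> \<le> e/2 + c * C" using d(3) C(3) c by (intro add_mono mult_left_mono)
    also have "c * C \<le> e/2"
    proof -
      have "C \<le> real N * (d * e/2)" using N d \<open>e > 0\<close> by (simp add: field_simps)
      also have "\<dots> \<le> Suc n * (d * e/2)" using n d \<open>e > 0\<close> by (intro mult_right_mono) auto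
      finally show ?thesis using d by (simp add: c_def pos_divide_le_eq mult_ac del: of_nat_Suc)
    qed
    finally show ?thesis using True by (simp add: neg_D_plus_def)
  qed (use \<open>e > 0\<close> in \<open>simp add: neg_D_plus_def\<close>)
  then show ?thesis by blast
qed

text \<open>The zero extension has left derivative 0 at \<open>a\<close>; requiring
  \<open>f'\<close> to lie in \<open>Ca a b\<close> makes the right derivative agree and the
  extended derivative continuous.\<close>

lemma flat_core_C1_atMost:
  assumes f: "f \<in> Ca a b" and f': "f' \<in> Ca a b" and ab: "a < b"
    and der: "\<And>t. t \<in> {a..b} \<Longrightarrow> (f has_real_derivative f' t) (at t within {a..b})"
  shows "f \<in> C1_0 {..b}"
proof -
  have "(f has_real_derivative f' t) (at t within {..b})" if t: "t \<in> {..b}" for t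
  proof -
    have left: "(f has_real_derivative f' t) (at t within {..a})" if "t \<le> a"
    proof -
      have "((\<lambda>_. 0) has_real_derivative 0) (at t within {..a})" by simp
      then have "(f has_real_derivative 0) (at t within {..a})"
        by (rule has_field_derivative_transform_within[where d=1]) (use that Ca_le[OF f] in auto)
      then show ?thesis using Ca_le[OF f' that] by simp
    qed
    \<comment> \<open>Where \<open>t\<close> is not a limit point of the interval,
      \<open>at t within\<close> is the trivial filter and every derivative claim holds; so the two
      one-sided statements can be glued at every \<open>t\<close>.\<close>
    have right: "(f has_real_derivative f' t) (at t within {a..b})"
    proof (cases "t < a")
      case True
      then have "at t within {a..b} = bot" using at_within_eq_bot_iff[of t "{a..b}"] by auto
      then show ?thesis by (simp add: has_field_derivative_iff)
    qed (use der t in auto)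
    have U: "{..b} = {..a} \<union> {a..b}" using ab by auto
    show ?thesis
    proof (cases "t \<le> a")
      case True
      show ?thesis
        using left[OF True] right unfolding U has_field_derivative_iff by (intro Lim_Un)
    next
      case False
      then have "at t within {..a} = bot" using at_within_eq_bot_iff[of t "{..a}"] by auto
      then have "(f has_real_derivative f' t) (at t within {..a})" by (simp add: has_field_derivative_iff)
      then show ?thesis
        using right unfolding U has_field_derivative_iff by (intro Lim_Un)
    qed
  qed
  then show ?thesis using f f' Ca_subset_C0[of a b] ab unfolding C1_0_def by auto
qed

text \<open>Closedness of the generator of \<open>P\<close> is used twice: from functions with flat
  start to the whole Riemann-Liouville core, through the correctors, and from that core to the full
  domain of \<open>T\<close>.\<close>

lemma RL_generator_subset:
  assumes H: "H0 \<nu>" and P: "generates_D_plus b \<nu> P" and T: "generates_D_RL a b \<nu> T" and ab: "a < b"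
    and f: "f \<in> gen_dom (Ca a b) T"
  shows "f \<in> gen_dom (C0 {..b}) P" "gen_op P f = gen_op T f"
proof -
  have ab': "a \<le> b" using ab by simp
  interpret T: contraction_semigroup "Ca a b" T
    using T by (intro contraction_semigroup_Ca) (simp add: generates_D_RL_def generates_with_core_def)
  interpret P: contraction_semigroup "C0 {..b}" P
    using P by (intro contraction_semigroup_C0) (simp add: generates_D_plus_def generates_with_core_def)
  have T_core: "f \<in> gen_dom (Ca a b) T" "gen_op T f = neg_D_plus b \<nu> f" if "f \<in> RL_core a b" for f
    using T that RL_core_neg_D[OF H ab' that] unfolding generates_D_RL_def generates_with_core_def by auto
  have flat: "f \<in> gen_dom (C0 {..b}) P" "gen_op P f = neg_D_plus b \<nu> f"
    if f: "f \<in> RL_core a b" "f' \<in> Ca a b" "\<And>t. t \<in> {a..b} \<Longrightarrow> (f has_real_derivative f' t) (at t within {a..b})" for f f'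
  proof -
    have "f \<in> C1_0 {..b}" using flat_core_C1_atMost[OF _ f(2) ab f(3)] f(1) by simp
    \<comment> \<open>The core of \<open>P\<close> also asks the image to vanish at infinity. This
      is read off from \<open>T\<close>: the image is a value of the generator of \<open>T\<close>,
      hence in \<open>Ca a b\<close>.\<close>
    moreover have "neg_D_plus b \<nu> f \<in> C0 {..b}"
      using T.gen_domD(2)[OF T_core(1)[OF f(1)]] T_core(2)[OF f(1)] Ca_subset_C0[OF ab'] by auto
    ultimately show "f \<in> gen_dom (C0 {..b}) P" "gen_op P f = neg_D_plus b \<nu> f"
      using P unfolding generates_D_plus_def generates_with_core_def by auto
  qed
  have core: "f \<in> gen_dom (C0 {..b}) P \<and> gen_op P f = neg_D_plus b \<nu> f" if f: "f \<in> RL_core a b" for f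
  proof -
    let ?k = "flat_corr a b"
    obtain f' where f': "f' \<in> C0 {a..b}" "\<And>t. t \<in> {a..b} \<Longrightarrow> (f has_real_derivative f' t) (at t within {a..b})"
      using f by (auto simp: C1_0_def)
    define c where "c = f' a"
    define h where "h n t = f t - c * ?k n t" for n t
    have jf: "jump_bounded b f" by (rule RL_core_jump_bounded[OF f ab'])
    have jk: "jump_bounded b (?k n)" for n by (rule RL_core_jump_bounded[OF flat_corr_core ab'])
    have "h n \<in> gen_dom (C0 {..b}) P \<and> gen_op P (h n) = neg_D_plus b \<nu> (h n)" for n
    proof -
      define k' where "k' t = exp (- real (Suc n) * (t - a))" for t
      have hd: "(h n has_real_derivative f' t - c * k' t) (at t within {a..b})" if t: "t \<in> {a..b}" for t
      proof -
        have "((\<lambda>t. (1 - exp (- real (Suc n) * (t - a))) / real (Suc n)) has_real_derivative k' t) (at t within {a..b})"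
          unfolding k'_def by (rule flat_corr_derivative) simp
        then have "(?k n has_real_derivative k' t) (at t within {a..b})"
          by (rule has_field_derivative_transform_within[where d=1]) (use t in \<open>auto simp: flat_corr_def\<close>)
        then show ?thesis unfolding h_def by (intro DERIV_diff DERIV_cmult f' t)
      qed
      define h' where "h' t = (if t \<in> {a..b} then f' t - c * k' t else 0)" for t
      have "continuous_on {a..b} (\<lambda>t. f' t - c * k' t)"
        using f'(1) unfolding k'_def by (auto simp: C0_def intro!: continuous_intros)
      then have h'c: "continuous_on {a..b} h'" by (rule continuous_on_eq) (simp add: h'_def)
      have h': "h' \<in> Ca a b" using h'c by (auto simp: Ca_iff h'_def c_def k'_def)
      have hC: "h n \<in> Ca a b"
        using T.diff_in[OF _ T.scale_in, of f "?k n" c] f flat_corr_core[of a b n] by (simp add: h_def[abs_def])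
      have "h n \<in> RL_core a b"
        using hC h' hd unfolding C1_0_def by (auto simp: Ca_def h'_def intro!: bexI[of _ h'])
      from flat[OF this h'] hd show ?thesis by (simp add: h'_def)
    qed
    then have h: "\<And>n. h n \<in> gen_dom (C0 {..b}) P" "\<And>n. gen_op P (h n) = neg_D_plus b \<nu> (h n)" by auto
    have 1: "uniform_limit UNIV h f sequentially"
      unfolding uniform_limit_sequentially_real_iff
    proof (intro allI impI)
      fix e :: real assume "e > 0"
      obtain N where N: "\<bar>c\<bar> / e \<le> real N" using real_arch_simple by blast
      have "\<bar>h n t - f t\<bar> \<le> e" if "n \<ge> N" for n t
      proof -
        have "\<bar>h n t - f t\<bar> \<le> \<bar>c\<bar> * (1 / real (Suc n))"
        proof -
          have "\<bar>h n t - f t\<bar> = \<bar>c\<bar> * \<bar>?k n t\<bar>" by (simp add: h_def abs_mult)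
          also have "\<dots> \<le> \<bar>c\<bar> * (1 / real (Suc n))"
            using flat_corr_bounds[of a b n t] by (intro mult_left_mono) (auto simp del: of_nat_Suc)
          finally show ?thesis .
        qed
        also have "\<dots> \<le> e"
        proof -
          have "\<bar>c\<bar> \<le> real N * e" using N \<open>e > 0\<close> by (simp add: field_simps)
          also have "\<dots> \<le> Suc n * e" using that \<open>e > 0\<close> by (intro mult_right_mono) auto
          finally show ?thesis by (simp add: field_simps)
        qed
        finally show ?thesis .
      qed
      then show "\<exists>N. \<forall>n\<ge>N. \<forall>t. \<bar>h n t - f t\<bar> \<le> e" by blast
    qed
    have 2: "uniform_limit UNIV (\<lambda>n. gen_op P (h n)) (neg_D_plus b \<nu> f) sequentially"
      unfolding uniform_limit_sequentially_real_iff
    proof (intro allI impI)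
      fix e :: real assume "e > 0"
      then have "e / (\<bar>c\<bar> + 1) > 0" by simp
      then obtain N where N: "\<And>n t. n \<ge> N \<Longrightarrow> \<bar>neg_D_plus b \<nu> (?k n) t\<bar> \<le> e / (\<bar>c\<bar> + 1)"
        using flat_corr_neg_D_tendsto_0[OF H ab'] by blast
      have "\<bar>gen_op P (h n) t - neg_D_plus b \<nu> f t\<bar> \<le> e" if "n \<ge> N" for n t
      proof -
        have "gen_op P (h n) t - neg_D_plus b \<nu> f t = - c * neg_D_plus b \<nu> (?k n) t"
          using neg_D_plus_diff[OF H jf jk, of c n t] h(2)[of n] by (simp add: h_def[abs_def])
        then have "\<bar>gen_op P (h n) t - neg_D_plus b \<nu> f t\<bar> = \<bar>c\<bar> * \<bar>neg_D_plus b \<nu> (?k n) t\<bar>"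
          by (simp add: abs_mult)
        also have "\<dots> \<le> (\<bar>c\<bar> + 1) * (e / (\<bar>c\<bar> + 1))"
          using N[OF that] by (intro mult_mono) auto
        finally show ?thesis by simp
      qed
      then show "\<exists>N. \<forall>n\<ge>N. \<forall>t. \<bar>gen_op P (h n) t - neg_D_plus b \<nu> f t\<bar> \<le> e" by blast
    qed
    have fP: "f \<in> C0 {..b}" using f Ca_subset_C0[OF ab'] by auto
    have gP: "neg_D_plus b \<nu> f \<in> C0 {..b}"
      using T.gen_domD(2)[OF T_core(1)[OF f]] T_core(2)[OF f] Ca_subset_C0[OF ab'] by auto
    show ?thesis using P.gen_closed[OF h(1) fP gP 1 2] by simp
  qed
  obtain h where h: "\<And>n::nat. h n \<in> RL_core a b" "uniform_limit UNIV h f sequentially"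
    "uniform_limit UNIV (\<lambda>n. neg_D_RL a b \<nu> (h n)) (gen_op T f) sequentially"
  proof -
    have "\<forall>f\<in>gen_dom (Ca a b) T. \<exists>h. (\<forall>n::nat. h n \<in> RL_core a b) \<and> uniform_limit UNIV h f sequentially \<and>
        uniform_limit UNIV (\<lambda>n. neg_D_RL a b \<nu> (h n)) (gen_op T f) sequentially"
      using T unfolding generates_D_RL_def generates_with_core_def by (elim conjE)
    from bspec[OF this f] show ?thesis using that by metis
  qed
  have fP: "f \<in> C0 {..b}" "gen_op T f \<in> C0 {..b}" using T.gen_domD[OF f] Ca_subset_C0[OF ab'] by auto
  have 1: "\<And>n. h n \<in> gen_dom (C0 {..b}) P" using core[OF h(1)] by simp
  have 2: "uniform_limit UNIV (\<lambda>n. gen_op P (h n)) (gen_op T f) sequentially"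
    using h(3) core[OF h(1)] RL_core_neg_D[OF H ab' h(1)] by simp
  show "f \<in> gen_dom (C0 {..b}) P" "gen_op P f = gen_op T f"
    using P.gen_closed[OF 1 fP h(2) 2] by auto
qed

lemma RL_core_dense:
  assumes f: "f \<in> Ca a b" and "e > 0" and ab: "a \<le> b"
  shows "\<exists>g\<in>RL_core a b. \<forall>t. \<bar>f t - g t\<bar> \<le> e"
proof -
  have "e/2 > 0" using \<open>e > 0\<close> by simp
  moreover have "continuous_on {a..b} f" using f by (simp add: Ca_iff)
  ultimately obtain p where p: "polynomial_function p" "\<And>t. t \<in> {a..b} \<Longrightarrow> norm (f t - p t) < e/2"
    using Stone_Weierstrass_polynomial_function[of "{a..b}" f "e/2"] by auto
  obtain p' where p': "polynomial_function p'" "\<And>t. (p has_vector_derivative p' t) (at t)"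
    using has_vector_derivative_polynomial_function[OF p(1)] by metis
  \<comment> \<open>Subtracting \<open>p a\<close> restores the value 0 at \<open>a\<close>, at the
    price of a second e/2.\<close>
  let ?g = "\<lambda>t. if t \<in> {a..b} then p t - p a else 0"
  have "?g \<in> RL_core a b"
  proof (rule RL_coreI)
    show "((\<lambda>t. p t - p a) has_real_derivative p' t) (at t within {a..b})" for t
    proof -
      have "(p has_real_derivative p' t) (at t within {a..b})"
        using p'(2)[of t] has_field_derivative_at_within has_real_derivative_iff_has_vector_derivative by blast
      from DERIV_diff[OF this DERIV_const] show ?thesis by simp
    qed
    show "continuous_on {a..b} p'" by (rule continuous_on_polymonial_function[OF p'(1)])
  qed simp
  moreover have "\<bar>f t - ?g t\<bar> \<le> e" for t
  proof (cases "t \<in> {a..b}")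
    case True
    have "\<bar>f t - p t\<bar> < e/2" "\<bar>f a - p a\<bar> < e/2" using p(2)[of t] p(2)[of a] True ab by auto
    then have "\<bar>f t - (p t - p a)\<bar> \<le> e" using Ca_le[OF f, of a] by linarith
    then show ?thesis using True by simp
  next
    case False then show ?thesis using f \<open>e > 0\<close> by (auto simp: Ca_iff)
  qed
  ultimately show ?thesis by (intro bexI[of _ ?g] allI)
qed

text \<open>From here on \<open>T\<close> inherits the probabilistic meaning of \<open>P\<close>;
  the comparison of semigroups is fed with the inclusion of generators and the density of the
  core.\<close>

lemma RL_semigroup_eq:
  assumes H: "H0 \<nu>" and P: "generates_D_plus b \<nu> P" and T: "generates_D_RL a b \<nu> T" and ab: "a < b"
    and f: "f \<in> Ca a b" and s: "0 \<le> s"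
  shows "T s f = P s f"
proof (rule semigroups_agree[of "Ca a b" T "C0 {..b}" P])
  show "contraction_semigroup (Ca a b) T"
    using T by (intro contraction_semigroup_Ca) (simp add: generates_D_RL_def generates_with_core_def)
  show "contraction_semigroup (C0 {..b}) P"
    using P by (intro contraction_semigroup_C0) (simp add: generates_D_plus_def generates_with_core_def)
  fix e :: real assume "e > 0"
  then obtain g where "g \<in> RL_core a b" "\<forall>t. \<bar>f t - g t\<bar> \<le> e" using RL_core_dense[OF f, of e] ab by auto
  then show "\<exists>g\<in>gen_dom (Ca a b) T. \<forall>t. \<bar>f t - g t\<bar> \<le> e"
    using T by (auto simp: generates_D_RL_def generates_with_core_def)
qed (use RL_generator_subset[OF H P T ab] Ca_subset_C0[of a b] ab f s in auto)

text \<open>The natural test function is \<open>exp t\<close> on (a,b], since a jump of size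
  \<open>r\<close> lowers it by the factor exp (- r), but it does not vanish at \<open>a\<close>.
  The second factor brings it into the core and increases to 1 at every t > a as \<open>n\<close>
  grows.\<close>

definition barrier :: "real \<Rightarrow> real \<Rightarrow> nat \<Rightarrow> real \<Rightarrow> real" where
  "barrier a b n t = (if t \<in> {a..b} then exp t * (1 - exp (- real n * (t - a))) else 0)"

lemma barrier_core: "barrier a b n \<in> RL_core a b"
proof -
  have "(\<lambda>t. if t \<in> {a..b} then exp t * (1 - exp (- real n * (t - a))) else 0) \<in> RL_core a b"
    by (rule RL_coreI[where h'="\<lambda>t. exp t * (1 - exp (- real n * (t - a))) + exp t * (real n * exp (- real n * (t - a)))"])
      (auto intro!: derivative_eq_intros continuous_intros simp: algebra_simps)
  then show ?thesis by (simp add: barrier_def[abs_def])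
qed

lemma barrier_nonneg: "0 \<le> barrier a b n t"
  by (auto simp: barrier_def)

text \<open>Both factors increase with \<open>t\<close>: the exponential supplies the factor exp (-
  r), and the cut-off can only decrease along the jump. A jump below \<open>a\<close> ends at
  0.\<close>

lemma barrier_jump:
  assumes "t \<le> b" "r > 0"
  shows "barrier a b n (t - r) \<le> exp (- r) * barrier a b n t"
proof (cases "a \<le> t - r")
  case True
  have "exp (t - r) * (1 - exp (- real n * (t - r - a))) \<le> exp (t - r) * (1 - exp (- real n * (t - a)))"
    using assms by (intro mult_left_mono) (auto intro!: mult_left_mono)
  also have "\<dots> = exp (- r) * (exp t * (1 - exp (- real n * (t - a))))"
    by (simp add: exp_diff exp_minus field_simps)
  finally show ?thesis using True assms by (simp add: barrier_def)
next
  case False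
  then have "barrier a b n (t - r) = 0" by (simp add: barrier_def)
  then show ?thesis using barrier_nonneg[of a b n t] by simp
qed

text \<open>Since the exponential factor decreases by \<open>exp (- r)\<close> over a jump of size \<open>r\<close> whatever the
  value of \<open>n\<close>, jumps of size in \<open>[\<epsilon>/2, \<epsilon>]\<close> already give a rate that does not depend on \<open>n\<close>.\<close>

lemma barrier_supersolution:
  assumes H: "H0 \<nu>" and H1: "H1a \<nu>" and ab: "a \<le> b"
  obtains c where "c > 0" "\<And>n t. neg_D_RL a b \<nu> (barrier a b n) t \<le> - c * barrier a b n t"
proof -
  obtain \<epsilon> \<delta> where e: "\<epsilon> > 0" "\<delta> > 0" "\<And>t r. 0 < r \<Longrightarrow> r < \<epsilon> \<Longrightarrow> \<delta> \<le> \<nu> t r"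
    using H1 unfolding H1a_def by blast
  \<comment> \<open>The jumps in the window have total rate at least \<delta> * \<epsilon>/2, and
    each removes at least the fraction 1 - exp (- \<epsilon>/2) of the value.\<close>
  define c where "c = (1 - exp (- \<epsilon>/2)) * \<delta> * (\<epsilon>/2)"
  have c: "c > 0" using e by (simp add: c_def)
  have "neg_D_plus b \<nu> (barrier a b n) t \<le> - c * barrier a b n t" for n t
  proof (cases "t \<le> b")
    case True
    let ?f = "barrier a b n"
    have jb: "jump_bounded b ?f" by (rule RL_core_jump_bounded[OF barrier_core ab])
    define q where "q = (1 - exp (- \<epsilon>/2)) * \<delta> * ?f t"
    have q: "0 \<le> q" using e barrier_nonneg[of a b n t] by (simp add: q_def)
    \<comment> \<open>No jump raises \<open>?f\<close>, so jumps outside the window contribute at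
      most 0 and are dropped.\<close>
    have "(LINT r:{0<..}|lborel. (?f (t - r) - ?f t) * \<nu> t r) \<le> (LINT r:{0<..}|lborel. - q * indicator {\<epsilon>/2<..<\<epsilon>} r)"
    proof (rule set_integral_mono)
      show "set_integrable lborel {0<..} (\<lambda>r. (?f (t - r) - ?f t) * \<nu> t r)"
        by (rule jump_integrable[OF H jb True]) auto
      have "integrable lborel (\<lambda>r. indicator ({0<..} \<inter> {\<epsilon>/2<..<\<epsilon>}) r :: real)"
      proof (rule integrable_real_indicator)
        have "emeasure lborel ({0<..} \<inter> {\<epsilon>/2<..<\<epsilon>}) \<le> emeasure lborel {\<epsilon>/2<..<\<epsilon>}"
          by (rule emeasure_mono) auto
        then show "emeasure lborel ({0<..} \<inter> {\<epsilon>/2<..<\<epsilon>}) < \<infinity>"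
          using e by (auto simp: order_le_less_trans)
      qed simp
      then show "set_integrable lborel {0<..} (\<lambda>r. - q * indicator {\<epsilon>/2<..<\<epsilon>} r)"
        unfolding set_integrable_def by (simp add: indicator_inter_arith mult.left_commute)
      fix r :: real assume "r \<in> {0<..}"
      then have r: "r > 0" by simp
      have le: "?f (t - r) - ?f t \<le> - (1 - exp (- r)) * ?f t"
        using barrier_jump[OF True r, of a n] by (simp add: algebra_simps)
      show "(?f (t - r) - ?f t) * \<nu> t r \<le> - q * indicator {\<epsilon>/2<..<\<epsilon>} r"
      proof (cases "r \<in> {\<epsilon>/2<..<\<epsilon>}")
        case True
        have "q = (1 - exp (- \<epsilon>/2)) * ?f t * \<delta>" by (simp add: q_def)
        also have "\<dots> \<le> (1 - exp (- r)) * ?f t * \<nu> t r"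
          using True e r barrier_nonneg[of a b n t] by (intro mult_mono) auto
        finally have "q \<le> (1 - exp (- r)) * ?f t * \<nu> t r" .
        moreover have "(?f (t - r) - ?f t) * \<nu> t r \<le> (- (1 - exp (- r)) * ?f t) * \<nu> t r"
          using le H0_nonneg[OF H r] by (intro mult_right_mono)
        ultimately have "(?f (t - r) - ?f t) * \<nu> t r \<le> - q" by linarith
        then show ?thesis using True by simp
      next
        case False
        have "- (1 - exp (- r)) * ?f t \<le> 0" using barrier_nonneg[of a b n t] r by (simp add: mult_nonpos_nonneg)
        then have "?f (t - r) - ?f t \<le> 0" using le by linarith
        then show ?thesis using False H0_nonneg[OF H r] by (simp add: mult_nonpos_nonneg)
      qed
    qed
    also have "\<dots> = - q * (\<epsilon>/2)"
    proof -
      have "(LINT r:{0<..}|lborel. - q * indicator {\<epsilon>/2<..<\<epsilon>} r) = (LINT r|lborel. - q * indicator {\<epsilon>/2<..<\<epsilon>} r)"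
        unfolding set_lebesgue_integral_def using e by (intro Bochner_Integration.integral_cong) (auto simp: indicator_def)
      then show ?thesis using e by simp
    qed
    also have "\<dots> = - c * ?f t" by (simp add: q_def c_def)
    finally show ?thesis using True by (simp add: neg_D_plus_def)
  qed (simp add: neg_D_plus_def barrier_def)
  then show ?thesis using that c RL_core_neg_D[OF H ab barrier_core] by metis
qed

text \<open>Gronwall along the semigroup: the derivative of exp (c * r) times \<open>T r\<close> f
  is exp (c * r) times \<open>T r\<close> applied to c * f plus the generator of f. That function is
  nonpositive by \<open>barrier_supersolution\<close>, so positivity of \<open>T\<close> makes the
  product non-increasing in \<open>r\<close>.\<close>

lemma barrier_decay:
  assumes H: "H0 \<nu>" and H1: "H1a \<nu>" and T: "generates_D_RL a b \<nu> T" and ab: "a \<le> b"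
  obtains c where "c > 0" "\<And>n s t. 0 \<le> s \<Longrightarrow> T s (barrier a b n) t \<le> exp (- c * s) * barrier a b n t"
proof -
  interpret T: contraction_semigroup "Ca a b" T
    using T by (intro contraction_semigroup_Ca) (simp add: generates_D_RL_def generates_with_core_def)
  obtain c where c: "c > 0" "\<And>n t. neg_D_RL a b \<nu> (barrier a b n) t \<le> - c * barrier a b n t"
    using barrier_supersolution[OF H H1 ab] by metis
  have "T s (barrier a b n) t \<le> exp (- c * s) * barrier a b n t" if s: "0 \<le> s" for n s t
  proof -
    let ?f = "barrier a b n"
    have f: "?f \<in> gen_dom (Ca a b) T" "gen_op T ?f = neg_D_RL a b \<nu> ?f"
      using T barrier_core[of a b n] unfolding generates_D_RL_def generates_with_core_def by auto
    note fV = T.gen_domD[OF f(1)]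
    define G where "G r = exp (c * r) * T r ?f t" for r
    have "G s \<le> G 0"
    proof (rule DERIV_nonpos_imp_decreasing_open[OF s])
      fix r assume r: "0 < r" "r < s"
      have "r \<in> interior {0..}" using r by simp
      then have "((\<lambda>r. T r ?f t) has_real_derivative T r (gen_op T ?f) t) (at r)"
        using T.gen_derivative[OF f(1), of r t] r at_within_interior[of r "{0..}"] by auto
      then have D: "(G has_real_derivative c * exp (c * r) * T r ?f t + exp (c * r) * T r (gen_op T ?f) t) (at r)"
        unfolding G_def by (auto intro!: derivative_eq_intros)
      have r0: "0 \<le> r" using r by simp
      have "0 \<le> T r (\<lambda>x. - c * ?f x + - 1 * gen_op T ?f x) t"
        using c(2)[of n] f(2) by (intro T.T_nonneg r0 T.lincomb fV) auto
      then have "c * T r ?f t + T r (gen_op T ?f) t \<le> 0"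
        using T.T_lin[OF r0 fV, of "- c" "- 1"] by simp
      then have "exp (c * r) * (c * T r ?f t + T r (gen_op T ?f) t) \<le> 0"
        by (intro mult_nonneg_nonpos) auto
      then show "\<exists>y. (G has_real_derivative y) (at r) \<and> y \<le> 0"
        using D by (intro exI conjI) (auto simp: algebra_simps)
    next
      show "continuous_on {0..s} G"
        unfolding G_def using continuous_on_subset[OF T.orbit_continuous[OF fV(1)], of "{0..s}" t]
        by (auto intro!: continuous_intros)
    qed
    then show ?thesis
      using T.T_0[OF fV(1)] by (simp add: G_def exp_minus field_simps)
  qed
  then show ?thesis using that c(1) by blast
qed

section \<open>Feller processes\<close>

lemma space_compactified_borel [simp]: "space compactified_borel = UNIV"
  by (simp add: compactified_borel_def)

lemma sets_compactified_borel:
  "sets compactified_borel = sigma_sets UNIV {U. openin (Alexandroff_compactification euclidean) U}"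
  by (simp add: compactified_borel_def)

lemma Some_image_open: "open U \<Longrightarrow> Some ` U \<in> sets compactified_borel"
  unfolding sets_compactified_borel by (intro sigma_sets.Basic) simp

lemma None_in_compactified_borel: "{None} \<in> sets (compactified_borel :: 'a::topological_space option measure)"
proof -
  have "space compactified_borel - Some ` UNIV \<in> sets (compactified_borel :: 'a option measure)"
    by (intro sets.compl_sets Some_image_open) simp
  moreover have "space compactified_borel - Some ` UNIV = {None :: 'a option}"
    by (auto simp: notin_range_Some)
  ultimately show ?thesis by simp
qed

text \<open>\<open>the None\<close> is unspecified but a fixed element, so the preimage of an open
  set is its image under \<open>Some\<close>, possibly with the cemetery added.\<close>

lemma measurable_the [measurable]: "the \<in> measurable compactified_borel borel"
proof (rule borel_measurableI)
  fix S :: "'a set" assume "open S"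
  have "the -` S = Some ` S \<union> (if the None \<in> S then {None} else {})"
  proof (intro set_eqI)
    fix z show "z \<in> the -` S \<longleftrightarrow> z \<in> Some ` S \<union> (if the None \<in> S then {None} else {})"
      by (cases z) auto
  qed
  then show "the -` S \<inter> space compactified_borel \<in> sets compactified_borel"
    using sets.Un[OF None_in_compactified_borel Some_image_open[OF \<open>open S\<close>]] Some_image_open[OF \<open>open S\<close>]
    by auto
qed

lemma measurable_Some: "Some \<in> measurable borel compactified_borel"
  unfolding compactified_borel_def
proof (rule measurable_measure_of)
  fix V :: "'a option set" assume "V \<in> {U. openin (Alexandroff_compactification euclidean) U}"
  then have "open {x. Some x \<in> V}"
    using continuous_map_Some[of "euclidean :: 'a topology"] unfolding continuous_map_def by auto
  then show "Some -` V \<inter> space borel \<in> sets borel" by (simp add: vimage_def)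
qed auto

lemma measurable_is_None [measurable]: "Measurable.pred compactified_borel (\<lambda>z. z = None)"
  using None_in_compactified_borel by (simp add: pred_def)

lemma ext0_eq: "ext0 f z = (if z = None then 0 else f (the z))"
  by (cases z) (auto simp: ext0_def)

lemma ext0_Some [simp]: "ext0 f (Some x) = f x"
  and ext0_None [simp]: "ext0 f None = 0"
  by (simp_all add: ext0_def)

lemma measurable_ext0:
  assumes "f \<in> borel_measurable borel" "Y \<in> measurable N compactified_borel"
  shows "(\<lambda>w. ext0 f (Y w)) \<in> borel_measurable N"
proof -
  note [measurable] = assms
  show ?thesis unfolding ext0_eq by measurable
qed

lemma measurable_ext0_pair:
  fixes g :: "real \<times> 'a::second_countable_topology \<Rightarrow> real"
  assumes "g \<in> borel_measurable borel" "Z \<in> borel_measurable N" "Y \<in> measurable N compactified_borel"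
  shows "(\<lambda>w. ext0 (\<lambda>y. g (Z w, y)) (Y w)) \<in> borel_measurable N"
proof -
  note [measurable] = assms
  show ?thesis unfolding ext0_eq by measurable
qed

lemma space_path_sigma [simp]: "space (path_sigma M I X) = space M"
  unfolding path_sigma_def by (intro space_measure_of) auto

lemma sets_path_sigma:
  "sets (path_sigma M I X) = sigma_sets (space M) (\<Union>s\<in>I. {X s -` B \<inter> space M | B. B \<in> sets compactified_borel})"
  unfolding path_sigma_def by (intro sets_measure_of) auto

lemma path_sigma_measurable:
  assumes "s \<in> I"
  shows "X s \<in> measurable (path_sigma M I X) compactified_borel"
proof (rule measurableI)
  fix B assume "B \<in> sets (compactified_borel :: 'b option measure)"
  then show "X s -` B \<inter> space (path_sigma M I X) \<in> sets (path_sigma M I X)"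
    unfolding sets_path_sigma using assms by (intro sigma_sets.Basic) auto
qed simp

lemma path_sigma_subalgebra:
  assumes "\<And>s. s \<in> I \<Longrightarrow> X s \<in> measurable M compactified_borel"
  shows "subalgebra M (path_sigma M I X)"
  unfolding subalgebra_def sets_path_sigma
  by (auto intro!: sets.sigma_sets_subset measurable_sets assms)

text \<open>The Markov property is taken at time 0, where the process sits at \<open>x\<close> and
  the conditional expectation is therefore almost surely constant; integrating removes the
  conditioning.\<close>

lemma feller_process_expectation:
  assumes X: "feller_process M E T x X" and f: "f \<in> C0 E" "f \<in> borel_measurable borel" and r: "0 \<le> r"
  shows "T r f x = (\<integral>\<omega>. ext0 f (X r \<omega>) \<partial>M)"
proof -
  interpret prob_space M using X by (simp add: feller_process_def)
  have Xm: "\<And>s. 0 \<le> s \<Longrightarrow> X s \<in> measurable M compactified_borel"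
    and X0: "\<And>\<omega>. \<omega> \<in> space M \<Longrightarrow> X 0 \<omega> = Some x"
    using X by (auto simp: feller_process_def)
  let ?F = "path_sigma M {0..0} X"
  have sub: "subalgebra M ?F" using Xm by (intro path_sigma_subalgebra) auto
  interpret F: finite_measure_subalgebra M ?F using sub by unfold_locales
  obtain B where B: "\<And>x. \<bar>f x\<bar> \<le> B" using C0_bounded[OF f(1)] by (auto simp: bounded_iff)
  have B0: "0 \<le> B" using B[of x] by linarith
  have int: "integrable M (\<lambda>\<omega>. ext0 f (X r \<omega>))"
    using B B0 r by (intro integrable_const_bound[where B=B] measurable_ext0 f Xm) (auto simp: ext0_eq)
  have "AE \<omega> in M. real_cond_exp M ?F (\<lambda>\<omega>. ext0 f (X (0 + r) \<omega>)) \<omega> = ext0 (T r f) (X 0 \<omega>)"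
    using X f(1) r unfolding feller_process_def by blast
  then have "AE \<omega> in M. real_cond_exp M ?F (\<lambda>\<omega>. ext0 f (X r \<omega>)) \<omega> = T r f x"
    using X0 by (auto elim!: AE_mp intro!: AE_I2)
  then have "(\<integral>\<omega>. real_cond_exp M ?F (\<lambda>\<omega>. ext0 f (X r \<omega>)) \<omega> \<partial>M) = (\<integral>\<omega>. T r f x \<partial>M)"
    by (intro integral_cong_AE) auto
  then show ?thesis using F.real_cond_exp_int(2)[OF int] by (simp add: prob_space)
qed

text \<open>For an open \<open>U\<close> containing 0, the set where \<open>f\<close> leaves
  \<open>U\<close> is closed in \<open>E\<close> and lies in a compact set, because \<open>f\<close>
  vanishes at infinity. Its complement is a neighbourhood of the cemetery, where
  \<open>ext0 f\<close> is 0.\<close>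

lemma continuous_map_ext0:
  fixes E :: "'a::t2_space set"
  assumes f: "f \<in> C0 E"
  shows "continuous_map (Alexandroff_compactification (top_of_set E)) euclidean (ext0 f)"
  unfolding continuous_map_def
proof (intro conjI allI impI)
  have c: "continuous_on E f" using f by (simp add: C0_def)
  fix U :: "real set" assume "openin euclidean U"
  then have U: "open U" by simp
  let ?S = "{z \<in> topspace (Alexandroff_compactification (top_of_set E)). ext0 f z \<in> U}"
  have op: "openin (top_of_set E) {x \<in> E. f x \<in> U}"
    using continuous_openin_preimage_gen[OF c U] by (simp add: vimage_def Int_def conj_commute)
  show "openin (Alexandroff_compactification (top_of_set E)) ?S"
  proof (cases "0 \<in> U")
    case False
    then have "?S = Some ` {x \<in> E. f x \<in> U}" by auto
    then show ?thesis using op by simp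
  next
    case True
    let ?C = "{x \<in> E. f x \<notin> U}"
    have "?S = insert None (Some ` (topspace (top_of_set E) - ?C))" using True by auto
    moreover have cl: "closedin (top_of_set E) ?C"
      using closedin_diff[OF closedin_topspace op] by (simp add: set_diff_eq) (metis (mono_tags, lifting) Collect_cong)
    moreover have "compactin (top_of_set E) ?C"
    proof -
      obtain e where e: "e > 0" "ball 0 e \<subseteq> U" using U True open_contains_ball by blast
      obtain K where K: "compact K" "K \<subseteq> E" "\<And>x. x \<in> E - K \<Longrightarrow> \<bar>f x\<bar> < e"
        using C0_small_off_compact[OF f e(1)] by blast
      have "?C \<subseteq> K"
      proof
        fix x assume x: "x \<in> ?C"
        show "x \<in> K"
        proof (rule ccontr)
          assume "x \<notin> K"
          then have "f x \<in> ball 0 e" using K(3)[of x] x by (simp add: dist_real_def)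
          then show False using e x by auto
        qed
      qed
      moreover have "closedin (top_of_set K) ?C"
        using closedin_subset_trans[OF cl _ K(2)] \<open>?C \<subseteq> K\<close> by simp
      ultimately have "compact ?C" using K(1) closedin_compact by blast
      then show ?thesis by (auto simp: compactin_subtopology compactin_euclidean_iff)
    qed
    ultimately show ?thesis unfolding openin_Alexandroff_compactification by blast
  qed
qed auto

lemma feller_right_continuous:
  fixes E :: "'a::t2_space set"
  assumes X: "feller_process M E T x X" and f: "f \<in> C0 E" and "\<omega> \<in> space M" "0 \<le> s"
  shows "((\<lambda>r. ext0 f (X r \<omega>)) \<longlongrightarrow> ext0 f (X s \<omega>)) (at_right s)"
proof -
  have "limitin (Alexandroff_compactification (top_of_set E)) (\<lambda>r. X r \<omega>) (X s \<omega>) (at_right s)"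
    using X assms(3,4) by (auto simp: feller_process_def)
  from continuous_map_limit[OF continuous_map_ext0[OF f] this]
  show ?thesis by (simp add: comp_def)
qed

text \<open>Time is rounded up to a grid of mesh 1/(n+1): the rounded process takes countably many
  times and is jointly measurable, and right continuity gives convergence. \<open>max 0 s\<close>
  makes the function total on the real line.\<close>

lemma right_continuous_jointly_measurable:
  fixes F :: "real \<Rightarrow> 'w \<Rightarrow> real"
  assumes m: "\<And>s. 0 \<le> s \<Longrightarrow> F s \<in> borel_measurable N"
    and rc: "\<And>s \<omega>. 0 \<le> s \<Longrightarrow> \<omega> \<in> space N \<Longrightarrow> ((\<lambda>r. F r \<omega>) \<longlongrightarrow> F s \<omega>) (at_right s)"
  shows "(\<lambda>(s, \<omega>). F (max 0 s) \<omega>) \<in> borel_measurable (borel \<Otimes>\<^sub>M N)"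
proof (rule borel_measurable_LIMSEQ_real)
  \<comment> \<open>Floor plus one instead of ceiling: the grid point must lie strictly to the right
    of \<open>s\<close>, as the filter \<open>at_right\<close> excludes \<open>s\<close>
    itself.\<close>
  define q where "q n s = (real_of_int \<lfloor>max 0 s * Suc n\<rfloor> + 1) / Suc n" for n and s :: real
  have q: "max 0 s < q n s" "q n s \<le> max 0 s + 1 / Suc n" for n s
  proof -
    show "max 0 s < q n s" unfolding q_def by (subst pos_less_divide_eq) (auto simp del: of_nat_Suc max_less_iff_conj)
    have "q n s \<le> (max 0 s * Suc n + 1) / Suc n" unfolding q_def by (intro divide_right_mono) auto
    then show "q n s \<le> max 0 s + 1 / Suc n" by (simp add: add_divide_distrib del: of_nat_Suc)
  qed
  show "(\<lambda>n. case p of (s, \<omega>) \<Rightarrow> F (q n s) \<omega>) \<longlonglongrightarrow> (case p of (s, \<omega>) \<Rightarrow> F (max 0 s) \<omega>)"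
    if "p \<in> space (borel \<Otimes>\<^sub>M N)" for p
  proof -
    obtain s \<omega> where p: "p = (s, \<omega>)" by force
    then have \<omega>: "\<omega> \<in> space N" using that by (simp add: space_pair_measure)
    have "(\<lambda>n. q n s) \<longlonglongrightarrow> max 0 s"
    proof (rule tendsto_sandwich[of "\<lambda>_. max 0 s" _ _ "\<lambda>n. max 0 s + 1 / Suc n"])
      have "(\<lambda>n. max 0 s + 1 / Suc n) \<longlonglongrightarrow> max 0 s + 0"
        by (intro tendsto_intros LIMSEQ_Suc[OF lim_1_over_n])
      then show "(\<lambda>n. max 0 s + 1 / Suc n) \<longlonglongrightarrow> max 0 s" by simp
    qed (use q(2) less_imp_le[OF q(1)] in auto)
    then have "filterlim (\<lambda>n. q n s) (at_right (max 0 s)) sequentially"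
      using q(1)[of s] less_imp_neq[OF q(1)[of s]] unfolding filterlim_at greaterThan_iff
      by (intro conjI always_eventually allI) metis+
    from filterlim_compose[OF rc[OF _ \<omega>] this] show ?thesis by (simp add: p)
  qed
  show "(\<lambda>(s, \<omega>). F (q n s) \<omega>) \<in> borel_measurable (borel \<Otimes>\<^sub>M N)" for n
  proof -
    have "(\<lambda>p. F ((real k + 1) / Suc n) (snd p)) \<in> borel_measurable (borel \<Otimes>\<^sub>M N)" for k
      using m[of "(real k + 1) / Suc n"] by (intro measurable_compose[OF measurable_snd]) simp
    moreover have "(\<lambda>p. nat \<lfloor>max 0 (fst p :: real) * Suc n\<rfloor>) \<in> measurable (borel \<Otimes>\<^sub>M N) (count_space UNIV)"
      by measurable
    ultimately have "(\<lambda>p. F ((real (nat \<lfloor>max 0 (fst p :: real) * Suc n\<rfloor>) + 1) / Suc n) (snd p)) \<in> borel_measurable (borel \<Otimes>\<^sub>M N)"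
      by (rule measurable_compose_countable)
    then show ?thesis by (simp add: q_def case_prod_beta del: of_nat_Suc)
  qed
qed

text \<open>Freezing lemma. The second variable is the whole sample point read on \<open>FY\<close>;
  independence says that the joint law of \<open>Z\<close> and this point is a product measure, and
  Fubini does the rest. In this form \<open>h\<close> may depend on an entire path of the second
  process.\<close>

lemma (in prob_space) indep_integral:
  fixes h :: "real \<Rightarrow> 'a \<Rightarrow> real"
  assumes FX: "subalgebra M FX" and FY: "subalgebra M FY" and indep: "indep_set (sets FX) (sets FY)"
    and Z: "Z \<in> borel_measurable FX" and h: "(\<lambda>(z, \<omega>). h z \<omega>) \<in> borel_measurable (borel \<Otimes>\<^sub>M FY)"
    and B: "\<And>z \<omega>. \<bar>h z \<omega>\<bar> \<le> B"
  shows "(\<integral>\<omega>. h (Z \<omega>) \<omega> \<partial>M) = (\<integral>\<omega>'. (\<integral>\<omega>. h (Z \<omega>') \<omega> \<partial>M) \<partial>M)"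
proof -
  have ZM: "Z \<in> borel_measurable M" using measurable_from_subalg[OF FX Z] .
  have idM: "(\<lambda>\<omega>. \<omega>) \<in> measurable M FY" using measurable_from_subalg[OF FY measurable_ident] by (simp add: id_def)
  interpret DZ: prob_space "distr M borel Z" by (rule prob_space_distr[OF ZM])
  interpret DY: prob_space "distr M FY (\<lambda>\<omega>. \<omega>)" by (rule prob_space_distr[OF idM])
  interpret D: pair_prob_space "distr M borel Z" "distr M FY (\<lambda>\<omega>. \<omega>)" ..
  have eq: "distr M borel Z \<Otimes>\<^sub>M distr M FY (\<lambda>\<omega>. \<omega>) = distr M (borel \<Otimes>\<^sub>M FY) (\<lambda>\<omega>. (Z \<omega>, \<omega>))"
  proof (rule pair_measure_eqI)
    show "sigma_finite_measure (distr M borel Z)" "sigma_finite_measure (distr M FY (\<lambda>\<omega>. \<omega>))"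
      by unfold_locales
    fix A C assume A: "A \<in> sets (distr M borel Z)" and C: "C \<in> sets (distr M FY (\<lambda>\<omega>. \<omega>))"
    have sp: "space FX = space M" "space FY = space M" using FX FY by (auto simp: subalgebra_def)
    have ZA: "Z -` A \<inter> space M \<in> sets FX" using measurable_sets[OF Z, of A] A sp by simp
    have "prob ((Z -` A \<inter> space M) \<inter> C) = prob (Z -` A \<inter> space M) * prob C"
      using C by (intro indep_setD[OF indep ZA]) simp
    moreover have "(\<lambda>\<omega>. (Z \<omega>, \<omega>)) -` (A \<times> C) \<inter> space M = (Z -` A \<inter> space M) \<inter> C"
      by auto
    moreover have "C \<inter> space M = C" using C sets.sets_into_space[of C FY] sp by auto
    ultimately show "emeasure (distr M borel Z) A * emeasure (distr M FY (\<lambda>\<omega>. \<omega>)) C =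
        emeasure (distr M (borel \<Otimes>\<^sub>M FY) (\<lambda>\<omega>. (Z \<omega>, \<omega>))) (A \<times> C)"
      using A C ZM idM by (simp add: emeasure_distr emeasure_eq_measure ennreal_mult)
  qed (auto cong: sets_pair_measure_cong)
  have hm: "(\<lambda>(z, \<omega>). h z \<omega>) \<in> borel_measurable (distr M borel Z \<Otimes>\<^sub>M distr M FY (\<lambda>\<omega>. \<omega>))"
    using h by (simp cong: measurable_cong_sets)
  have int: "integrable (distr M borel Z \<Otimes>\<^sub>M distr M FY (\<lambda>\<omega>. \<omega>)) (\<lambda>(z, \<omega>). h z \<omega>)"
    using B hm by (intro D.integrable_const_bound[where B=B]) auto
  have hz: "h z \<in> borel_measurable FY" for z
    using measurable_Pair2[OF h, of z] by simp
  have "(\<integral>\<omega>. h (Z \<omega>) \<omega> \<partial>M) = (\<integral>p. (case p of (z, \<omega>) \<Rightarrow> h z \<omega>) \<partial>distr M (borel \<Otimes>\<^sub>M FY) (\<lambda>\<omega>. (Z \<omega>, \<omega>)))"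
    using ZM idM h by (subst integral_distr) auto
  also have "\<dots> = (\<integral>z. (\<integral>\<omega>. h z \<omega> \<partial>distr M FY (\<lambda>\<omega>. \<omega>)) \<partial>distr M borel Z)"
    unfolding eq[symmetric] using D.integral_fst'[OF int] by simp
  also have "\<dots> = (\<integral>z. (\<integral>\<omega>. h z \<omega> \<partial>M) \<partial>distr M borel Z)"
    using integral_distr[OF idM hz] by simp
  also have "\<dots> = (\<integral>\<omega>'. (\<integral>\<omega>. h (Z \<omega>') \<omega> \<partial>M) \<partial>M)"
  proof (rule integral_distr[OF ZM])
    have "(\<lambda>z. \<integral>\<omega>. h z \<omega> \<partial>distr M FY (\<lambda>\<omega>. \<omega>)) \<in> borel_measurable borel"
      using hm by (intro DY.borel_measurable_lebesgue_integral) (simp cong: measurable_cong_sets)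
    then show "(\<lambda>z. \<integral>\<omega>. h z \<omega> \<partial>M) \<in> borel_measurable borel"
      using integral_distr[OF idM hz] by simp
  qed
  finally show ?thesis .
qed

text \<open>Right continuity gives joint measurability of real-valued functions, so the state is
  encoded by functions vanishing at infinity: 1/(1+|y|^2) is 0 exactly at the cemetery, and dividing
  y_i/(1+|y|^2) by it recovers the coordinates. The parameter \<open>N\<close> is there because both
  \<open>M\<close> and the path sigma-algebra of \<open>Y\<close> occur.\<close>

lemma feller_jointly_measurable:
  fixes Y :: "real \<Rightarrow> 'w \<Rightarrow> ('a::euclidean_space) option"
  assumes Y: "feller_process M UNIV S x Y" and N: "space N = space M"
    and m: "\<And>s. 0 \<le> s \<Longrightarrow> Y s \<in> measurable N compactified_borel"
  shows "(\<lambda>(s, \<omega>). Y (max 0 s) \<omega>) \<in> measurable (borel \<Otimes>\<^sub>M N) compactified_borel"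
proof -
  have jm: "(\<lambda>(s, \<omega>). ext0 f (Y (max 0 s) \<omega>)) \<in> borel_measurable (borel \<Otimes>\<^sub>M N)" if f: "f \<in> C0 UNIV" for f
    using feller_right_continuous[OF Y f] N
    by (intro right_continuous_jointly_measurable measurable_ext0 m C0_borel[OF f]) auto
  define f0 where "f0 y = 1 / (1 + (norm y)\<^sup>2)" for y :: 'a
  define fi where "fi i y = (y \<bullet> i) / (1 + (norm y)\<^sup>2)" for i y :: 'a
  have pos: "1 + (norm y)\<^sup>2 > 0" for y :: 'a by (simp add: add_pos_nonneg)
  have small: "z / (1 + (norm y)\<^sup>2) < e" if y: "norm y > max 1 (1/e)" and "e > 0" "z \<le> norm y" for y :: 'a and z e
  proof -
    have "1 < e * norm y" using y \<open>e > 0\<close> by (simp add: field_simps)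
    then have "1 * norm y < (e * norm y) * norm y" using y by (intro mult_strict_right_mono) auto
    then have "norm y < e * (1 + (norm y)\<^sup>2)" using \<open>e > 0\<close> by (simp add: power2_eq_square algebra_simps add_strict_increasing)
    then show ?thesis using pos[of y] \<open>z \<le> norm y\<close> by (simp add: pos_divide_less_eq)
  qed
  have f0: "f0 \<in> C0 UNIV"
    unfolding C0_UNIV_iff f0_def
  proof (intro conjI allI impI)
    show "continuous_on UNIV (\<lambda>y::'a. 1 / (1 + (norm y)\<^sup>2))"
      using pos by (intro continuous_intros) (metis less_irrefl)
    fix e :: real assume "e > 0"
    then show "\<exists>R. \<forall>y::'a. R < norm y \<longrightarrow> \<bar>1 / (1 + (norm y)\<^sup>2)\<bar> < e"
      using small[of e _ 1] pos by (intro exI[of _ "max 1 (1/e)"]) (auto simp: abs_of_pos)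
  qed
  have fi: "fi i \<in> C0 UNIV" if i: "i \<in> Basis" for i
    unfolding C0_UNIV_iff fi_def
  proof (intro conjI allI impI)
    show "continuous_on UNIV (\<lambda>y::'a. (y \<bullet> i) / (1 + (norm y)\<^sup>2))"
      using pos by (intro continuous_intros) (metis less_irrefl)
    fix e :: real assume "e > 0"
    have "\<bar>(y \<bullet> i) / (1 + (norm y)\<^sup>2)\<bar> < e" if "max 1 (1/e) < norm y" for y
      using small[OF that \<open>e > 0\<close> Basis_le_norm[OF i]] pos[of y] by (simp add: abs_divide)
    then show "\<exists>R. \<forall>y::'a. R < norm y \<longrightarrow> \<bar>(y \<bullet> i) / (1 + (norm y)\<^sup>2)\<bar> < e" by blast
  qed
  define G where "G p = (case p of (s, \<omega>) \<Rightarrow> Y (max 0 s) \<omega>)" for p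
  have Gm: "(\<lambda>p. ext0 f (G p)) \<in> borel_measurable (borel \<Otimes>\<^sub>M N)" if "f \<in> C0 UNIV" for f
    using jm[OF that] by (simp add: G_def case_prod_beta)
  have eq: "G p = (if ext0 f0 (G p) = 0 then None else Some (\<Sum>i\<in>Basis. (ext0 (fi i) (G p) / ext0 f0 (G p)) *\<^sub>R i))" for p
  proof (cases "G p")
    case (Some y)
    have "f0 y \<noteq> 0" using pos[of y] by (simp add: f0_def)
    moreover have "fi i y / f0 y = y \<bullet> i" for i using pos[of y] by (simp add: f0_def fi_def)
    ultimately show ?thesis using Some by (simp add: euclidean_representation)
  qed simp
  have "(\<lambda>p. if ext0 f0 (G p) = 0 then None else Some (\<Sum>i\<in>Basis. (ext0 (fi i) (G p) / ext0 f0 (G p)) *\<^sub>R i))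
    \<in> measurable (borel \<Otimes>\<^sub>M N) compactified_borel"
  proof (rule measurable_If)
    show "(\<lambda>p. Some (\<Sum>i\<in>Basis. (ext0 (fi i) (G p) / ext0 f0 (G p)) *\<^sub>R i)) \<in> measurable (borel \<Otimes>\<^sub>M N) compactified_borel"
      by (intro measurable_compose[OF _ measurable_Some] borel_measurable_sum borel_measurable_scaleR
          borel_measurable_divide Gm f0 fi borel_measurable_const)
    show "{p \<in> space (borel \<Otimes>\<^sub>M N). ext0 f0 (G p) = 0} \<in> sets (borel \<Otimes>\<^sub>M N)"
      using Gm[OF f0] by measurable
  qed simp
  then have "G \<in> measurable (borel \<Otimes>\<^sub>M N) compactified_borel"
    by (subst (asm) eq[symmetric])
  then show ?thesis by (simp add: G_def[abs_def])
qed

section \<open>Non-increasing processes and their hitting times\<close>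

locale decreasing_process = prob_space M for M :: "'w measure" +
  fixes b t :: real and P :: "real \<Rightarrow> (real \<Rightarrow> real) \<Rightarrow> (real \<Rightarrow> real)" and X :: "real \<Rightarrow> 'w \<Rightarrow> real"
  assumes process: "decreasing_feller_process M b P t X"
begin

abbreviation "FX \<equiv> path_sigma M {0..} (\<lambda>s \<omega>. Some (X s \<omega>))"

lemma feller: "feller_process M {..b} P t (\<lambda>s \<omega>. Some (X s \<omega>))"
  and antimono: "\<omega> \<in> space M \<Longrightarrow> 0 \<le> r \<Longrightarrow> r \<le> s \<Longrightarrow> X s \<omega> \<le> X r \<omega>"
  using process by (auto simp: decreasing_feller_process_def monotone_on_def)

lemma le_b: "\<omega> \<in> space M \<Longrightarrow> 0 \<le> s \<Longrightarrow> X s \<omega> \<le> b"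
  and Some_X_measurable: "0 \<le> s \<Longrightarrow> (\<lambda>\<omega>. Some (X s \<omega>)) \<in> measurable M compactified_borel"
  using feller by (auto simp: feller_process_def)

lemma FX_subalgebra: "subalgebra M FX"
  by (intro path_sigma_subalgebra Some_X_measurable) simp

lemma X_measurable_FX: "0 \<le> s \<Longrightarrow> X s \<in> borel_measurable FX"
  using measurable_compose[OF path_sigma_measurable[of s "{0..}" "\<lambda>s \<omega>. Some (X s \<omega>)"] measurable_the] by simp

lemma X_measurable: "0 \<le> s \<Longrightarrow> X s \<in> borel_measurable M"
  using measurable_from_subalg[OF FX_subalgebra X_measurable_FX] .

lemma X_expectation:
  assumes "f \<in> C0 {..b}" "0 \<le> s"
  shows "P s f t = (\<integral>\<omega>. f (X s \<omega>) \<partial>M)"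
  using feller_process_expectation[OF feller assms(1) C0_borel[OF assms(1)] assms(2)] by simp

text \<open>The exponential vanishes at minus infinity, hence belongs to the functions on
  \<open>{..b}\<close> along which Feller paths are right-continuous; the logarithm then recovers
  the path itself.\<close>

lemma X_right_continuous:
  assumes "\<omega> \<in> space M" "0 \<le> s"
  shows "((\<lambda>r. X r \<omega>) \<longlongrightarrow> X s \<omega>) (at_right s)"
proof -
  define f where "f z = (if z \<le> b then exp z else 0)" for z :: real
  have "f \<in> C0 {..b}"
  proof -
    have "continuous_on {..b} f"
      by (rule continuous_on_eq[of _ exp]) (auto simp: f_def intro!: continuous_intros)
    moreover have "\<exists>K. compact K \<and> K \<subseteq> {..b} \<and> (\<forall>z\<in>{..b} - K. \<bar>f z\<bar> < e)" if "e > 0" for e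
    proof (intro exI[of _ "{ln e..b}"] conjI ballI)
      fix z assume "z \<in> {..b} - {ln e..b}"
      then have "exp z < exp (ln e)" by (auto simp del: exp_ln)
      then show "\<bar>f z\<bar> < e" using that by (simp add: f_def)
    qed auto
    ultimately show ?thesis by (auto simp: C0_def f_def)
  qed
  from feller_right_continuous[OF feller this assms]
  have lim: "((\<lambda>r. f (X r \<omega>)) \<longlongrightarrow> exp (X s \<omega>)) (at_right s)"
    using le_b[OF assms] by (simp add: f_def)
  have "eventually (\<lambda>r. f (X r \<omega>) = exp (X r \<omega>)) (at_right s)"
    using eventually_at_right_less[of s] by eventually_elim (use le_b assms in \<open>auto simp: f_def\<close>)
  from tendsto_ln[OF Lim_transform_eventually[OF lim this]] show ?thesis by simp
qed

lemma X_jointly_measurable: "(\<lambda>(s, \<omega>). X (max 0 s) \<omega>) \<in> borel_measurable (borel \<Otimes>\<^sub>M M)"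
  using X_right_continuous by (intro right_continuous_jointly_measurable X_measurable) auto

text \<open>Right continuity keeps a path that is strictly above \<open>a\<close> at time
  \<open>s\<close> there for a while, and monotonicity keeps it there before \<open>s\<close>, so
  the infimum exceeds \<open>s\<close>. An event about the hitting time becomes one about the path
  at a single time.\<close>

lemma less_hitting_time_iff:
  assumes \<omega>: "\<omega> \<in> space M" and s: "0 \<le> s"
  shows "ereal s < hitting_time a X \<omega> \<longleftrightarrow> a < X s \<omega>"
proof
  assume "ereal s < hitting_time a X \<omega>"
  moreover have "hitting_time a X \<omega> \<le> ereal s" if "X s \<omega> \<le> a"
    unfolding hitting_time_def using s that by (intro INF_lower) auto
  ultimately show "a < X s \<omega>" by force
next
  assume gt: "a < X s \<omega>"
  have "eventually (\<lambda>r. a < X r \<omega>) (at_right s)"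
    using X_right_continuous[OF \<omega> s] gt by (rule order_tendstoD)
  then obtain d where d: "d > s" "\<And>r. s < r \<Longrightarrow> r < d \<Longrightarrow> a < X r \<omega>"
    unfolding eventually_at_right_field by blast
  have "ereal d \<le> hitting_time a X \<omega>"
    unfolding hitting_time_def
  proof (rule INF_greatest)
    fix r assume "r \<in> {s. 0 \<le> s \<and> X s \<omega> \<le> a}"
    then have r: "0 \<le> r" "X r \<omega> \<le> a" by auto
    have "\<not> r \<le> s" using antimono[OF \<omega> r(1), of s] gt r by auto
    then show "ereal d \<le> ereal r" using d(2)[of r] r by (cases "r < d") auto
  qed
  then show "ereal s < hitting_time a X \<omega>" using d(1) by (metis ereal_less(2) less_ereal.simps(1) order_less_le_trans)
qed

lemma hitting_time_nonneg: "0 \<le> hitting_time a X \<omega>"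
  unfolding hitting_time_def by (intro INF_greatest) auto

text \<open>Measurability is wanted for the path sigma-algebra, not only for \<open>M\<close>, so
  that the hitting time is independent of the spatial process. It holds because hitting before or at
  \<open>s\<close> is the event \<open>X s \<omega> \<le> a\<close>.\<close>

lemma hitting_time_measurable: "hitting_time a X \<in> borel_measurable FX"
  unfolding borel_measurable_iff_Iic_ereal
proof
  fix c :: ereal
  show "hitting_time a X -` {..c} \<inter> space FX \<in> sets FX"
  proof (cases c)
    case (real s)
    show ?thesis
    proof (cases "0 \<le> s")
      case True
      have "hitting_time a X -` {..c} \<inter> space FX = {\<omega> \<in> space FX. X s \<omega> \<le> a}"
        using less_hitting_time_iff[OF _ True, of _ a] by (auto simp: real not_less[symmetric])
      also have "\<dots> \<in> sets FX" using X_measurable_FX[OF True] by measurable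
      finally show ?thesis .
    next
      case False
      then have "c < hitting_time a X \<omega>" for \<omega>
        using hitting_time_nonneg[of a \<omega>] by (simp add: real) (metis ereal_less(2) ereal_less_eq(5) leI order_less_le_trans)
      then have "hitting_time a X -` {..c} \<inter> space FX = {}" by (auto simp: not_le[symmetric])
      then show ?thesis by simp
    qed
  next
    case PInf
    then have "hitting_time a X -` {..c} \<inter> space FX = space FX" by auto
    then show ?thesis by (metis sets.top)
  next
    case MInf
    then have "hitting_time a X -` {..c} \<inter> space FX = {}"
      using hitting_time_nonneg[of a] by auto
    then show ?thesis by simp
  qed
qed

end

section \<open>The stochastic representation of the product semigroup\<close>

text \<open>Up to the factor K / c the integrand is the exponential density of rate
  \<open>c\<close>, which has total mass 1.\<close>

lemma set_integrable_exp_decay: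
  fixes c K :: real
  assumes "0 < c"
  shows "set_integrable lborel {0..} (\<lambda>s. K * exp (- c * s))"
proof -
  interpret prob_space "density lborel (exponential_density c)"
    by (rule prob_space_exponential_density[OF assms])
  have "integrable (density lborel (exponential_density c)) (\<lambda>_. 1 :: real)" by simp
  then have "integrable lborel (\<lambda>s. exponential_density c s *\<^sub>R (1 :: real))"
    using assms by (subst (asm) integrable_density) (auto simp: exponential_density_def)
  then have "integrable lborel (\<lambda>s. (K / c) * exponential_density c s)" by simp
  moreover have "(K / c) * exponential_density c s = indicator {0..} s *\<^sub>R (K * exp (- c * s))" for s
    using assms by (auto simp: exponential_density_def indicator_def mult.commute)
  ultimately show ?thesis unfolding set_integrable_def by simp
qed

text \<open>Domination by an integrable exponential allows the expectation and the integral over an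
  infinite time horizon to be exchanged. Values of \<open>F\<close> at negative times are arbitrary,
  hence \<open>max 0 s\<close> in the measurability premise.\<close>

lemma (in prob_space) time_Fubini:
  fixes F :: "real \<Rightarrow> 'a \<Rightarrow> real"
  assumes m: "(\<lambda>(s, \<omega>). F (max 0 s) \<omega>) \<in> borel_measurable (borel \<Otimes>\<^sub>M M)"
    and bd: "\<And>s \<omega>. 0 \<le> s \<Longrightarrow> \<omega> \<in> space M \<Longrightarrow> \<bar>F s \<omega>\<bar> \<le> B"
    and decay: "\<And>s. 0 \<le> s \<Longrightarrow> (\<integral>\<omega>. \<bar>F s \<omega>\<bar> \<partial>M) \<le> K * exp (- c * s)" and c: "0 < c"
  shows "set_integrable lborel {0..} (\<lambda>s. \<integral>\<omega>. F s \<omega> \<partial>M)"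
    and "(LINT s:{0..}|lborel. (\<integral>\<omega>. F s \<omega> \<partial>M)) = (\<integral>\<omega>. (LINT s:{0..}|lborel. F s \<omega>) \<partial>M)"
    and "integrable M (\<lambda>\<omega>. LINT s:{0..}|lborel. F s \<omega>)"
proof -
  interpret L: pair_sigma_finite lborel M ..
  define H where "H s \<omega> = indicator {0..} s * F (max 0 s) \<omega>" for s \<omega>
  have H0: "H s \<omega> = indicator {0..} s * F s \<omega>" for s \<omega>
    by (auto simp: H_def indicator_def)
  have Hm: "case_prod H \<in> borel_measurable (lborel \<Otimes>\<^sub>M M)"
  proof -
    have "(\<lambda>p. indicator {0..} (fst p) * (case p of (s, \<omega>) \<Rightarrow> F (max 0 s) \<omega>)) \<in> borel_measurable (borel \<Otimes>\<^sub>M M)"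
      by (intro borel_measurable_times m) measurable
    moreover have "case_prod H = (\<lambda>p. indicator {0..} (fst p) * (case p of (s, \<omega>) \<Rightarrow> F (max 0 s) \<omega>))"
      by (auto simp: H_def fun_eq_iff)
    ultimately show ?thesis by (simp cong: measurable_cong_sets)
  qed
  have Hsm: "H s \<in> borel_measurable M" for s using measurable_Pair2[OF Hm, of s] by simp
  have intH: "integrable M (H s)" for s
  proof (rule integrable_const_bound[where B="\<bar>B\<bar>", OF AE_I2 Hsm])
    fix \<omega> assume "\<omega> \<in> space M"
    then show "norm (H s \<omega>) \<le> \<bar>B\<bar>" using bd[of s \<omega>] by (cases "0 \<le> s") (auto simp: H0)
  qed
  have int: "integrable (lborel \<Otimes>\<^sub>M M) (case_prod H)"
  proof (rule L.Fubini_integrable[OF Hm])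
    show "integrable lborel (\<lambda>s. \<integral>\<omega>. norm (case (s, \<omega>) of (s, \<omega>) \<Rightarrow> H s \<omega>) \<partial>M)"
    proof (rule Bochner_Integration.integrable_bound)
      show "integrable lborel (\<lambda>s. indicator {0..} s *\<^sub>R (K * exp (- c * s)))"
        using set_integrable_exp_decay[OF c] unfolding set_integrable_def .
      show "(\<lambda>s. \<integral>\<omega>. norm (case (s, \<omega>) of (s, \<omega>) \<Rightarrow> H s \<omega>) \<partial>M) \<in> borel_measurable lborel"
        using Hm by (intro borel_measurable_lebesgue_integral) (simp add: case_prod_beta)
      show "AE s in lborel. norm (\<integral>\<omega>. norm (case (s, \<omega>) of (s, \<omega>) \<Rightarrow> H s \<omega>) \<partial>M) \<le> norm (indicator {0..} s *\<^sub>R (K * exp (- c * s)))"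
      proof (rule AE_I2)
        fix s :: real
        show "norm (\<integral>\<omega>. norm (case (s, \<omega>) of (s, \<omega>) \<Rightarrow> H s \<omega>) \<partial>M) \<le> norm (indicator {0..} s *\<^sub>R (K * exp (- c * s)))"
        proof (cases "0 \<le> s")
          case True
          have "0 \<le> (\<integral>\<omega>. \<bar>F s \<omega>\<bar> \<partial>M)" by (intro Bochner_Integration.integral_nonneg) simp
          then show ?thesis using decay[OF True] True by (simp add: H0)
        qed (simp add: H0)
      qed
    qed
    show "AE s in lborel. integrable M (\<lambda>\<omega>. case (s, \<omega>) of (s, \<omega>) \<Rightarrow> H s \<omega>)"
      using intH by simp
  qed
  have "integrable lborel (\<lambda>s. \<integral>\<omega>. H s \<omega> \<partial>M)"
    using L.integrable_fst'[OF int] by simp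
  then show "set_integrable lborel {0..} (\<lambda>s. \<integral>\<omega>. F s \<omega> \<partial>M)"
    unfolding set_integrable_def by (simp add: H0)
  show "(LINT s:{0..}|lborel. (\<integral>\<omega>. F s \<omega> \<partial>M)) = (\<integral>\<omega>. (LINT s:{0..}|lborel. F s \<omega>) \<partial>M)"
    using L.Fubini_integral[OF int] unfolding set_lebesgue_integral_def by (simp add: H0)
  show "integrable M (\<lambda>\<omega>. LINT s:{0..}|lborel. F s \<omega>)"
    using L.integrable_snd[OF int] unfolding set_lebesgue_integral_def by (simp add: H0)
qed

section \<open>The killed semigroup, the product semigroup and survival\<close>

locale caputo_problem =
  fixes a b :: real
    and \<nu> :: "real \<Rightarrow> real \<Rightarrow> real"
    and P T :: "real \<Rightarrow> (real \<Rightarrow> real) \<Rightarrow> (real \<Rightarrow> real)"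
    and S :: "real \<Rightarrow> ('a::euclidean_space \<Rightarrow> real) \<Rightarrow> ('a \<Rightarrow> real)"
    and domA :: "('a \<Rightarrow> real) set"
    and A :: "('a \<Rightarrow> real) \<Rightarrow> ('a \<Rightarrow> real)"
    and M :: "'w measure"
    and X :: "real \<Rightarrow> real \<Rightarrow> 'w \<Rightarrow> real"
    and Y :: "'a \<Rightarrow> real \<Rightarrow> 'w \<Rightarrow> 'a option"
  assumes ab: "a < b" and H0: "H0 \<nu>" and H1a: "H1a \<nu>"
    and gen_P: "generates_D_plus b \<nu> P"
    and gen_T: "generates_D_RL a b \<nu> T"
    and gen_S: "generates (C0 UNIV) domA A S"
    and X_process: "\<And>t. t \<in> {a..b} \<Longrightarrow> decreasing_feller_process M b P t (X t)"
    and Y_process: "\<And>x. feller_process M UNIV S x (Y x)"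
    and XY_indep: "\<And>t x. t \<in> {a..b} \<Longrightarrow> indep_processes M (\<lambda>s \<omega>. Some (X t s \<omega>)) (Y x)"
begin

sublocale prob_space M
  using Y_process by (simp add: feller_process_def)

lemma decreasing: "t \<in> {a..b} \<Longrightarrow> decreasing_process M b t P (X t)"
  using X_process by unfold_locales

abbreviation "FX t \<equiv> path_sigma M {0..} (\<lambda>s \<omega>. Some (X t s \<omega>))"
abbreviation "FY x \<equiv> path_sigma M {0..} (Y x)"
abbreviation "U \<equiv> product_semigroup T S"
abbreviation "alive z \<equiv> (indicator {a<..} z :: real)"

lemma Y_measurable: "0 \<le> s \<Longrightarrow> Y x s \<in> measurable M compactified_borel"
  using Y_process[of x] by (simp add: feller_process_def)

lemma FY_subalgebra: "subalgebra M (FY x)"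
  by (intro path_sigma_subalgebra Y_measurable) simp

lemma Y_measurable_FY: "0 \<le> s \<Longrightarrow> Y x s \<in> measurable (FY x) compactified_borel"
  by (rule path_sigma_measurable) simp

lemma S_semigroup: "pos_contraction_semigroup (C0 UNIV) S"
  using gen_S by (simp add: generates_def)

lemma T_semigroup: "pos_contraction_semigroup (Ca a b) T"
  using gen_T by (simp add: generates_D_RL_def generates_with_core_def)

sublocale S: contraction_semigroup "C0 UNIV" S
  by (rule contraction_semigroup_C0[OF S_semigroup])

sublocale T: contraction_semigroup "Ca a b" T
  by (rule contraction_semigroup_Ca[OF T_semigroup])

lemma S_expectation:
  assumes "f \<in> C0 UNIV" "0 \<le> s"
  shows "S s f x = (\<integral>\<omega>. ext0 f (Y x s \<omega>) \<partial>M)"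
  using feller_process_expectation[OF Y_process assms(1) C0_borel[OF assms(1)] assms(2)] by simp

text \<open>No killing is visible on the right-hand side: \<open>f\<close> vanishes up to
  \<open>a\<close>, and a non-increasing path that has reached this region never leaves it.\<close>

lemma T_expectation:
  assumes "f \<in> Ca a b" "0 \<le> s" "t \<in> {a..b}"
  shows "T s f t = (\<integral>\<omega>. f (X t s \<omega>) \<partial>M)"
proof -
  interpret Xt: decreasing_process M b t P "X t" by (rule decreasing[OF assms(3)])
  show ?thesis
    using RL_semigroup_eq[OF H0 gen_P gen_T ab assms(1,2)] Xt.X_expectation[OF _ assms(2), of f]
      Ca_subset_C0[of a b] assms(1) ab by auto
qed

lemma XY_indep_integral:
  fixes h :: "real \<Rightarrow> 'w \<Rightarrow> real"
  assumes "t \<in> {a..b}" "Z \<in> borel_measurable (FX t)" "(\<lambda>(z, \<omega>). h z \<omega>) \<in> borel_measurable (borel \<Otimes>\<^sub>M FY x)"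
    and "\<And>z \<omega>. \<bar>h z \<omega>\<bar> \<le> B"
  shows "(\<integral>\<omega>. h (Z \<omega>) \<omega> \<partial>M) = (\<integral>\<omega>'. (\<integral>\<omega>. h (Z \<omega>') \<omega> \<partial>M) \<partial>M)"
proof -
  interpret Xt: decreasing_process M b t P "X t" by (rule decreasing[OF assms(1)])
  show ?thesis
    using XY_indep[OF assms(1), of x] assms(2-4)
    by (intro indep_integral[OF Xt.FX_subalgebra FY_subalgebra]) (auto simp: indep_processes_def)
qed

lemma abs_ext0_le: "(\<And>y. \<bar>f y\<bar> \<le> B) \<Longrightarrow> 0 \<le> B \<Longrightarrow> \<bar>ext0 f z\<bar> \<le> B"
  by (simp add: ext0_eq)

lemma pair_integral:
  fixes g :: "real \<times> 'a \<Rightarrow> real"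
  assumes t: "t \<in> {a..b}" and s: "0 \<le> s" "0 \<le> r" and g: "g \<in> borel_measurable borel" "\<And>p. \<bar>g p\<bar> \<le> B"
  shows "(\<integral>\<omega>. ext0 (\<lambda>y. g (X t r \<omega>, y)) (Y x s \<omega>) \<partial>M) =
    (\<integral>\<omega>'. (\<integral>\<omega>. ext0 (\<lambda>y. g (X t r \<omega>', y)) (Y x s \<omega>) \<partial>M) \<partial>M)"
proof -
  interpret Xt: decreasing_process M b t P "X t" by (rule decreasing[OF t])
  have B: "0 \<le> B" using g(2)[of undefined] by linarith
  have "(\<lambda>p. ext0 (\<lambda>y. g (fst p, y)) (Y x s (snd p))) \<in> borel_measurable (borel \<Otimes>\<^sub>M FY x)"
    by (intro measurable_ext0_pair g measurable_fst measurable_compose[OF measurable_snd Y_measurable_FY] s)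
  then show ?thesis
    using B by (intro XY_indep_integral[where x=x, OF t Xt.X_measurable_FX[OF s(2)], where B=B] abs_ext0_le g(2)) (auto simp: case_prod_beta)
qed

text \<open>Both sides are iterated integrals over two copies of \<open>M\<close>, one sample point
  for the time process and one for the spatial process, so Fubini on the product measure exchanges
  them.\<close>

lemma time_space_commute:
  assumes u: "u \<in> Ca0 a b" and r: "0 \<le> r" and s: "0 \<le> s"
  shows "T r (\<lambda>t'. S s (\<lambda>x'. u (t', x')) x) t = S s (\<lambda>x'. T r (\<lambda>t'. u (t', x')) t) x"
proof (cases "t \<in> {a..b}")
  case True
  interpret Xt: decreasing_process M b t P "X t" by (rule decreasing[OF True])
  interpret MM: pair_prob_space M M ..
  note um = Ca0_borel[OF u]
  obtain B where B: "\<And>p. \<bar>u p\<bar> \<le> B" using Ca0_bounded[OF u] by (auto simp: bounded_iff)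
  have B0: "0 \<le> B" using B[of undefined] by linarith
  have k: "(\<lambda>t'. S s (\<lambda>x'. u (t', x')) x) \<in> Ca a b"
    using Ca0_time_slice[OF space_lift_in_Ca0[OF S_semigroup u s]] by simp
  have l: "(\<lambda>x'. T r (\<lambda>t'. u (t', x')) t) \<in> C0 UNIV"
    using Ca0_space_slice[OF time_lift_in_Ca0[OF T_semigroup u r]] by simp
  have int: "integrable (M \<Otimes>\<^sub>M M) (\<lambda>(\<omega>', \<omega>). ext0 (\<lambda>y. u (X t r \<omega>', y)) (Y x s \<omega>))"
  proof (rule MM.integrable_const_bound[where B=B])
    have "(\<lambda>p. ext0 (\<lambda>y. u (X t r (fst p), y)) (Y x s (snd p))) \<in> borel_measurable (M \<Otimes>\<^sub>M M)"
      by (intro measurable_ext0_pair um measurable_compose[OF measurable_fst Xt.X_measurable]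
          measurable_compose[OF measurable_snd Y_measurable] r s)
    then show "(\<lambda>(\<omega>', \<omega>). ext0 (\<lambda>y. u (X t r \<omega>', y)) (Y x s \<omega>)) \<in> borel_measurable (M \<Otimes>\<^sub>M M)"
      by (simp add: case_prod_beta)
  qed (use B B0 in \<open>auto simp: ext0_eq\<close>)
  have "T r (\<lambda>t'. S s (\<lambda>x'. u (t', x')) x) t = (\<integral>\<omega>'. (\<integral>\<omega>. ext0 (\<lambda>y. u (X t r \<omega>', y)) (Y x s \<omega>) \<partial>M) \<partial>M)"
    by (subst T_expectation[OF k r True]) (simp only: S_expectation[OF Ca0_space_slice[OF u] s])
  also have "\<dots> = (\<integral>\<omega>. (\<integral>\<omega>'. ext0 (\<lambda>y. u (X t r \<omega>', y)) (Y x s \<omega>) \<partial>M) \<partial>M)"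
    using MM.Fubini_integral[OF int] by simp
  also have "\<dots> = (\<integral>\<omega>. ext0 (\<lambda>y. \<integral>\<omega>'. u (X t r \<omega>', y) \<partial>M) (Y x s \<omega>) \<partial>M)"
    by (intro Bochner_Integration.integral_cong) (auto simp: ext0_eq)
  also have "\<dots> = S s (\<lambda>x'. T r (\<lambda>t'. u (t', x')) t) x"
    by (subst S_expectation[OF l s]) (simp only: T_expectation[OF Ca0_time_slice[OF u] r True])
  finally show ?thesis .
next
  case False
  have k: "(\<lambda>t'. S s (\<lambda>x'. u (t', x')) x) \<in> Ca a b"
    using Ca0_time_slice[OF space_lift_in_Ca0[OF S_semigroup u s]] by simp
  have "T r (\<lambda>t'. u (t', x')) t = 0" for x'
    using T.T_in[OF r Ca0_time_slice[OF u]] False by (auto simp: Ca_iff)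
  moreover have "S s (\<lambda>_. 0) x = 0" using S.T_le[OF s C0_0, of 0 x] by simp
  ultimately show ?thesis using T.T_in[OF r k] False by (auto simp: Ca_iff)
qed

lemma U_semigroup: "pos_contraction_semigroup (Ca0 a b) U"
  by (rule pos_contraction_semigroup_product[OF T_semigroup S_semigroup time_space_commute])

sublocale U: contraction_semigroup "Ca0 a b" U
  by (rule contraction_semigroup_Ca0[OF U_semigroup])

text \<open>Applying the two semigroups in turn averages over separate sample points; independence
  merges them into one.\<close>

lemma U_expectation:
  assumes u: "u \<in> Ca0 a b" and s: "0 \<le> s" and t: "t \<in> {a..b}"
  shows "U s u (t, x) = (\<integral>\<omega>. ext0 (\<lambda>y. u (X t s \<omega>, y)) (Y x s \<omega>) \<partial>M)"
proof -
  obtain B where B: "\<And>p. \<bar>u p\<bar> \<le> B" using Ca0_bounded[OF u] by (auto simp: bounded_iff)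
  have k: "(\<lambda>t'. S s (\<lambda>x'. u (t', x')) x) \<in> Ca a b"
    using Ca0_time_slice[OF space_lift_in_Ca0[OF S_semigroup u s]] by simp
  have "U s u (t, x) = (\<integral>\<omega>'. (\<integral>\<omega>. ext0 (\<lambda>y. u (X t s \<omega>', y)) (Y x s \<omega>) \<partial>M) \<partial>M)"
    unfolding product_semigroup_def prod.case
    by (subst T_expectation[OF k s t]) (simp only: S_expectation[OF Ca0_space_slice[OF u] s])
  then show ?thesis using pair_integral[OF t s s Ca0_borel[OF u] B] by simp
qed

lemma U_outside:
  assumes "u \<in> Ca0 a b" "0 \<le> s" "t \<notin> {a..b}"
  shows "U s u (t, x) = 0"
  using U.T_in[OF assms(2,1)] assms(3) unfolding Ca0_iff by blast

text \<open>Neither the rate \<open>c\<close> nor the bound exp b on the barriers depends on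
  \<open>n\<close>, so letting \<open>n\<close> grow replaces the cut-off by the indicator of the
  event that the path is above \<open>a\<close>.\<close>

lemma survival_decay_exists:
  obtains c where "0 < c"
    "\<And>t s. t \<in> {a..b} \<Longrightarrow> 0 \<le> s \<Longrightarrow> (\<integral>\<omega>. alive (X t s \<omega>) \<partial>M) \<le> exp (b - a) * exp (- c * s)"
proof -
  obtain c where c: "c > 0" "\<And>n s t. 0 \<le> s \<Longrightarrow> T s (barrier a b n) t \<le> exp (- c * s) * barrier a b n t"
    using barrier_decay[OF H0 H1a gen_T] ab by (metis less_imp_le)
  have "(\<integral>\<omega>. alive (X t s \<omega>) \<partial>M) \<le> exp (b - a) * exp (- c * s)" if t: "t \<in> {a..b}" and s: "0 \<le> s" for t s
  proof -
    interpret Xt: decreasing_process M b t P "X t" by (rule decreasing[OF t])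
    have bar_le: "barrier a b n z \<le> exp b" for n z
    proof (cases "z \<in> {a..b}")
      case True
      then have "exp z * (1 - exp (- real n * (z - a))) \<le> exp b * 1"
        by (intro mult_mono) auto
      then show ?thesis using True by (simp add: barrier_def)
    qed (auto simp: barrier_def)
    have bC: "barrier a b n \<in> Ca a b" for n using barrier_core by blast
    have bm: "barrier a b n \<in> borel_measurable borel" for n
      using C0_borel[of "barrier a b n" "{a..b}"] bC by (auto simp: Ca_def)
    have lim: "(\<lambda>n. \<integral>\<omega>. barrier a b n (X t s \<omega>) \<partial>M) \<longlonglongrightarrow> (\<integral>\<omega>. exp (X t s \<omega>) * alive (X t s \<omega>) \<partial>M)"
    proof (rule integral_dominated_convergence[where w="\<lambda>_. exp b"])
      show "(\<lambda>\<omega>. exp (X t s \<omega>) * alive (X t s \<omega>)) \<in> borel_measurable M"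
        using Xt.X_measurable[OF s] by measurable
      show "(\<lambda>\<omega>. barrier a b n (X t s \<omega>)) \<in> borel_measurable M" for n
        using measurable_compose[OF Xt.X_measurable[OF s] bm] .
      show "AE \<omega> in M. (\<lambda>n. barrier a b n (X t s \<omega>)) \<longlonglongrightarrow> exp (X t s \<omega>) * alive (X t s \<omega>)"
      proof (rule AE_I2)
        fix \<omega> assume \<omega>: "\<omega> \<in> space M"
        let ?z = "X t s \<omega>"
        show "(\<lambda>n. barrier a b n ?z) \<longlonglongrightarrow> exp ?z * alive ?z"
        proof (cases "a < ?z")
          case True
          have "(\<lambda>n. exp ?z * (1 - exp (- (?z - a)) ^ n)) \<longlonglongrightarrow> exp ?z * (1 - 0)"
            using True by (intro tendsto_intros LIMSEQ_power_zero) auto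
          moreover have "barrier a b n ?z = exp ?z * (1 - exp (- (?z - a)) ^ n)" for n
            using True Xt.le_b[OF \<omega> s] by (simp add: barrier_def exp_of_nat_mult[symmetric] algebra_simps)
          ultimately show ?thesis using True by simp
        next
          case False
          then show ?thesis using Ca_le[OF bC] by simp
        qed
      qed
      show "AE \<omega> in M. norm (barrier a b n (X t s \<omega>)) \<le> exp b" for n
        using bar_le barrier_nonneg by simp
    qed simp
    have "(\<integral>\<omega>. barrier a b n (X t s \<omega>) \<partial>M) \<le> exp (- c * s) * exp b" for n
    proof -
      have "(\<integral>\<omega>. barrier a b n (X t s \<omega>) \<partial>M) = T s (barrier a b n) t"
        using T_expectation[OF bC s t] by simp
      also have "\<dots> \<le> exp (- c * s) * barrier a b n t" by (rule c(2)[OF s])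
      also have "\<dots> \<le> exp (- c * s) * exp b" using bar_le by (intro mult_left_mono) auto
      finally show ?thesis .
    qed
    then have E: "(\<integral>\<omega>. exp (X t s \<omega>) * alive (X t s \<omega>) \<partial>M) \<le> exp (- c * s) * exp b"
      by (intro LIMSEQ_le_const2[OF lim]) auto
    \<comment> \<open>On that event the exponential of the path is at least exp a; dividing exp b by
      it gives the constant exp (b - a).\<close>
    have "exp a * (\<integral>\<omega>. alive (X t s \<omega>) \<partial>M) = (\<integral>\<omega>. exp a * alive (X t s \<omega>) \<partial>M)" by simp
    also have "\<dots> \<le> (\<integral>\<omega>. exp (X t s \<omega>) * alive (X t s \<omega>) \<partial>M)"
    proof (rule integral_mono)
      show "integrable M (\<lambda>\<omega>. exp a * alive (X t s \<omega>))"
        using Xt.X_measurable[OF s] by (intro integrable_const_bound[where B="exp a"]) (auto simp: indicator_def)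
      show "integrable M (\<lambda>\<omega>. exp (X t s \<omega>) * alive (X t s \<omega>))"
        using Xt.X_measurable[OF s] Xt.le_b[OF _ s]
        by (intro integrable_const_bound[where B="exp b"]) (auto simp: indicator_def)
    qed (auto simp: indicator_def)
    also note E
    finally have "exp a * (\<integral>\<omega>. alive (X t s \<omega>) \<partial>M) \<le> exp (- c * s) * exp b" .
    then show ?thesis by (simp add: exp_diff field_simps)
  qed
  then show ?thesis using that c(1) by blast
qed

definition decay_rate :: real where
  "decay_rate = (SOME c. 0 < c \<and>
    (\<forall>t\<in>{a..b}. \<forall>s\<ge>0. (\<integral>\<omega>. alive (X t s \<omega>) \<partial>M) \<le> exp (b - a) * exp (- c * s)))"

lemma decay_rate_pos: "0 < decay_rate"
  and survival_decay: "t \<in> {a..b} \<Longrightarrow> 0 \<le> s \<Longrightarrow>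
    (\<integral>\<omega>. alive (X t s \<omega>) \<partial>M) \<le> exp (b - a) * exp (- decay_rate * s)"
proof -
  have "\<exists>c>0. \<forall>t\<in>{a..b}. \<forall>s\<ge>0. (\<integral>\<omega>. alive (X t s \<omega>) \<partial>M) \<le> exp (b - a) * exp (- c * s)"
    using survival_decay_exists by metis
  from someI_ex[OF this, folded decay_rate_def]
  show "0 < decay_rate" "t \<in> {a..b} \<Longrightarrow> 0 \<le> s \<Longrightarrow>
    (\<integral>\<omega>. alive (X t s \<omega>) \<partial>M) \<le> exp (b - a) * exp (- decay_rate * s)"
    by auto
qed

end

section \<open>The Riemann--Liouville problem\<close>

context caputo_problem
begin

text \<open>The factor \<open>alive\<close> matters at the level \<open>a\<close> itself: a source
  of the Caputo problem need not vanish there, while a path sitting at \<open>a\<close> has already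
  been stopped.\<close>

definition killed :: "(real \<times> 'a \<Rightarrow> real) \<Rightarrow> real \<Rightarrow> 'a \<Rightarrow> real \<Rightarrow> 'w \<Rightarrow> real" where
  "killed g t x s \<omega> = alive (X t s \<omega>) * ext0 (\<lambda>y. g (X t s \<omega>, y)) (Y x s \<omega>)"

text \<open>The Green operator of the killed pair process. The expectation stands inside the time
  integral, so that for sources in \<open>Ca0 a b\<close> it is the integral of the orbit of
  \<open>U\<close>; it also makes sense for bounded Borel sources.\<close>

definition potential :: "(real \<times> 'a \<Rightarrow> real) \<Rightarrow> real \<Rightarrow> 'a \<Rightarrow> real" where
  "potential g t x = (LINT s:{0..}|lborel. (\<integral>\<omega>. killed g t x s \<omega> \<partial>M))"

lemma killed_le:
  assumes "\<And>p. \<bar>g p\<bar> \<le> B"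
  shows "\<bar>killed g t x s \<omega>\<bar> \<le> B * alive (X t s \<omega>)"
proof -
  have "0 \<le> B" using assms[of undefined] by linarith
  then show ?thesis using assms by (auto simp: killed_def ext0_eq indicator_def)
qed

lemma killed_measurable:
  assumes t: "t \<in> {a..b}" and s: "0 \<le> s" and g: "g \<in> borel_measurable borel"
  shows "killed g t x s \<in> borel_measurable M"
proof -
  interpret Xt: decreasing_process M b t P "X t" by (rule decreasing[OF t])
  note [measurable] = Xt.X_measurable[OF s] measurable_ext0_pair[OF g Xt.X_measurable[OF s] Y_measurable[OF s]]
  show ?thesis unfolding killed_def[abs_def] by measurable
qed

lemma killed_integrable:
  assumes t: "t \<in> {a..b}" and s: "0 \<le> s" and g: "g \<in> borel_measurable borel" "\<And>p. \<bar>g p\<bar> \<le> B"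
  shows "integrable M (killed g t x s)"
proof (rule integrable_const_bound[where B=B, OF AE_I2 killed_measurable[OF t s g(1)]])
  fix \<omega>
  have "B * alive (X t s \<omega>) \<le> B" using g(2)[of undefined] by (auto simp: indicator_def)
  then show "norm (killed g t x s \<omega>) \<le> B" using killed_le[of g B t x s \<omega>, OF g(2)] by simp
qed

lemma killed_decay:
  assumes t: "t \<in> {a..b}" and s: "0 \<le> s" and g: "g \<in> borel_measurable borel" "\<And>p. \<bar>g p\<bar> \<le> B"
  shows "(\<integral>\<omega>. \<bar>killed g t x s \<omega>\<bar> \<partial>M) \<le> (B * exp (b - a)) * exp (- decay_rate * s)"
proof -
  interpret Xt: decreasing_process M b t P "X t" by (rule decreasing[OF t])
  have B: "0 \<le> B" using g(2)[of undefined] by linarith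
  have "(\<integral>\<omega>. \<bar>killed g t x s \<omega>\<bar> \<partial>M) \<le> (\<integral>\<omega>. B * alive (X t s \<omega>) \<partial>M)"
  proof (rule integral_mono)
    show "integrable M (\<lambda>\<omega>. B * alive (X t s \<omega>))"
      using Xt.X_measurable[OF s] B by (intro integrable_const_bound[where B=B]) (auto simp: indicator_def)
  qed (use killed_integrable[OF t s g] killed_le[OF g(2)] in auto)
  also have "\<dots> \<le> B * (exp (b - a) * exp (- decay_rate * s))"
    using survival_decay[OF t s] B by (simp add: mult_left_mono)
  finally show ?thesis by (simp add: mult.assoc)
qed

lemma killed_jointly_measurable:
  assumes t: "t \<in> {a..b}" and g: "g \<in> borel_measurable borel"
  shows "(\<lambda>(s, \<omega>). killed g t x (max 0 s) \<omega>) \<in> borel_measurable (borel \<Otimes>\<^sub>M M)"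
proof -
  interpret Xt: decreasing_process M b t P "X t" by (rule decreasing[OF t])
  have X: "(\<lambda>p. X t (max 0 (fst p)) (snd p)) \<in> borel_measurable (borel \<Otimes>\<^sub>M M)"
    using Xt.X_jointly_measurable by (simp add: case_prod_beta)
  have Y: "(\<lambda>p. Y x (max 0 (fst p)) (snd p)) \<in> measurable (borel \<Otimes>\<^sub>M M) compactified_borel"
    using feller_jointly_measurable[OF Y_process refl Y_measurable, of x] by (simp add: case_prod_beta)
  note [measurable] = X measurable_ext0_pair[OF g X Y]
  have "(\<lambda>p. killed g t x (max 0 (fst p)) (snd p)) \<in> borel_measurable (borel \<Otimes>\<^sub>M M)"
    unfolding killed_def by measurable
  then show ?thesis by (simp add: case_prod_beta)
qed

lemma killed_Fubini:
  assumes t: "t \<in> {a..b}" and g: "g \<in> borel_measurable borel" "\<And>p. \<bar>g p\<bar> \<le> B"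
  shows "set_integrable lborel {0..} (\<lambda>s. \<integral>\<omega>. killed g t x s \<omega> \<partial>M)"
    and "potential g t x = (\<integral>\<omega>. (LINT s:{0..}|lborel. killed g t x s \<omega>) \<partial>M)"
proof -
  have bd: "\<bar>killed g t x s \<omega>\<bar> \<le> B" for s \<omega>
  proof -
    have "B * alive (X t s \<omega>) \<le> B" using g(2)[of undefined] by (auto simp: indicator_def)
    then show ?thesis using killed_le[of g B t x s \<omega>, OF g(2)] by linarith
  qed
  note * = time_Fubini[OF killed_jointly_measurable[OF t g(1)] bd killed_decay[OF t _ g] decay_rate_pos]
  show "set_integrable lborel {0..} (\<lambda>s. \<integral>\<omega>. killed g t x s \<omega> \<partial>M)" by (rule *(1))
  show "potential g t x = (\<integral>\<omega>. (LINT s:{0..}|lborel. killed g t x s \<omega>) \<partial>M)"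
    unfolding potential_def by (rule *(2))
qed

lemma potential_eq_stochastic:
  assumes t: "t \<in> {a..b}" and g: "g \<in> borel_measurable borel" "\<And>p. \<bar>g p\<bar> \<le> B"
  shows "potential g t x = (\<integral>\<omega>. (LINT s:{s. 0 \<le> s \<and> ereal s < hitting_time a (X t) \<omega>}|lborel.
    ext0 (\<lambda>y. g (X t s \<omega>, y)) (Y x s \<omega>)) \<partial>M)"
  unfolding killed_Fubini(2)[OF t g]
proof (rule Bochner_Integration.integral_cong)
  interpret Xt: decreasing_process M b t P "X t" by (rule decreasing[OF t])
  fix \<omega> assume \<omega>: "\<omega> \<in> space M"
  show "(LINT s:{0..}|lborel. killed g t x s \<omega>) =
    (LINT s:{s. 0 \<le> s \<and> ereal s < hitting_time a (X t) \<omega>}|lborel. ext0 (\<lambda>y. g (X t s \<omega>, y)) (Y x s \<omega>))"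
    unfolding set_lebesgue_integral_def killed_def
    using Xt.less_hitting_time_iff[OF \<omega>, of _ a]
    by (intro Bochner_Integration.integral_cong) (auto simp: indicator_def)
qed simp

lemma potential_add:
  assumes t: "t \<in> {a..b}" and g: "g \<in> borel_measurable borel" "\<And>p. \<bar>g p\<bar> \<le> B"
    and h: "h \<in> borel_measurable borel" "\<And>p. \<bar>h p\<bar> \<le> C"
  shows "potential (\<lambda>p. g p + h p) t x = potential g t x + potential h t x"
proof -
  have "killed (\<lambda>p. g p + h p) t x s = (\<lambda>\<omega>. killed g t x s \<omega> + killed h t x s \<omega>)" for s
    by (simp add: killed_def ext0_eq algebra_simps fun_eq_iff)
  then have k: "(\<integral>\<omega>. killed (\<lambda>p. g p + h p) t x s \<omega> \<partial>M) = (\<integral>\<omega>. killed g t x s \<omega> \<partial>M) + (\<integral>\<omega>. killed h t x s \<omega> \<partial>M)"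
    if "0 \<le> s" for s
    using Bochner_Integration.integral_add[OF killed_integrable[OF t that g] killed_integrable[OF t that h], of x x] by simp
  have "potential (\<lambda>p. g p + h p) t x = (LINT s:{0..}|lborel. (\<integral>\<omega>. killed g t x s \<omega> \<partial>M) + (\<integral>\<omega>. killed h t x s \<omega> \<partial>M))"
    unfolding potential_def
    by (intro set_lebesgue_integral_cong) (auto simp: k)
  also have "\<dots> = potential g t x + potential h t x"
    unfolding potential_def by (intro set_integral_add killed_Fubini(1)[OF t g] killed_Fubini(1)[OF t h])
  finally show ?thesis .
qed

lemma U_killed:
  assumes u: "u \<in> Ca0 a b" and s: "0 \<le> s" and t: "t \<in> {a..b}"
  shows "U s u (t, x) = (\<integral>\<omega>. killed u t x s \<omega> \<partial>M)"
proof -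
  have "alive z * ext0 (\<lambda>y. u (z, y)) w = ext0 (\<lambda>y. u (z, y)) w" for z w
    using Ca_le[OF Ca0_time_slice[OF u], of z] by (auto simp: indicator_def ext0_eq)
  then show ?thesis unfolding U_expectation[OF assms] killed_def by (simp only:)
qed

text \<open>The spatial process contributes only the bound \<open>B\<close>; the decay is that of
  the probability that the time process is still above \<open>a\<close>.\<close>

lemma U_decay:
  assumes g: "g \<in> Ca0 a b" and s: "0 \<le> s" and B: "\<And>p. \<bar>g p\<bar> \<le> B"
  shows "\<bar>U s g p\<bar> \<le> (B * exp (b - a)) * exp (- decay_rate * s)"
proof -
  obtain t x where p: "p = (t, x)" by force
  have B0: "0 \<le> B" using B[of undefined] by linarith
  show ?thesis
  proof (cases "t \<in> {a..b}")
    case True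
    have "\<bar>U s g p\<bar> \<le> (\<integral>\<omega>. \<bar>killed g t x s \<omega>\<bar> \<partial>M)"
      unfolding p U_killed[OF g s True] by (rule integral_abs_bound)
    also note killed_decay[OF True s Ca0_borel[OF g] B]
    finally show ?thesis .
  next
    case False
    then show ?thesis using U_outside[OF g s] B0 by (simp add: p)
  qed
qed

section \<open>The time integral of the orbit as inverse of the product generator\<close>

definition RL_sol :: "(real \<times> 'a \<Rightarrow> real) \<Rightarrow> real \<times> 'a \<Rightarrow> real" where
  "RL_sol g p = (LINT s:{0..}|lborel. U s g p)"

lemma U_orbit_integrable:
  assumes g: "g \<in> Ca0 a b"
  shows "set_integrable lborel {0..} (\<lambda>s. U s g p)"
proof -
  obtain B where B: "\<And>p. \<bar>g p\<bar> \<le> B" using Ca0_bounded[OF g] by (auto simp: bounded_iff)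
  have "set_borel_measurable lborel {0..} (\<lambda>s. U s g p)"
    using borel_measurable_continuous_on_indicator[of "{0..}" "\<lambda>s. U s g p"] U.orbit_continuous[OF g]
    unfolding set_borel_measurable_def by simp
  moreover have "AE s in lborel. s \<in> {0..} \<longrightarrow> norm (U s g p) \<le> norm ((B * exp (b - a)) * exp (- decay_rate * s))"
    by (intro AE_I2 impI) (simp only: real_norm_def atLeast_iff order_trans[OF U_decay[OF g _ B] abs_ge_self])
  ultimately show ?thesis using set_integrable_exp_decay[OF decay_rate_pos] by (rule set_integrable_bound[rotated])
qed

lemma RL_sol_potential:
  assumes "g \<in> Ca0 a b" "t \<in> {a..b}"
  shows "RL_sol g (t, x) = potential g t x"
  unfolding RL_sol_def potential_def
  by (intro set_lebesgue_integral_cong) (auto simp: U_killed[OF assms(1) _ assms(2)])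

lemma RL_sol_outside:
  assumes "g \<in> Ca0 a b" "t \<notin> {a..b}"
  shows "RL_sol g (t, x) = 0"
proof -
  have "RL_sol g (t, x) = (LINT s:{0::real..}|lborel. 0)"
    unfolding RL_sol_def by (intro set_lebesgue_integral_cong) (auto simp: U_outside[OF assms(1) _ assms(2)])
  then show ?thesis by (simp add: set_lebesgue_integral_def)
qed

text \<open>Dominated convergence with the bound of \<open>U_decay\<close>. Being stated for
  arbitrary sequences of points, it yields both joint continuity and decay at infinity of
  \<open>RL_sol\<close>.\<close>

lemma RL_sol_limit:
  assumes g: "g \<in> Ca0 a b" and lim: "\<And>s. 0 \<le> s \<Longrightarrow> (\<lambda>n. U s g (p n)) \<longlonglongrightarrow> f s"
  shows "(\<lambda>n. RL_sol g (p n)) \<longlonglongrightarrow> (LINT s:{0..}|lborel. f s)"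
proof -
  obtain B where B: "\<And>p. \<bar>g p\<bar> \<le> B" using Ca0_bounded[OF g] by (auto simp: bounded_iff)
  have m: "(\<lambda>s. indicator {0..} s *\<^sub>R U s g (p n)) \<in> borel_measurable lborel" for n
    using U_orbit_integrable[OF g] unfolding set_integrable_def by (rule borel_measurable_integrable)
  have l: "(\<lambda>n. indicator {0..} s *\<^sub>R U s g (p n)) \<longlonglongrightarrow> indicator {0..} s *\<^sub>R f s" for s
    using lim[of s] by (auto simp: indicator_def)
  show ?thesis
    unfolding RL_sol_def set_lebesgue_integral_def
  proof (rule integral_dominated_convergence[where w="\<lambda>s. indicator {0..} s *\<^sub>R ((B * exp (b - a)) * exp (- decay_rate * s))"])
    show "(\<lambda>s. indicator {0..} s *\<^sub>R f s) \<in> borel_measurable lborel"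
      by (rule borel_measurable_LIMSEQ_real[OF l m])
    show "integrable lborel (\<lambda>s. indicator {0..} s *\<^sub>R ((B * exp (b - a)) * exp (- decay_rate * s)))"
      using set_integrable_exp_decay[OF decay_rate_pos] unfolding set_integrable_def .
    show "AE s in lborel. norm (indicator {0..} s *\<^sub>R U s g (p n)) \<le> indicator {0..} s *\<^sub>R ((B * exp (b - a)) * exp (- decay_rate * s))" for n
      using U_decay[OF g _ B] by (intro AE_I2) (auto simp: indicator_def)
  qed (use l m in auto)
qed

lemma RL_sol_in_Ca0:
  assumes g: "g \<in> Ca0 a b"
  shows "RL_sol g \<in> Ca0 a b"
  unfolding Ca0_iff
proof (intro conjI allI impI)
  note Ug = U.T_in[OF _ g]
  show "continuous_on ({a..b} \<times> UNIV) (RL_sol g)"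
  proof (rule continuous_on_sequentiallyI)
    fix p :: "nat \<Rightarrow> real \<times> 'a" and q assume p: "\<forall>n. p n \<in> {a..b} \<times> UNIV" "q \<in> {a..b} \<times> UNIV" "p \<longlonglongrightarrow> q"
    have "(\<lambda>n. U s g (p n)) \<longlonglongrightarrow> U s g q" if "0 \<le> s" for s
    proof -
      have "continuous_on ({a..b} \<times> UNIV) (U s g)" using Ug[OF that] unfolding Ca0_iff by blast
      then show ?thesis using p by (auto simp: continuous_on_sequentially comp_def)
    qed
    from RL_sol_limit[OF g this] show "(\<lambda>n. RL_sol g (p n)) \<longlonglongrightarrow> RL_sol g q" by (simp add: RL_sol_def)
  qed
  show "RL_sol g (t, x) = 0" if "t \<notin> {a..b}" for t x by (rule RL_sol_outside[OF g that])
  show "RL_sol g (a, x) = 0" for x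
  proof -
    have "RL_sol g (a, x) = (LINT s:{0::real..}|lborel. 0)"
      unfolding RL_sol_def using Ug by (intro set_lebesgue_integral_cong) (auto simp: Ca0_iff)
    then show ?thesis by (simp add: set_lebesgue_integral_def)
  qed
  fix e :: real assume "e > 0"
  \<comment> \<open>A failing tail bound would give points with \<open>x\<close> tending to infinity
    along which the absolute value of \<open>RL_sol g\<close> stays at least \<open>e\<close>,
    against the limit 0 along this sequence.\<close>
  show "\<exists>R. \<forall>t x. R < norm x \<longrightarrow> \<bar>RL_sol g (t, x)\<bar> < e"
  proof (rule ccontr)
    assume "\<not> ?thesis"
    then have "\<forall>n::nat. \<exists>p. real n < norm (snd p) \<and> e \<le> \<bar>RL_sol g p\<bar>" by (auto simp: not_less)
    then obtain p where p: "\<And>n::nat. real n < norm (snd (p n))" "\<And>n. e \<le> \<bar>RL_sol g (p n)\<bar>" by metis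
    have "(\<lambda>n. U s g (p n)) \<longlonglongrightarrow> 0" if s: "0 \<le> s" for s
    proof (rule LIMSEQ_I)
      fix d :: real assume "d > 0"
      then obtain R where R: "\<And>t x. R < norm x \<Longrightarrow> \<bar>U s g (t, x)\<bar> < d" using Ug[OF s] unfolding Ca0_iff by meson
      obtain N where N: "R \<le> real N" using real_arch_simple by blast
      have "norm (U s g (p n) - 0) < d" if "n \<ge> N" for n
      proof -
        have "R < norm (snd (p n))" using p(1)[of n] N that by linarith
        then show ?thesis using R[of "snd (p n)" "fst (p n)"] by simp
      qed
      then show "\<exists>N. \<forall>n\<ge>N. norm (U s g (p n) - 0) < d" by blast
    qed
    from RL_sol_limit[OF g this] have "(\<lambda>n. RL_sol g (p n)) \<longlonglongrightarrow> 0" by (simp add: set_lebesgue_integral_def)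
    from LIMSEQ_D[OF this \<open>e > 0\<close>] obtain n where "\<bar>RL_sol g (p n)\<bar> < e" by auto
    then show False using p(2)[of n] by simp
  qed
qed

text \<open>\<open>U h\<close> is an expectation over the pair process at time \<open>h\<close>, so
  moving it under the time integral is Fubini; the semigroup law then merges \<open>h\<close> and
  \<open>s\<close>.\<close>

lemma U_RL_sol:
  assumes g: "g \<in> Ca0 a b" and h: "0 \<le> h"
  shows "U h (RL_sol g) p = (LINT s:{0..}|lborel. U (h + s) g p)"
proof -
  obtain t x where p: "p = (t, x)" by force
  obtain B where B: "\<And>p. \<bar>g p\<bar> \<le> B" using Ca0_bounded[OF g] by (auto simp: bounded_iff)
  have B0: "0 \<le> B" using B[of undefined] by linarith
  show ?thesis
  proof (cases "t \<in> {a..b}")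
    case True
    interpret Xt: decreasing_process M b t P "X t" by (rule decreasing[OF True])
    define F where "F s \<omega> = ext0 (\<lambda>y. U s g (X t h \<omega>, y)) (Y x h \<omega>)" for s \<omega>
    have Fm: "F s \<in> borel_measurable M" if "0 \<le> s" for s
      unfolding F_def by (intro measurable_ext0_pair Ca0_borel[OF U.T_in[OF that g]] Xt.X_measurable Y_measurable h)
    \<comment> \<open>The position at time \<open>h\<close> is held fixed, so only continuity of the
      orbit of \<open>g\<close> in \<open>s\<close> enters; joint measurability follows from
      it.\<close>
    have Frc: "((\<lambda>r. F r \<omega>) \<longlongrightarrow> F s \<omega>) (at_right s)" if "0 \<le> s" for s \<omega>
    proof (cases "Y x h \<omega>")
      case (Some y)
      have "((\<lambda>r. U r g (X t h \<omega>, y)) \<longlongrightarrow> U s g (X t h \<omega>, y)) (at s within {0..})"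
        using U.orbit_continuous[OF g] that by (auto simp: continuous_on_def)
      then have "((\<lambda>r. U r g (X t h \<omega>, y)) \<longlongrightarrow> U s g (X t h \<omega>, y)) (at_right s)"
        by (rule tendsto_within_subset) (use that in auto)
      then show ?thesis by (simp add: F_def Some)
    qed (simp add: F_def)
    have Fle: "\<bar>F s \<omega>\<bar> \<le> (B * exp (b - a)) * exp (- decay_rate * s)" if "0 \<le> s" for s \<omega>
      unfolding F_def using U_decay[OF g that B] B0 by (intro abs_ext0_le) auto
    have jm: "(\<lambda>(s, \<omega>). F (max 0 s) \<omega>) \<in> borel_measurable (borel \<Otimes>\<^sub>M M)"
      by (intro right_continuous_jointly_measurable Fm Frc)
    have bd: "\<bar>F s \<omega>\<bar> \<le> B * exp (b - a)" if "0 \<le> s" for s \<omega>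
    proof -
      have "(B * exp (b - a)) * exp (- decay_rate * s) \<le> (B * exp (b - a)) * 1"
        using that decay_rate_pos B0 by (intro mult_left_mono) auto
      then show ?thesis using Fle[OF that, of \<omega>] by simp
    qed
    have dec: "(\<integral>\<omega>. \<bar>F s \<omega>\<bar> \<partial>M) \<le> (B * exp (b - a)) * exp (- decay_rate * s)" if "0 \<le> s" for s
      using Fle[OF that] Fm[OF that] B0 by (intro integral_le_const integrable_const_bound[where B="(B * exp (b - a)) * exp (- decay_rate * s)"]) auto
    have "U h (RL_sol g) p = (\<integral>\<omega>. ext0 (\<lambda>y. RL_sol g (X t h \<omega>, y)) (Y x h \<omega>) \<partial>M)"
      unfolding p by (rule U_expectation[OF RL_sol_in_Ca0[OF g] h True])
    also have "\<dots> = (\<integral>\<omega>. (LINT s:{0..}|lborel. F s \<omega>) \<partial>M)"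
      by (intro Bochner_Integration.integral_cong) (auto simp: F_def ext0_eq RL_sol_def set_lebesgue_integral_def)
    also have "\<dots> = (LINT s:{0..}|lborel. (\<integral>\<omega>. F s \<omega> \<partial>M))"
      using time_Fubini(2)[OF jm bd dec decay_rate_pos] by simp
    also have "\<dots> = (LINT s:{0..}|lborel. U (h + s) g p)"
    proof (intro set_lebesgue_integral_cong allI impI)
      fix s :: real assume "s \<in> {0..}"
      then have s: "0 \<le> s" by simp
      have "U (h + s) g p = U h (U s g) p" using U.T_add[OF h s g] by simp
      then show "(\<integral>\<omega>. F s \<omega> \<partial>M) = U (h + s) g p"
        using U_expectation[OF U.T_in[OF s g] h True] by (simp add: F_def p)
    qed simp
    finally show ?thesis .
  next
    case False
    have "(LINT s:{0..}|lborel. U (h + s) g p) = (LINT s:{0::real..}|lborel. 0)"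
      using h False by (intro set_lebesgue_integral_cong) (auto simp: p U_outside[OF g])
    then show ?thesis using U_outside[OF RL_sol_in_Ca0[OF g] h False] by (simp add: p set_lebesgue_integral_def)
  qed
qed

text \<open>\<open>U s\<close> shifts the time integral by \<open>s\<close>, so the increment of
  \<open>RL_sol g\<close> under \<open>U s\<close> is minus the integral of the orbit over [0,s].
  That is the integrated generator equation with right-hand side -g.\<close>

lemma RL_sol_generator:
  assumes g: "g \<in> Ca0 a b"
  shows "RL_sol g \<in> gen_dom (Ca0 a b) U" "gen_op U (RL_sol g) = (\<lambda>p. - g p)"
proof -
  have mg: "(\<lambda>p. - g p) \<in> Ca0 a b" using U.scale_in[OF g, of "-1"] by simp
  have "((\<lambda>r. U r (\<lambda>p. - g p) p) has_integral (U s (RL_sol g) p - RL_sol g p)) {0..s}" if s: "0 < s" for s p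
  proof -
    let ?f = "\<lambda>r. U r g p"
    have s0: "0 \<le> s" using s by simp
    note int = U_orbit_integrable[OF g, of p]
    have i1: "set_integrable lborel {0..s} ?f" "set_integrable lborel {s<..} ?f"
      using int s0 by (auto elim!: set_integrable_subset)
    have sm: "set_borel_measurable lborel {0..} (\<lambda>r. U (s + r) g p)"
    proof -
      have "continuous_on {0..} (\<lambda>r. U (s + r) g p)"
        by (rule continuous_on_compose2[OF U.orbit_continuous[OF g]]) (auto intro!: continuous_intros simp: s0)
      from borel_measurable_continuous_on_indicator[OF _ this] show ?thesis
        by (simp add: set_borel_measurable_def)
    qed
    have split: "{0..} = {0..s} \<union> {s<..}" using s by auto
    have "RL_sol g p = (LINT r:{0..s}|lborel. ?f r) + (LINT r:{s<..}|lborel. ?f r)"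
      unfolding RL_sol_def split by (rule set_integral_Un) (use i1 in auto)
    also have "(LINT r:{s<..}|lborel. ?f r) = (LINT r:{0<..}|lborel. ?f (s + r))"
      unfolding set_lebesgue_integral_def
      by (subst lborel_integral_real_affine[where c=1 and t=s]) (auto simp: indicator_def intro!: Bochner_Integration.integral_cong)
    also have "\<dots> = (LINT r:{0..}|lborel. ?f (s + r))"
    proof (rule set_integral_cong_set)
      show "set_borel_measurable lborel {0<..} (\<lambda>r. U (s + r) g p)"
        by (rule set_borel_measurable_subset[OF sm]) auto
      show "AE r in lborel. (r \<in> {0::real..}) = (r \<in> {0<..})"
        by (rule AE_mp[OF AE_lborel_singleton[of "0::real"]]) (auto intro!: AE_I2)
    qed (rule sm)
    also have "\<dots> = U s (RL_sol g) p" using U_RL_sol[OF g s0] by simp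
    finally have "U s (RL_sol g) p - RL_sol g p = - (LINT r:{0..s}|lborel. ?f r)" by simp
    moreover have "(?f has_integral (LINT r:{0..s}|lborel. ?f r)) {0..s}"
      using set_borel_integral_eq_integral[OF i1(1)] integrable_integral by metis
    ultimately have hi: "((\<lambda>r. - ?f r) has_integral (U s (RL_sol g) p - RL_sol g p)) {0..s}"
      by (simp only: has_integral_neg)
    have "- ?f r = U r (\<lambda>p. - g p) p" if "r \<in> {0..s}" for r
      using fun_cong[OF U.T_scale[OF _ g, of r "-1"], of p] that by simp
    from has_integral_eq[OF this hi] show ?thesis .
  qed
  from U.gen_domI[OF RL_sol_in_Ca0[OF g] mg this]
  show "RL_sol g \<in> gen_dom (Ca0 a b) U" "gen_op U (RL_sol g) = (\<lambda>p. - g p)" by auto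
qed

text \<open>A solution minus its image under \<open>U n\<close> is the integral of the orbit of
  \<open>g\<close> over [0,n]. Exponential decay sends that image to 0, which forces the solution to
  be the full integral.\<close>

lemma RL_sol_unique:
  assumes g: "g \<in> Ca0 a b" and w: "w \<in> gen_dom (Ca0 a b) U" and gw: "gen_op U w = (\<lambda>p. - g p)"
  shows "w = RL_sol g"
proof
  fix p
  note wC = U.gen_domD(1)[OF w]
  obtain B where B: "\<And>p. \<bar>w p\<bar> \<le> B" using Ca0_bounded[OF wC] by (auto simp: bounded_iff)
  have int: "(LINT r:{0..real n}|lborel. U r g p) = w p - U (real n) w p" for n
  proof -
    have hi: "((\<lambda>r. U r (gen_op U w) p) has_integral (U (real n) w p - w p)) {0..real n}"
      by (rule U.gen_integral[OF w]) simp
    have "U r (gen_op U w) p = - U r g p" if "r \<in> {0..real n}" for r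
      using fun_cong[OF U.T_scale[OF _ g, of r "-1"], of p] that by (simp add: gw)
    from has_integral_neg[OF has_integral_eq[OF this hi]] have "integral {0..real n} (\<lambda>r. U r g p) = w p - U (real n) w p"
      by (auto intro: integral_unique)
    moreover have "set_integrable lborel {0..real n} (\<lambda>r. U r g p)"
      by (rule set_integrable_subset[OF U_orbit_integrable[OF g]]) auto
    ultimately show ?thesis by (simp add: set_borel_integral_eq_integral(2))
  qed
  have "(\<lambda>n. LINT r:{0..real n}|lborel. U r g p) \<longlonglongrightarrow> (LINT r:{0..}|lborel. U r g p)"
    unfolding set_lebesgue_integral_def
  proof (rule integral_dominated_convergence[where w="\<lambda>r. norm (indicator {0..} r *\<^sub>R U r g p)"])
    have i: "integrable lborel (\<lambda>r. indicator {0..} r *\<^sub>R U r g p)"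
      using U_orbit_integrable[OF g] unfolding set_integrable_def .
    then show "integrable lborel (\<lambda>r. norm (indicator {0..} r *\<^sub>R U r g p))" by simp
    show "(\<lambda>r. indicator {0..} r *\<^sub>R U r g p) \<in> borel_measurable lborel" using i by simp
    show "(\<lambda>r. indicator {0..real n} r *\<^sub>R U r g p) \<in> borel_measurable lborel" for n
      using set_integrable_subset[OF U_orbit_integrable[OF g], of "{0..real n}" p]
      unfolding set_integrable_def by (intro borel_measurable_integrable) auto
    show "AE r in lborel. (\<lambda>n. indicator {0..real n} r *\<^sub>R U r g p) \<longlonglongrightarrow> indicator {0..} r *\<^sub>R U r g p"
    proof (rule AE_I2)
      fix r :: real
      obtain N where N: "r \<le> real N" using real_arch_simple by blast
      have "indicator {0..real n} r *\<^sub>R U r g p = indicator {0..} r *\<^sub>R U r g p" if "n \<ge> N" for n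
        using N that by (auto simp: indicator_def)
      then show "(\<lambda>n. indicator {0..real n} r *\<^sub>R U r g p) \<longlonglongrightarrow> indicator {0..} r *\<^sub>R U r g p"
        by (intro tendsto_eventually eventually_sequentiallyI[of N])
    qed
    show "AE r in lborel. norm (indicator {0..real n} r *\<^sub>R U r g p) \<le> norm (indicator {0..} r *\<^sub>R U r g p)" for n
      by (intro AE_I2) (auto simp: indicator_def)
  qed
  moreover have "(\<lambda>n. w p - U (real n) w p) \<longlonglongrightarrow> w p - 0"
  proof (intro tendsto_diff tendsto_const)
    have "(\<lambda>n. (B * exp (b - a)) * exp (- decay_rate) ^ n) \<longlonglongrightarrow> (B * exp (b - a)) * 0"
      using decay_rate_pos by (intro tendsto_mult tendsto_const LIMSEQ_power_zero) auto
    then have lim: "(\<lambda>n. (B * exp (b - a)) * exp (- decay_rate) ^ n) \<longlonglongrightarrow> 0" by simp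
    have "norm (U (real n) w p) \<le> (B * exp (b - a)) * exp (- decay_rate) ^ n" for n
      using U_decay[OF wC _ B, of "real n" p] by (simp add: exp_of_nat_mult[symmetric] mult.commute)
    from Lim_null_comparison[OF always_eventually[OF allI[OF this]] lim]
    show "(\<lambda>n. U (real n) w p) \<longlonglongrightarrow> 0" .
  qed
  ultimately have "(LINT r:{0..}|lborel. U r g p) = w p - 0"
    unfolding int by (rule LIMSEQ_unique)
  then show "w p = RL_sol g p" by (simp add: RL_sol_def)
qed

lemma RL_solution_dom_iff: "RL_solution_dom a b T S g u \<longleftrightarrow> g \<in> Ca0 a b \<and> u = RL_sol g"
proof
  assume "RL_solution_dom a b T S g u"
  then have "g \<in> Ca0 a b" "u \<in> gen_dom (Ca0 a b) U" "gen_op U u = (\<lambda>p. - g p)"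
    by (auto simp: RL_solution_dom_def)
  then show "g \<in> Ca0 a b \<and> u = RL_sol g" by (intro conjI RL_sol_unique)
next
  assume "g \<in> Ca0 a b \<and> u = RL_sol g"
  then show "RL_solution_dom a b T S g u"
    using RL_sol_generator[of g] by (simp add: RL_solution_dom_def)
qed

end

section \<open>The Caputo problem\<close>

lemma const_in_time_C0:
  fixes f :: "'a::euclidean_space \<Rightarrow> real"
  assumes f: "f \<in> C0 UNIV"
  shows "const_in_time a b f \<in> C0 ({a..b} \<times> UNIV)"
proof -
  have c: "continuous_on UNIV f" using f by (simp add: C0_def)
  have "continuous_on ({a..b} \<times> UNIV) (\<lambda>p. f (snd p))"
    by (intro continuous_on_compose2[OF c] continuous_intros) auto
  then have "continuous_on ({a..b} \<times> UNIV) (const_in_time a b f)"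
    by (rule continuous_on_eq) (auto simp: const_in_time_def)
  moreover have "\<exists>K. compact K \<and> K \<subseteq> {a..b} \<times> UNIV \<and> (\<forall>p\<in>{a..b} \<times> UNIV - K. \<bar>const_in_time a b f p\<bar> < e)"
    if e: "e > 0" for e
  proof -
    obtain K where K: "compact K" "K \<subseteq> UNIV" "\<And>x. x \<in> UNIV - K \<Longrightarrow> \<bar>f x\<bar> < e"
      using C0_small_off_compact[OF f e] by metis
    have "\<bar>const_in_time a b f p\<bar> < e" if "p \<in> {a..b} \<times> UNIV - {a..b} \<times> K" for p
    proof -
      have "snd p \<notin> K" using that by (cases p) auto
      then have "\<bar>f (snd p)\<bar> < e" using K(3) by simp
      then show ?thesis using that by (auto simp: const_in_time_def)
    qed
    then show ?thesis using K(1) by (intro exI[of _ "{a..b} \<times> K"]) (auto intro!: compact_Times)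
  qed
  ultimately show ?thesis by (auto simp: C0_def const_in_time_def)
qed

lemma C0_strip_borel: "f \<in> C0 ({a..b} \<times> UNIV) \<Longrightarrow> f \<in> borel_measurable borel"
  for f :: "real \<times> 'a::euclidean_space \<Rightarrow> real"
  by (rule C0_borel) (auto intro: closed_Times)

section \<open>Dynkin's formula and the stochastic representation\<close>

context caputo_problem
begin

lemma domA: "\<phi> \<in> domA \<Longrightarrow> \<phi> \<in> gen_dom (C0 UNIV) S" "\<phi> \<in> domA \<Longrightarrow> gen_op S \<phi> = A \<phi>"
  "\<phi> \<in> domA \<Longrightarrow> \<phi> \<in> C0 UNIV" "\<phi> \<in> domA \<Longrightarrow> A \<phi> \<in> C0 UNIV"
  using gen_S by (auto simp: generates_def gen_dom_def)

text \<open>The cut-off of \<open>const_in_time\<close> outside [a,b] is invisible, because paths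
  stay below \<open>b\<close> and \<open>alive\<close> discards the rest. What remains is a function
  of X times a function of Y, and independence factors it.\<close>

lemma expectation_killed_const:
  assumes t: "t \<in> {a..b}" and s: "0 \<le> s" and f: "f \<in> C0 UNIV"
  shows "(\<integral>\<omega>. killed (const_in_time a b f) t x s \<omega> \<partial>M) = (\<integral>\<omega>. alive (X t s \<omega>) * S s f x \<partial>M)"
proof -
  interpret Xt: decreasing_process M b t P "X t" by (rule decreasing[OF t])
  note fm = C0_borel[OF f closed_UNIV]
  obtain B where B: "\<And>y. \<bar>f y\<bar> \<le> B" using C0_bounded[OF f] by (auto simp: bounded_iff)
  have B0: "0 \<le> B" using B[of undefined] by linarith
  define h where "h z \<omega> = alive z * ext0 f (Y x s \<omega>)" for z \<omega>
  have "(\<integral>\<omega>. killed (const_in_time a b f) t x s \<omega> \<partial>M) = (\<integral>\<omega>. h (X t s \<omega>) \<omega> \<partial>M)"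
    using Xt.le_b[OF _ s]
    by (intro Bochner_Integration.integral_cong)
      (auto simp: killed_def h_def indicator_def const_in_time_def ext0_eq)
  also have "\<dots> = (\<integral>\<omega>'. (\<integral>\<omega>. h (X t s \<omega>') \<omega> \<partial>M) \<partial>M)"
  proof (rule XY_indep_integral[where x=x and B=B, OF t Xt.X_measurable_FX[OF s]])
    have "(\<lambda>p. alive (fst p) * ext0 f (Y x s (snd p))) \<in> borel_measurable (borel \<Otimes>\<^sub>M FY x)"
      by (intro borel_measurable_times measurable_ext0 fm measurable_compose[OF measurable_snd Y_measurable_FY] s) measurable
    then show "(\<lambda>(z, \<omega>). h z \<omega>) \<in> borel_measurable (borel \<Otimes>\<^sub>M FY x)"
      by (simp add: h_def case_prod_beta)
    show "\<bar>h z \<omega>\<bar> \<le> B" for z \<omega>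
      using B B0 by (auto simp: h_def indicator_def ext0_eq)
  qed
  also have "\<dots> = (\<integral>\<omega>. alive (X t s \<omega>) * S s f x \<partial>M)"
    by (simp add: h_def S_expectation[OF f s])
  finally show ?thesis .
qed

text \<open>An infinite hitting time forces the path above \<open>a\<close> at every integer time,
  and the probability of that decays geometrically.\<close>

lemma hitting_time_finite_AE:
  assumes t: "t \<in> {a..b}"
  shows "AE \<omega> in M. hitting_time a (X t) \<omega> \<noteq> \<infinity>"
proof -
  interpret Xt: decreasing_process M b t P "X t" by (rule decreasing[OF t])
  have hm: "hitting_time a (X t) \<in> borel_measurable M"
    using measurable_from_subalg[OF Xt.FX_subalgebra Xt.hitting_time_measurable] .
  define N where "N = {\<omega> \<in> space M. hitting_time a (X t) \<omega> = \<infinity>}"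
  have N: "N \<in> sets M" unfolding N_def using hm by measurable
  have le: "prob N \<le> exp (b - a) * exp (- decay_rate) ^ n" for n
  proof -
    have "prob N = (\<integral>\<omega>. indicator N \<omega> \<partial>M)" using N by simp
    also have "\<dots> \<le> (\<integral>\<omega>. alive (X t (real n) \<omega>) \<partial>M)"
    proof (rule integral_mono)
      show "integrable M (\<lambda>\<omega>. alive (X t (real n) \<omega>))"
        using Xt.X_measurable[of "real n"] by (intro integrable_const_bound[where B=1]) auto
      show "indicator N \<omega> \<le> alive (X t (real n) \<omega>)" if "\<omega> \<in> space M" for \<omega>
        using Xt.less_hitting_time_iff[OF that, of "real n" a] by (auto simp: N_def indicator_def)
      show "integrable M (\<lambda>\<omega>. indicator N \<omega> :: real)"
        using N by (intro integrable_const_bound[where B=1]) auto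
    qed
    also have "\<dots> \<le> exp (b - a) * exp (- decay_rate * real n)" by (rule survival_decay[OF t]) simp
    finally show ?thesis by (simp add: exp_of_nat_mult[symmetric] mult.commute)
  qed
  have "(\<lambda>n. exp (b - a) * exp (- decay_rate) ^ n) \<longlonglongrightarrow> exp (b - a) * 0"
    using decay_rate_pos by (intro tendsto_mult tendsto_const LIMSEQ_power_zero) auto
  then have "prob N \<le> exp (b - a) * 0" by (rule LIMSEQ_le_const) (use le in auto)
  then have "prob N = 0" using measure_nonneg[of M N] by simp
  then have "N \<in> null_sets M" using N by (simp add: emeasure_eq_measure null_setsI)
  from AE_not_in[OF this] show ?thesis
    by (rule AE_mp) (auto simp: N_def intro!: AE_I2)
qed

text \<open>The hitting time is a function of X alone, so by independence Y may be evaluated at it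
  as at a deterministic time, giving \<open>S\<close> at time \<tau> without optional stopping. The
  integrated generator equation of \<open>S\<close> produces \<open>A \<phi>\<close>, and r < \<tau>
  is rewritten as X(r) > a before averaging over X.\<close>

lemma Dynkin_at_hitting_time:
  assumes t: "t \<in> {a..b}" and \<phi>: "\<phi> \<in> domA"
  shows "(\<integral>\<omega>. (if hitting_time a (X t) \<omega> = \<infinity> then 0
      else ext0 \<phi> (Y x (real_of_ereal (hitting_time a (X t) \<omega>)) \<omega>)) \<partial>M) =
    \<phi> x + potential (const_in_time a b (A \<phi>)) t x"
proof -
  interpret Xt: decreasing_process M b t P "X t" by (rule decreasing[OF t])
  note fC = domA(3)[OF \<phi>] and AC = domA(4)[OF \<phi>]
  note fm = C0_borel[OF fC closed_UNIV]
  obtain B where B: "\<And>y. \<bar>\<phi> y\<bar> \<le> B" using C0_bounded[OF fC] by (auto simp: bounded_iff)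
  have B0: "0 \<le> B" using B[of undefined] by linarith
  obtain C where C: "\<And>y. \<bar>A \<phi> y\<bar> \<le> C" using C0_bounded[OF AC] by (auto simp: bounded_iff)
  have C0: "0 \<le> C" using C[of undefined] by linarith
  \<comment> \<open>\<open>real_of_ereal\<close> sends \<infinity> to 0, so \<tau> is 0 on paths
    that never reach \<open>a\<close>; comparing \<tau> with times requires finiteness.\<close>
  define \<tau> where "\<tau> \<omega> = real_of_ereal (hitting_time a (X t) \<omega>)" for \<omega>
  have \<tau>0: "0 \<le> \<tau> \<omega>" for \<omega> unfolding \<tau>_def by (intro real_of_ereal_pos Xt.hitting_time_nonneg)
  have \<tau>FX: "\<tau> \<in> borel_measurable (FX t)"
    unfolding \<tau>_def using Xt.hitting_time_measurable[of a] by measurable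
  have \<tau>m: "\<tau> \<in> borel_measurable M" using measurable_from_subalg[OF Xt.FX_subalgebra \<tau>FX] .
  have \<tau>: "r < \<tau> \<omega> \<longleftrightarrow> a < X t r \<omega>" if "\<omega> \<in> space M" "0 \<le> r" "hitting_time a (X t) \<omega> \<noteq> \<infinity>" for r \<omega>
    using Xt.less_hitting_time_iff[OF that(1,2), of a] Xt.hitting_time_nonneg[of a \<omega>] that(3)
    by (cases "hitting_time a (X t) \<omega>") (auto simp: \<tau>_def)
  note fin = hitting_time_finite_AE[OF t]
  define h where "h z \<omega> = ext0 \<phi> (Y x (max 0 z) \<omega>)" for z \<omega>
  have hm: "(\<lambda>(z, \<omega>). h z \<omega>) \<in> borel_measurable (borel \<Otimes>\<^sub>M FY x)"
  proof -
    have "(\<lambda>p. Y x (max 0 (fst p)) (snd p)) \<in> measurable (borel \<Otimes>\<^sub>M FY x) compactified_borel"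
      using feller_jointly_measurable[OF Y_process _ Y_measurable_FY, of x] by (simp add: case_prod_beta)
    from measurable_ext0[OF fm this] show ?thesis by (simp add: h_def case_prod_beta)
  qed
  have hle: "\<bar>h z \<omega>\<bar> \<le> B" for z \<omega> using B B0 by (auto simp: h_def ext0_eq)
  have h\<tau>: "(\<lambda>\<omega>. h (\<tau> \<omega>) \<omega>) \<in> borel_measurable M"
  proof -
    have "(\<lambda>\<omega>. (\<tau> \<omega>, \<omega>)) \<in> measurable M (borel \<Otimes>\<^sub>M FY x)"
      using measurable_from_subalg[OF FY_subalgebra measurable_ident] \<tau>m
      by (intro measurable_Pair) (auto simp: id_def)
    from measurable_compose[OF this hm] show ?thesis by simp
  qed
  define F where "F r \<omega> = alive (X t r \<omega>) * S r (A \<phi>) x" for r \<omega>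
  have Sm: "(\<lambda>r. S (max 0 r) f x) \<in> borel_measurable borel" if "f \<in> C0 UNIV" for f
    by (intro borel_measurable_continuous_onI continuous_on_compose2[OF S.orbit_continuous[OF that]])
      (auto intro!: continuous_intros)
  have jm: "(\<lambda>(r, \<omega>). F (max 0 r) \<omega>) \<in> borel_measurable (borel \<Otimes>\<^sub>M M)"
  proof -
    have X: "(\<lambda>p. X t (max 0 (fst p)) (snd p)) \<in> borel_measurable (borel \<Otimes>\<^sub>M M)"
      using Xt.X_jointly_measurable by (simp add: case_prod_beta)
    have "(\<lambda>p. alive (X t (max 0 (fst p)) (snd p)) * S (max 0 (fst p)) (A \<phi>) x) \<in> borel_measurable (borel \<Otimes>\<^sub>M M)"
      using X measurable_compose[OF measurable_fst Sm[OF AC], of M] by (intro borel_measurable_times) measurable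
    then show ?thesis by (simp add: F_def case_prod_beta)
  qed
  have Fle: "\<bar>F r \<omega>\<bar> \<le> C * alive (X t r \<omega>)" if "0 \<le> r" for r \<omega>
    using S.T_le[OF that AC C, of x] by (auto simp: F_def indicator_def)
  have Fbd: "\<bar>F r \<omega>\<bar> \<le> C" if "0 \<le> r" for r \<omega>
    using Fle[OF that, of \<omega>] C0 by (cases "a < X t r \<omega>") auto
  have Fdec: "(\<integral>\<omega>. \<bar>F r \<omega>\<bar> \<partial>M) \<le> (C * exp (b - a)) * exp (- decay_rate * r)" if r: "0 \<le> r" for r
  proof -
    have "(\<integral>\<omega>. \<bar>F r \<omega>\<bar> \<partial>M) \<le> (\<integral>\<omega>. C * alive (X t r \<omega>) \<partial>M)"
    proof (rule integral_mono)
      show "integrable M (\<lambda>\<omega>. C * alive (X t r \<omega>))"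
        using Xt.X_measurable[OF r] C0 by (intro integrable_const_bound[where B=C]) (auto simp: indicator_def)
      show "integrable M (\<lambda>\<omega>. \<bar>F r \<omega>\<bar>)"
        using Xt.X_measurable[OF r] Fbd[OF r] by (intro integrable_const_bound[where B=C]) (auto simp: F_def)
    qed (use Fle[OF r] in auto)
    also have "\<dots> \<le> C * (exp (b - a) * exp (- decay_rate * r))" using survival_decay[OF t r] C0 by (simp add: mult_left_mono)
    finally show ?thesis by (simp add: mult.assoc)
  qed
  note Fub = time_Fubini[OF jm Fbd Fdec decay_rate_pos]
  have path: "S (max 0 (\<tau> \<omega>)) \<phi> x = \<phi> x + (LINT r:{0..}|lborel. F r \<omega>)"
    if \<omega>: "\<omega> \<in> space M" "hitting_time a (X t) \<omega> \<noteq> \<infinity>" for \<omega>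
  proof -
    let ?s = "\<tau> \<omega>"
    have hi: "((\<lambda>r. S r (A \<phi>) x) has_integral (S ?s \<phi> x - \<phi> x)) {0..?s}"
      using S.gen_integral[OF domA(1)[OF \<phi>] \<tau>0[of \<omega>], of x] domA(2)[OF \<phi>] by simp
    have "continuous_on {0..?s} (\<lambda>r. S r (A \<phi>) x)"
      by (rule continuous_on_subset[OF S.orbit_continuous[OF AC]]) auto
    then have si: "set_integrable lborel {0..?s} (\<lambda>r. S r (A \<phi>) x)"
      unfolding set_integrable_def by (intro borel_integrable_compact) auto
    have "S ?s \<phi> x - \<phi> x = (LINT r:{0..?s}|lborel. S r (A \<phi>) x)"
      using hi set_borel_integral_eq_integral(2)[OF si] by (simp add: integral_unique)
    \<comment> \<open>Dropping the end point matches the strict comparison r < \<tau>, the one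
      equivalent to X(r) > a.\<close>
    also have "\<dots> = (LINT r:{0..<?s}|lborel. S r (A \<phi>) x)"
    proof (rule set_integral_cong_set)
      show "set_borel_measurable lborel {0..?s} (\<lambda>r. S r (A \<phi>) x)"
        using si unfolding set_integrable_def set_borel_measurable_def by (rule borel_measurable_integrable)
      then show "set_borel_measurable lborel {0..<?s} (\<lambda>r. S r (A \<phi>) x)"
        by (rule set_borel_measurable_subset) auto
      show "AE r in lborel. (r \<in> {0..<?s}) = (r \<in> {0..?s})"
        by (rule AE_mp[OF AE_lborel_singleton[of ?s]]) (auto intro!: AE_I2)
    qed
    also have "\<dots> = (LINT r:{0..}|lborel. F r \<omega>)"
      unfolding set_lebesgue_integral_def using \<tau>[OF \<omega>(1) _ \<omega>(2)]
      by (intro Bochner_Integration.integral_cong) (auto simp: F_def indicator_def)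
    finally show ?thesis using \<tau>0[of \<omega>] by simp
  qed
  have "(\<integral>\<omega>. (if hitting_time a (X t) \<omega> = \<infinity> then 0
      else ext0 \<phi> (Y x (real_of_ereal (hitting_time a (X t) \<omega>)) \<omega>)) \<partial>M) = (\<integral>\<omega>. h (\<tau> \<omega>) \<omega> \<partial>M)"
  proof (rule integral_cong_AE)
    have hit: "hitting_time a (X t) \<in> borel_measurable M"
      using measurable_from_subalg[OF Xt.FX_subalgebra Xt.hitting_time_measurable] .
    have "(\<lambda>\<omega>. if hitting_time a (X t) \<omega> = \<infinity> then 0 else h (\<tau> \<omega>) \<omega>) \<in> borel_measurable M"
      using hit h\<tau> by measurable
    then show "(\<lambda>\<omega>. if hitting_time a (X t) \<omega> = \<infinity> then 0
      else ext0 \<phi> (Y x (real_of_ereal (hitting_time a (X t) \<omega>)) \<omega>)) \<in> borel_measurable M"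
      by (simp only: h_def max_absorb2[OF \<tau>0]) (simp only: \<tau>_def)
    show "AE \<omega> in M. (if hitting_time a (X t) \<omega> = \<infinity> then 0
      else ext0 \<phi> (Y x (real_of_ereal (hitting_time a (X t) \<omega>)) \<omega>)) = h (\<tau> \<omega>) \<omega>"
      using fin
    proof eventually_elim
      case (elim \<omega>)
      have "max 0 (\<tau> \<omega>) = real_of_ereal (hitting_time a (X t) \<omega>)" using \<tau>0[of \<omega>] by (simp add: \<tau>_def)
      then show ?case using elim by (simp only: h_def if_False)
    qed
  qed (rule h\<tau>)
  also have "\<dots> = (\<integral>\<omega>'. (\<integral>\<omega>. h (\<tau> \<omega>') \<omega> \<partial>M) \<partial>M)"
    by (rule XY_indep_integral[where x=x, OF t \<tau>FX hm hle])
  also have "\<dots> = (\<integral>\<omega>. S (max 0 (\<tau> \<omega>)) \<phi> x \<partial>M)"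
    by (simp add: h_def S_expectation[OF fC])
  also have "\<dots> = (\<integral>\<omega>. \<phi> x + (LINT r:{0..}|lborel. F r \<omega>) \<partial>M)"
  proof (rule integral_cong_AE)
    show "(\<lambda>\<omega>. S (max 0 (\<tau> \<omega>)) \<phi> x) \<in> borel_measurable M"
      using measurable_compose[OF \<tau>m Sm[OF fC]] .
    show "(\<lambda>\<omega>. \<phi> x + (LINT r:{0..}|lborel. F r \<omega>)) \<in> borel_measurable M"
      by (intro borel_measurable_add borel_measurable_const borel_measurable_integrable Fub(3))
    show "AE \<omega> in M. S (max 0 (\<tau> \<omega>)) \<phi> x = \<phi> x + (LINT r:{0..}|lborel. F r \<omega>)"
      by (rule AE_mp[OF fin]) (use path in \<open>auto intro!: AE_I2\<close>)
  qed
  also have "\<dots> = \<phi> x + (\<integral>\<omega>. (LINT r:{0..}|lborel. F r \<omega>) \<partial>M)"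
    using Fub(3) by (simp add: prob_space)
  also have "(\<integral>\<omega>. (LINT r:{0..}|lborel. F r \<omega>) \<partial>M) = (LINT r:{0..}|lborel. (\<integral>\<omega>. F r \<omega> \<partial>M))"
    by (rule Fub(2)[symmetric])
  also have "\<dots> = potential (const_in_time a b (A \<phi>)) t x"
    unfolding potential_def F_def
    by (intro set_lebesgue_integral_cong) (auto simp: expectation_killed_const[OF t _ AC])
  finally show ?thesis .
qed

text \<open>Dynkin's formula accounts for \<open>\<phi> x\<close> and for the
  \<open>A \<phi>\<close> part of the shifted source, the integral of \<open>g\<close> up to the
  hitting time for the rest. Both notions of solution end in this identity.\<close>

lemma stochastic_rep_eq:
  assumes t: "t \<in> {a..b}" and \<phi>: "\<phi> \<in> domA" and g: "g \<in> borel_measurable borel" "\<And>p. \<bar>g p\<bar> \<le> B"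
  shows "stochastic_rep M a (X t) (Y x) \<phi> g = potential (\<lambda>p. g p + const_in_time a b (A \<phi>) p) t x + \<phi> x"
proof -
  note cC = const_in_time_C0[OF domA(4)[OF \<phi>], of a b]
  obtain C where C: "\<And>p. \<bar>const_in_time a b (A \<phi>) p\<bar> \<le> C" using C0_bounded[OF cC] by (auto simp: bounded_iff)
  show ?thesis
    unfolding stochastic_rep_def Dynkin_at_hitting_time[OF t \<phi>] potential_eq_stochastic[OF t g, symmetric]
      potential_add[OF t g C0_strip_borel[OF cC] C] by simp
qed

lemma Caputo_dom_solvable:
  assumes g: "g \<in> C0 ({a..b} \<times> UNIV)" and \<phi>: "\<phi> \<in> domA" and compat: "\<And>x. A \<phi> x = - g (a, x)"
  shows "\<exists>u \<in> C0 ({a..b} \<times> UNIV). Caputo_solution_dom a b T S domA A g \<phi> u \<and>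
    (\<forall>v. Caputo_solution_dom a b T S domA A g \<phi> v \<longrightarrow> v = u) \<and>
    (\<forall>t\<in>{a..b}. \<forall>x. u (t, x) = stochastic_rep M a (X t) (Y x) \<phi> g)"
proof -
  define g' where "g' p = g p + const_in_time a b (A \<phi>) p" for p
  define u where "u p = RL_sol g' p + const_in_time a b \<phi> p" for p
  obtain B where B: "\<And>p. \<bar>g p\<bar> \<le> B" using C0_bounded[OF g] by (auto simp: bounded_iff)
  have "g' \<in> C0 ({a..b} \<times> UNIV)"
    using C0_lincomb[OF g const_in_time_C0[OF domA(4)[OF \<phi>]], of 1 1] by (simp add: g'_def[abs_def])
  \<comment> \<open>The compatibility condition is exactly the vanishing of the shifted source at t
    = a.\<close>
  then have g': "g' \<in> Ca0 a b"
    using compat ab by (auto simp: Ca0_def g'_def const_in_time_def)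
  have "RL_sol g' \<in> C0 ({a..b} \<times> UNIV)" using RL_sol_in_Ca0[OF g'] by (simp add: Ca0_def)
  from C0_lincomb[OF this const_in_time_C0[OF domA(3)[OF \<phi>]], of 1 1]
  have "u \<in> C0 ({a..b} \<times> UNIV)" by (simp add: u_def[abs_def])
  moreover have iff: "Caputo_solution_dom a b T S domA A g \<phi> v \<longleftrightarrow> v = u" for v
    unfolding Caputo_solution_dom_def g'_def[symmetric] RL_solution_dom_iff
    using g' \<phi> compat by (auto simp: u_def[abs_def])
  moreover have "u (t, x) = stochastic_rep M a (X t) (Y x) \<phi> g" if t: "t \<in> {a..b}" for t x
    unfolding stochastic_rep_eq[OF t \<phi> C0_strip_borel[OF g] B] u_def RL_sol_potential[OF g' t]
    using t by (simp add: g'_def[abs_def] const_in_time_def)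
  ultimately show ?thesis by (intro bexI[of _ u]) auto
qed

text \<open>Almost every section of \<open>N\<close> at fixed time is null; the law of X(s) sees
  almost surely only such sections, and the law of Y(s) on its survival event does not charge them.
  Independence joins the two laws.\<close>

lemma joint_law_null:
  assumes t: "t \<in> {a..b}" and s: "0 < s" and N: "N \<in> null_sets (lborel :: (real \<times> 'a) measure)"
    and acX: "absolutely_continuous lborel (distr M borel (X t s))"
    and acY: "absolutely_continuous lborel (law_on_space M (Y x s))"
  shows "AE \<omega> in M. Y x s \<omega> \<noteq> None \<longrightarrow> (X t s \<omega>, the (Y x s \<omega>)) \<notin> N"
proof -
  interpret Xt: decreasing_process M b t P "X t" by (rule decreasing[OF t])
  have s0: "0 \<le> s" using s by simp
  note Xm = Xt.X_measurable[OF s0] and Ym = Y_measurable[OF s0, of x]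
  have Ns: "N \<in> sets borel" using N by auto
  let ?D = "{\<omega> \<in> space M. Y x s \<omega> \<noteq> None}"
  have D: "?D \<inter> space M \<in> sets M"
  proof -
    have "{\<omega> \<in> space M. Y x s \<omega> = None} \<in> sets M"
      using measurable_compose[OF Ym measurable_is_None] by (simp add: pred_def)
    then have "space M - {\<omega> \<in> space M. Y x s \<omega> = None} \<in> sets M" by blast
    moreover have "space M - {\<omega> \<in> space M. Y x s \<omega> = None} = ?D \<inter> space M" by auto
    ultimately show ?thesis by simp
  qed
  have inner: "(\<integral>\<omega>. ext0 (\<lambda>y. indicator N (z, y)) (Y x s \<omega>) \<partial>M) = (0 :: real)"
    if "AE y in lborel. (z, y) \<notin> N" for z
  proof -
    have "AE y in law_on_space M (Y x s). (z, y) \<notin> N"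
      by (rule absolutely_continuous_AE[OF _ acY that]) (simp add: law_on_space_def)
    then have "AE \<omega> in restrict_space M ?D. (z, the (Y x s \<omega>)) \<notin> N"
      unfolding law_on_space_def
      by (rule AE_distrD[rotated]) (intro measurable_restrict_space1 measurable_compose[OF Ym measurable_the])
    then have "AE \<omega> in M. ext0 (\<lambda>y. indicator N (z, y)) (Y x s \<omega>) = (0 :: real)"
      unfolding AE_restrict_space_iff[OF D] by (rule AE_mp) (auto simp: ext0_eq intro!: AE_I2)
    then show ?thesis by (rule integral_eq_zero_AE)
  qed
  have "AE p in (lborel :: real measure) \<Otimes>\<^sub>M (lborel :: 'a measure). p \<notin> N"
    unfolding lborel_prod by (rule AE_not_in[OF N])
  then have ae: "AE z in lborel. AE y in lborel. (z, y) \<notin> N" by (rule lborel_pair.AE_pair)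
  have "AE z in distr M borel (X t s). AE y in lborel. (z, y) \<notin> N"
    by (rule absolutely_continuous_AE[OF _ acX ae]) simp
  then have "AE \<omega>' in M. AE y in lborel. (X t s \<omega>', y) \<notin> N"
    by (rule AE_distrD[OF Xm])
  then have "AE \<omega>' in M. (\<integral>\<omega>. ext0 (\<lambda>y. indicator N (X t s \<omega>', y)) (Y x s \<omega>) \<partial>M) = (0 :: real)"
    by (rule AE_mp) (auto intro!: AE_I2 inner)
  then have zero: "(\<integral>\<omega>'. (\<integral>\<omega>. ext0 (\<lambda>y. indicator N (X t s \<omega>', y)) (Y x s \<omega>) \<partial>M) \<partial>M) = (0 :: real)"
    by (rule integral_eq_zero_AE)
  have im: "indicator N \<in> borel_measurable (borel :: (real \<times> 'a) measure)" using Ns by simp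
  have "(\<integral>\<omega>. ext0 (\<lambda>y. indicator N (X t s \<omega>, y)) (Y x s \<omega>) \<partial>M) = (0 :: real)"
    using pair_integral[OF t s0 s0 im, of 1 x] zero by (simp add: indicator_def)
  moreover have "integrable M (\<lambda>\<omega>. ext0 (\<lambda>y. indicator N (X t s \<omega>, y)) (Y x s \<omega>) :: real)"
    by (intro integrable_const_bound[where B=1] measurable_ext0_pair im Xm Ym) (auto simp: ext0_eq indicator_def)
  ultimately have "AE \<omega> in M. ext0 (\<lambda>y. indicator N (X t s \<omega>, y)) (Y x s \<omega>) = (0 :: real)"
    by (subst (asm) integral_nonneg_eq_0_iff_AE) (auto simp: ext0_eq)
  then show ?thesis by (rule AE_mp) (auto simp: ext0_eq indicator_def intro!: AE_I2)
qed

text \<open>Two dominated convergences, one over the sample space at fixed s > 0 and one over time.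
  At s = 0 the pair sits at a single point, where the sources need not converge, but this one time
  is Lebesgue null.\<close>

lemma potential_limit:
  assumes t: "t \<in> {a..b}"
    and acX: "\<And>s. 0 < s \<Longrightarrow> absolutely_continuous lborel (distr M borel (X t s))"
    and acY: "\<And>s. 0 < s \<Longrightarrow> absolutely_continuous lborel (law_on_space M (Y x s))"
    and h: "\<And>n. h n \<in> borel_measurable borel" "\<And>n p. \<bar>h n p\<bar> \<le> B"
    and g: "g \<in> borel_measurable borel" "\<And>p. \<bar>g p\<bar> \<le> B"
    and lim: "AE p in lborel. (\<lambda>n. h n p) \<longlonglongrightarrow> g p"
  shows "(\<lambda>n. potential (h n) t x) \<longlonglongrightarrow> potential g t x"
proof -
  obtain N where N: "{p \<in> space lborel. \<not> (\<lambda>n. h n p) \<longlonglongrightarrow> g p} \<subseteq> N" "emeasure lborel N = 0" "N \<in> sets lborel"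
    using AE_E[OF lim] by blast
  then have N0: "N \<in> null_sets lborel" by (intro null_setsI)
  have conv: "(\<lambda>n. h n p) \<longlonglongrightarrow> g p" if "p \<notin> N" for p using N(1) that by auto
  have at_time: "(\<lambda>n. \<integral>\<omega>. killed (h n) t x s \<omega> \<partial>M) \<longlonglongrightarrow> (\<integral>\<omega>. killed g t x s \<omega> \<partial>M)" if s: "0 < s" for s
  proof (rule integral_dominated_convergence[where w="\<lambda>_. B"])
    have s0: "0 \<le> s" using s by simp
    show "killed g t x s \<in> borel_measurable M" "killed (h n) t x s \<in> borel_measurable M" for n
      by (intro killed_measurable t s0 g h)+
    show "AE \<omega> in M. (\<lambda>n. killed (h n) t x s \<omega>) \<longlonglongrightarrow> killed g t x s \<omega>"
    proof (rule AE_mp[OF joint_law_null[OF t s N0 acX[OF s] acY[OF s]]], rule AE_I2, rule impI)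
      fix \<omega> assume "Y x s \<omega> \<noteq> None \<longrightarrow> (X t s \<omega>, the (Y x s \<omega>)) \<notin> N"
      then show "(\<lambda>n. killed (h n) t x s \<omega>) \<longlonglongrightarrow> killed g t x s \<omega>"
        unfolding killed_def ext0_eq using conv by (auto intro!: tendsto_mult tendsto_const)
    qed
    show "AE \<omega> in M. norm (killed (h n) t x s \<omega>) \<le> B" for n
    proof (rule AE_I2)
      fix \<omega>
      have "B * alive (X t s \<omega>) \<le> B" using g(2)[of undefined] by (auto simp: indicator_def)
      then show "norm (killed (h n) t x s \<omega>) \<le> B" using killed_le[of "h n" B t x s \<omega>, OF h(2)] by simp
    qed
  qed simp
  have si: "integrable lborel (\<lambda>s. indicator {0..} s *\<^sub>R (\<integral>\<omega>. killed k t x s \<omega> \<partial>M))"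
    if "k \<in> borel_measurable borel" "\<And>p. \<bar>k p\<bar> \<le> B" for k
    using killed_Fubini(1)[OF t that] unfolding set_integrable_def .
  show ?thesis
    unfolding potential_def set_lebesgue_integral_def
  proof (rule integral_dominated_convergence[where w="\<lambda>s. indicator {0..} s *\<^sub>R ((B * exp (b - a)) * exp (- decay_rate * s))"])
    show "integrable lborel (\<lambda>s. indicator {0..} s *\<^sub>R ((B * exp (b - a)) * exp (- decay_rate * s)))"
      using set_integrable_exp_decay[OF decay_rate_pos] unfolding set_integrable_def .
    show "AE s in lborel. (\<lambda>n. indicator {0..} s *\<^sub>R (\<integral>\<omega>. killed (h n) t x s \<omega> \<partial>M)) \<longlonglongrightarrow>
        indicator {0..} s *\<^sub>R (\<integral>\<omega>. killed g t x s \<omega> \<partial>M)"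
      by (rule AE_mp[OF AE_lborel_singleton[of "0::real"]], rule AE_I2)
        (use at_time in \<open>auto simp: indicator_def\<close>)
    show "AE s in lborel. norm (indicator {0..} s *\<^sub>R (\<integral>\<omega>. killed (h n) t x s \<omega> \<partial>M))
        \<le> indicator {0..} s *\<^sub>R ((B * exp (b - a)) * exp (- decay_rate * s))" for n
    proof (rule AE_I2)
      fix s :: real
      show "norm (indicator {0..} s *\<^sub>R (\<integral>\<omega>. killed (h n) t x s \<omega> \<partial>M))
        \<le> indicator {0..} s *\<^sub>R ((B * exp (b - a)) * exp (- decay_rate * s))"
      proof (cases "0 \<le> s")
        case True
        have "\<bar>\<integral>\<omega>. killed (h n) t x s \<omega> \<partial>M\<bar> \<le> (\<integral>\<omega>. \<bar>killed (h n) t x s \<omega>\<bar> \<partial>M)" by (rule integral_abs_bound)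
        also note killed_decay[OF t True h]
        finally show ?thesis using True by simp
      qed simp
    qed
  qed (use si g h in auto)
qed

end

text \<open>The almost everywhere approximation by continuous functions comes from Lusin-type
  measurability; truncating the range and cutting off near \<open>t = a\<close> and at infinity preserves it.\<close>

lemma Ca0_dense_ae:
  fixes g :: "real \<times> 'a::euclidean_space \<Rightarrow> real"
  assumes g: "g \<in> borel_measurable borel" "\<And>p. \<bar>g p\<bar> \<le> B" "\<And>p. p \<notin> {a..b} \<times> UNIV \<Longrightarrow> g p = 0"
  obtains h where "\<And>n::nat. h n \<in> Ca0 a b" "\<And>n p. \<bar>h n p\<bar> \<le> B" "AE p in lborel. (\<lambda>n. h n p) \<longlonglongrightarrow> g p"
proof -
  have B0: "0 \<le> B" using g(2)[of undefined] by linarith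
  have "g \<in> borel_measurable lebesgue" using g(1) by (simp add: measurable_completion)
  then have "g measurable_on UNIV" by (intro lebesgue_measurable_imp_measurable_on) auto
  then obtain N k where N: "negligible N" and k: "\<And>n::nat. continuous_on UNIV (k n)"
    and lim: "\<And>p. p \<notin> N \<Longrightarrow> (\<lambda>n. k n p) \<longlonglongrightarrow> g p"
    unfolding measurable_on_def by auto
  \<comment> \<open>The first factor is 0 at t = a and 1 as soon as n * (t - a) \<ge> 1; the second
    is 0 for norm x \<ge> n and 1 for norm x \<le> n - 1; the third keeps the bound \<open>B\<close>
    and fixes the value \<open>g p\<close> in the limit.\<close>
  define h where "h n p = (if fst p \<in> {a..b} then min 1 (real n * (fst p - a)) * max 0 (min 1 (real n - norm (snd p)))
      * max (- B) (min B (k n p)) else 0)" for n :: nat and p :: "real \<times> 'a"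
  have hle: "\<bar>h n p\<bar> \<le> B" for n p
  proof (cases "fst p \<in> {a..b}")
    case True
    then have "\<bar>min 1 (real n * (fst p - a))\<bar> \<le> 1" by (auto simp: abs_le_iff min_def)
    moreover have "\<bar>max 0 (min 1 (real n - norm (snd p)))\<bar> \<le> 1" by auto
    moreover have "\<bar>max (- B) (min B (k n p))\<bar> \<le> B" using B0 by auto
    ultimately have "\<bar>min 1 (real n * (fst p - a))\<bar> * \<bar>max 0 (min 1 (real n - norm (snd p)))\<bar> * \<bar>max (- B) (min B (k n p))\<bar> \<le> 1 * 1 * B"
      by (intro mult_mono) auto
    then show ?thesis using True by (simp add: h_def abs_mult)
  qed (use B0 in \<open>auto simp: h_def\<close>)
  have "h n \<in> Ca0 a b" for n
    unfolding Ca0_iff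
  proof (intro conjI allI impI)
    have "continuous_on ({a..b} \<times> UNIV) (\<lambda>p. min 1 (real n * (fst p - a)) * max 0 (min 1 (real n - norm (snd p)))
      * max (- B) (min B (k n p)))"
      by (intro continuous_intros continuous_on_subset[OF k]) auto
    then show "continuous_on ({a..b} \<times> UNIV) (h n)"
      by (rule continuous_on_eq) (auto simp: h_def)
    show "\<exists>R. \<forall>t x. R < norm x \<longrightarrow> \<bar>h n (t, x)\<bar> < e" if "0 < e" for e
      using that by (intro exI[of _ "real n"]) (auto simp: h_def max_def min_def)
  qed (auto simp: h_def)
  moreover have "AE p in lborel. (\<lambda>n. h n p) \<longlonglongrightarrow> g p"
  proof -
    \<comment> \<open>On the hyperplane t = a the first cut-off stays 0 for every \<open>n\<close>,
      so this null set joins the exceptional one.\<close>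
    have "(1, 0) \<in> (Basis :: (real \<times> 'a) set)" by (simp add: Basis_prod_def)
    then have "negligible {p :: real \<times> 'a. p \<bullet> (1, 0) = a}" by (rule negligible_standard_hyperplane)
    moreover have "{p :: real \<times> 'a. p \<bullet> (1, 0) = a} = {p. fst p = a}" by (auto simp: inner_prod_def)
    ultimately have "N \<union> {p. fst p = a} \<in> null_sets lebesgue"
      using N by (simp add: negligible_iff_null_sets[symmetric])
    then have "AE p in completion lborel. p \<notin> N \<union> {p. fst p = a}" by (rule AE_not_in)
    then have "AE p in lborel. p \<notin> N \<union> {p. fst p = a}" by (simp only: AE_completion_iff)
    then show ?thesis
    proof (rule AE_mp, intro AE_I2 impI)
      fix p assume p: "p \<notin> N \<union> {p. fst p = a}"
      show "(\<lambda>n. h n p) \<longlonglongrightarrow> g p"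
      proof (cases "fst p \<in> {a..b}")
        case False
        then show ?thesis using g(3)[of p] by (cases p) (auto simp: h_def)
      next
        case True
        then have gt: "fst p - a > 0" using p by auto
        obtain n1 where n1: "1 / (fst p - a) \<le> real n1" using real_arch_simple by blast
        obtain n2 where n2: "1 + norm (snd p) \<le> real n2" using real_arch_simple by blast
        have "max (- B) (min B (k n p)) = h n p" if n: "n \<ge> max n1 n2" for n
        proof -
          have "1 \<le> real n1 * (fst p - a)" using n1 gt by (simp add: field_simps)
          also have "\<dots> \<le> real n * (fst p - a)" using n gt by (intro mult_right_mono) auto
          finally have "min 1 (real n * (fst p - a)) = 1" by simp
          moreover have "max 0 (min 1 (real n - norm (snd p))) = 1" using n2 n by auto
          ultimately show ?thesis using True by (simp add: h_def)
        qed
        then have "eventually (\<lambda>n. max (- B) (min B (k n p)) = h n p) sequentially"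
          by (rule eventually_sequentiallyI)
        moreover have "(\<lambda>n. max (- B) (min B (k n p))) \<longlonglongrightarrow> max (- B) (min B (g p))"
          using p by (intro tendsto_max tendsto_min tendsto_const lim) auto
        moreover have "max (- B) (min B (g p)) = g p" using g(2)[of p] by auto
        ultimately show ?thesis using Lim_transform_eventually by metis
      qed
    qed
  qed
  ultimately show ?thesis using that hle by blast
qed

section \<open>Generalised solutions\<close>

context caputo_problem
begin

text \<open>For every admissible sequence of sources, not just a chosen one, the solutions converge
  to the potential of \<open>g\<close>; this is uniqueness. Existence takes the sequence of
  \<open>Ca0_dense_ae\<close>, and the limit inherits measurability and boundedness from the
  approximating solutions.\<close>

lemma RL_solution_gen_iff:
  assumes acX: "\<And>t s. t \<in> {a..b} \<Longrightarrow> 0 < s \<Longrightarrow> absolutely_continuous lborel (distr M borel (X t s))"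
    and acY: "\<And>x s. 0 < s \<Longrightarrow> absolutely_continuous lborel (law_on_space M (Y x s))"
    and g: "g \<in> bounded_borel ({a..b} \<times> UNIV)"
  shows "RL_solution_gen a b T S g u \<longleftrightarrow> u = (\<lambda>(t, x). if t \<in> {a..b} then potential g t x else 0)"
    (is "_ \<longleftrightarrow> u = ?v")
proof -
  obtain B where B: "\<And>p. \<bar>g p\<bar> \<le> B" using g by (auto simp: bounded_borel_def bounded_iff)
  have gm: "g \<in> borel_measurable borel" and g0: "\<And>p. p \<notin> {a..b} \<times> UNIV \<Longrightarrow> g p = 0"
    using g by (auto simp: bounded_borel_def)
  have conv: "(\<lambda>n. RL_sol (h n) p) \<longlonglongrightarrow> ?v p"
    if h: "\<And>n::nat. h n \<in> Ca0 a b" "\<And>n p. \<bar>h n p\<bar> \<le> C" and lim: "AE p in lborel. (\<lambda>n. h n p) \<longlonglongrightarrow> g p" for h C p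
  proof -
    obtain t x where p: "p = (t, x)" by force
    show ?thesis
    proof (cases "t \<in> {a..b}")
      case True
      \<comment> \<open>\<open>potential_limit\<close> asks for one bound on the sources and their
        limit, while \<open>C\<close> bounds only the sequence; hence the maximum of
        \<open>B\<close> and \<open>C\<close>.\<close>
      have "(\<lambda>n. potential (h n) t x) \<longlonglongrightarrow> potential g t x"
        by (rule potential_limit[where B="max B C", OF True acX[OF True] acY])
          (use h Ca0_borel[OF h(1)] gm B lim in \<open>auto simp: le_max_iff_disj\<close>)
      then show ?thesis using True by (simp add: p RL_sol_potential[OF h(1) True])
    next
      case False then show ?thesis by (auto simp: p RL_sol_outside[OF h(1) False])
    qed
  qed
  show ?thesis
  proof
    assume "RL_solution_gen a b T S g u"
    then obtain gs us where gs: "\<And>n::nat. RL_solution_dom a b T S (gs n) (us n)"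
      and lim: "AE p in lborel. (\<lambda>n. gs n p) \<longlonglongrightarrow> g p" and bdd: "bdd_above (range (\<lambda>n. sup_norm (gs n)))"
      and us: "\<And>p. (\<lambda>n. us n p) \<longlonglongrightarrow> u p"
      unfolding RL_solution_gen_def by blast
    have gC: "gs n \<in> Ca0 a b" and us_eq: "us n = RL_sol (gs n)" for n using gs[of n] by (auto simp: RL_solution_dom_iff)
    obtain C where C: "\<And>n. sup_norm (gs n) \<le> C" using bdd by (auto simp: bdd_above_def)
    have "\<bar>gs n p\<bar> \<le> C" for n p using abs_le_sup_norm[OF Ca0_bounded[OF gC]] C order_trans by metis
    from conv[OF gC this lim] us show "u = ?v"
      unfolding us_eq by (intro ext) (rule LIMSEQ_unique)
  next
    assume u: "u = ?v"
    obtain h where h: "\<And>n::nat. h n \<in> Ca0 a b" "\<And>n p. \<bar>h n p\<bar> \<le> B" "AE p in lborel. (\<lambda>n. h n p) \<longlonglongrightarrow> g p"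
      using Ca0_dense_ae[OF gm B g0] by metis
    have lim: "(\<lambda>n. RL_sol (h n) p) \<longlonglongrightarrow> ?v p" for p by (rule conv[OF h])
    have um: "?v \<in> borel_measurable borel"
      by (rule borel_measurable_LIMSEQ_real[OF lim]) (intro Ca0_borel[OF RL_sol_in_Ca0] h(1))
    \<comment> \<open>Integrating the decay estimate over time bounds all
      \<open>RL_sol (h n)\<close> at once.\<close>
    define K where "K = (LINT s:{0..}|lborel. (B * exp (b - a)) * exp (- decay_rate * s))"
    have "\<bar>RL_sol (h n) p\<bar> \<le> K" for n p
    proof -
      have "\<bar>RL_sol (h n) p\<bar> \<le> (LINT s:{0..}|lborel. \<bar>U s (h n) p\<bar>)"
        unfolding RL_sol_def using set_integral_norm_bound[OF U_orbit_integrable[OF h(1)]] by simp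
      also have "\<dots> \<le> K"
        unfolding K_def using U_decay[OF h(1) _ h(2)] set_integrable_norm[OF U_orbit_integrable[OF h(1)]]
        by (intro set_integral_mono set_integrable_exp_decay[OF decay_rate_pos]) auto
      finally show ?thesis .
    qed
    then have "\<bar>?v p\<bar> \<le> K" for p
      by (intro LIMSEQ_le_const2[OF tendsto_rabs[OF lim]]) auto
    then have "bounded (range ?v)" unfolding bounded_iff by (intro exI[of _ K]) auto
    then have "?v \<in> bounded_borel ({a..b} \<times> UNIV)" using um by (auto simp: bounded_borel_def)
    moreover have "bdd_above (range (\<lambda>n. sup_norm (h n)))"
    proof -
      have "sup_norm (h n) \<le> B" for n by (rule sup_norm_le[OF h(2)])
      then show ?thesis by (auto simp: bdd_above_def)
    qed
    ultimately show "RL_solution_gen a b T S g u"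
      unfolding RL_solution_gen_def u using g h lim
      by (intro conjI exI[of _ h] exI[of _ "\<lambda>n. RL_sol (h n)"]) (auto simp: RL_solution_dom_iff)
  qed
qed

lemma Caputo_gen_solvable:
  assumes acX: "\<And>t s. t \<in> {a..b} \<Longrightarrow> 0 < s \<Longrightarrow> absolutely_continuous lborel (distr M borel (X t s))"
    and acY: "\<And>x s. 0 < s \<Longrightarrow> absolutely_continuous lborel (law_on_space M (Y x s))"
    and g: "g \<in> bounded_borel ({a..b} \<times> UNIV)" and \<phi>: "\<phi> \<in> domA"
  shows "\<exists>u \<in> bounded_borel ({a..b} \<times> UNIV). Caputo_solution_gen a b T S domA A g \<phi> u \<and>
    (\<forall>v. Caputo_solution_gen a b T S domA A g \<phi> v \<longrightarrow> v = u) \<and>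
    (\<forall>t\<in>{a..b}. \<forall>x. u (t, x) = stochastic_rep M a (X t) (Y x) \<phi> g)"
proof -
  have C0_bb: "f \<in> bounded_borel ({a..b} \<times> UNIV)" if "f \<in> C0 ({a..b} \<times> UNIV)" for f :: "real \<times> 'a \<Rightarrow> real"
    using C0_strip_borel[OF that] C0_bounded[OF that] that by (auto simp: bounded_borel_def C0_def)
  have add: "(\<lambda>p. f p + k p) \<in> bounded_borel ({a..b} \<times> UNIV)"
    if "f \<in> bounded_borel ({a..b} \<times> UNIV)" "k \<in> bounded_borel ({a..b} \<times> UNIV)" for f k :: "real \<times> 'a \<Rightarrow> real"
    using that bounded_plus_comp[of f UNIV k] by (auto simp: bounded_borel_def)
  obtain B where B: "\<And>p. \<bar>g p\<bar> \<le> B" using g by (auto simp: bounded_borel_def bounded_iff)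
  have gm: "g \<in> borel_measurable borel" using g by (simp add: bounded_borel_def)
  define g' where "g' p = g p + const_in_time a b (A \<phi>) p" for p
  have g': "g' \<in> bounded_borel ({a..b} \<times> UNIV)"
    unfolding g'_def[abs_def] by (rule add[OF g C0_bb[OF const_in_time_C0[OF domA(4)[OF \<phi>]]]])
  define v where "v = (\<lambda>(t, x). if t \<in> {a..b} then potential g' t x else 0)"
  have v: "RL_solution_gen a b T S g' w \<longleftrightarrow> w = v" for w
    unfolding v_def by (rule RL_solution_gen_iff[OF acX acY g'])
  define u where "u p = v p + const_in_time a b \<phi> p" for p
  have "v \<in> bounded_borel ({a..b} \<times> UNIV)" using v[of v] by (simp add: RL_solution_gen_def)
  then have "u \<in> bounded_borel ({a..b} \<times> UNIV)"
    unfolding u_def[abs_def] by (rule add[OF _ C0_bb[OF const_in_time_C0[OF domA(3)[OF \<phi>]]]])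
  moreover have "Caputo_solution_gen a b T S domA A g \<phi> w \<longleftrightarrow> w = u" for w
    unfolding Caputo_solution_gen_def g'_def[symmetric] v using \<phi> by (auto simp: u_def[abs_def])
  moreover have "u (t, x) = stochastic_rep M a (X t) (Y x) \<phi> g" if t: "t \<in> {a..b}" for t x
    unfolding stochastic_rep_eq[OF t \<phi> gm B] using t by (simp add: u_def v_def g'_def[abs_def] const_in_time_def)
  ultimately show ?thesis by (intro bexI[of _ u]) auto
qed

end

theorem theorem4p20:
  fixes a b :: real
    and \<nu> :: "real \<Rightarrow> real \<Rightarrow> real"
    and P T :: "real \<Rightarrow> (real \<Rightarrow> real) \<Rightarrow> (real \<Rightarrow> real)"
    and S :: "real \<Rightarrow> (real ^ 'd \<Rightarrow> real) \<Rightarrow> (real ^ 'd \<Rightarrow> real)"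
    and domA :: "(real ^ 'd \<Rightarrow> real) set"
    and A :: "(real ^ 'd \<Rightarrow> real) \<Rightarrow> (real ^ 'd \<Rightarrow> real)"
    and M :: "'w measure"
    and X :: "real \<Rightarrow> real \<Rightarrow> 'w \<Rightarrow> real"
    and Y :: "real ^ 'd \<Rightarrow> real \<Rightarrow> 'w \<Rightarrow> (real ^ 'd) option"
  assumes "a < b" and "H0 \<nu>" and "H1a \<nu>"
    and "generates_D_plus b \<nu> P"
    and "generates_D_RL a b \<nu> T"
    and "generates (C0 UNIV) domA A S" and "Cinf_0 \<subseteq> domA"
    and "\<And>t. t \<in> {a..b} \<Longrightarrow> decreasing_feller_process M b P t (X t)"
    and "\<And>x. feller_process M UNIV S x (Y x)"
    and "\<And>t x. t \<in> {a..b} \<Longrightarrow> indep_processes M (\<lambda>s \<omega>. Some (X t s \<omega>)) (Y x)"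
  shows
    "(\<forall>g \<phi>. g \<in> C0 ({a..b} \<times> UNIV) \<and> \<phi> \<in> domA \<and> (\<forall>x. A \<phi> x = - g (a, x)) \<longrightarrow>
        (\<exists>u \<in> C0 ({a..b} \<times> UNIV).
           Caputo_solution_dom a b T S domA A g \<phi> u \<and>
           (\<forall>v. Caputo_solution_dom a b T S domA A g \<phi> v \<longrightarrow> v = u) \<and>
           (\<forall>t\<in>{a..b}. \<forall>x. u (t, x) = stochastic_rep M a (X t) (Y x) \<phi> g))) \<and>
     (H2 M a b X Y \<longrightarrow>
        (\<forall>g \<phi>. g \<in> bounded_borel ({a..b} \<times> UNIV) \<and> \<phi> \<in> domA \<longrightarrow>
          (\<exists>u \<in> bounded_borel ({a..b} \<times> UNIV).
             Caputo_solution_gen a b T S domA A g \<phi> u \<and>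
             (\<forall>v. Caputo_solution_gen a b T S domA A g \<phi> v \<longrightarrow> v = u) \<and>
             (\<forall>t\<in>{a..b}. \<forall>x. u (t, x) = stochastic_rep M a (X t) (Y x) \<phi> g))))"
proof -
  interpret caputo_problem a b \<nu> P T S domA A M X Y
    by unfold_locales (fact assms)+
  show ?thesis
  proof (intro conjI allI impI; elim conjE)
    fix g \<phi> assume "g \<in> C0 ({a..b} \<times> UNIV)" "\<phi> \<in> domA" "\<forall>x. A \<phi> x = - g (a, x)"
    then show "\<exists>u \<in> C0 ({a..b} \<times> UNIV).
           Caputo_solution_dom a b T S domA A g \<phi> u \<and>
           (\<forall>v. Caputo_solution_dom a b T S domA A g \<phi> v \<longrightarrow> v = u) \<and>
           (\<forall>t\<in>{a..b}. \<forall>x. u (t, x) = stochastic_rep M a (X t) (Y x) \<phi> g)"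
      by (intro Caputo_dom_solvable) auto
  next
    fix g :: "real \<times> (real ^ 'd) \<Rightarrow> real" and \<phi>
    assume H2: "H2 M a b X Y" and g: "g \<in> bounded_borel ({a..b} \<times> UNIV)" "\<phi> \<in> domA"
    have acX: "absolutely_continuous lborel (distr M borel (X t s))" if "t \<in> {a..b}" "0 < s" for t s
      using H2 that by (auto simp: H2_def)
    \<comment> \<open>\<open>H2\<close> states both laws for each \<open>t\<close>; the spatial part
      is read off at t = a, which lies in [a,b] because a < b.\<close>
    have acY: "absolutely_continuous lborel (law_on_space M (Y x s))" if "0 < s" for x s
      using H2 that \<open>a < b\<close> by (auto simp: H2_def dest: bspec[of _ _ a])
    show "\<exists>u \<in> bounded_borel ({a..b} \<times> UNIV).
             Caputo_solution_gen a b T S domA A g \<phi> u \<and>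
             (\<forall>v. Caputo_solution_gen a b T S domA A g \<phi> v \<longrightarrow> v = u) \<and>
             (\<forall>t\<in>{a..b}. \<forall>x. u (t, x) = stochastic_rep M a (X t) (Y x) \<phi> g)"
      by (rule Caputo_gen_solvable[OF acX acY g])
  qed
qed

end
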